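(* Let $(E,[\cdot,\cdot]_E,\rho)$ be a Lie algebroid over $M$, let $S$ be a spray on the prolongation $\pounds^\pi E$, let $\mathcal H$ be the Berwald connection of $S$, and let $\eta\in\Gamma(E)$ be a Lie symmetry of $S$, i.e. $\llbracket S,\eta^C\rrbracket=0$. Then $\eta^C$ is a curvature collineation of the Berwald curvature $\mathcal B$ of $S$, i.e. $\widetilde{\mathcal L}_{\eta^C}\mathcal B=0$.
   Context: **Lie algebroid and prolongation.** $\pi:E\to M$ is a smooth vector bundle with a Lie algebroid structure $([\cdot,\cdot]_E,\rho)$: a Lie bracket on $\Gamma(E)$ and a bundle map (anchor) $\rho:E\to TM$ with $[\xi,f\eta]_E=f[\xi,\eta]_E+(\rho(\xi)f)\eta$. The prolongation is $\pounds^\pi E=\{(u,z)\in E\times TE:\rho(u)=\pi_*(z)\}$, a vector bundle over $E$ with projection $\pi_\pounds(u,z)=v$ for $z\in T_vE$. It is a Lie algebroid over $E$ with anchor $\rho_\pounds(u,z)=z$ and the bracket $\llbracket\cdot,\cdot\rrbracket$ determined by the Leibniz rule and, for sections of the form $(X\circ\pi,U)$, $(Y\circ\pi,W)$ with $X,Y\in\Gamma(E)$ and $U,W$ vector fields on $E$ that are $\pi$-related to $\rho(X),\rho(Y)$, by $\llbracket (X\circ\pi,U),(Y\circ\pi,W)\rrbracket=([X,Y]_E\circ\pi,[U,W])$. **Pullback bundle, $i$, $j$.** $\pi^*E=E\times_ME\to E$ is the pullback bundle (projection to the first factor); its $C^\infty(E)$-module of sections is written $\Gamma(\pi^*\pi)$.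 For $\eta\in\Gamma(E)$, $\widehat\eta(u)=(u,\eta(\pi(u)))$; $\delta(u)=(u,u)$. The bundle maps $i:\pi^*E\to\pounds^\pi E$, $i(u,v)=(0,\frac{d}{dt}|_{t=0}(u+tv))$, and $j:\pounds^\pi E\to\pi^*E$, $j(u,z)=(v,u)$ for $z\in T_vE$, form a short exact sequence $0\to\pi^*E\to\pounds^\pi E\to\pi^*E\to0$. Put $J=i\circ j$ and $C=i\circ\delta$ (Liouville section). **Lifts.** For $\eta\in\Gamma(E)$: the vertical lift is $\eta^V=i(\widehat\eta)$; the complete lift is $\eta^C(u)=(\eta(\pi(u)),\eta^c(u))$, where $\eta^c$ is the unique vector field on $E$ that is $\pi$-projectable onto $\rho(\eta)$ and satisfies $\eta^c(\widehat\theta)=\widehat{\pounds^E_\eta\theta}$ for all $\theta\in\Gamma(E^* )$, with $\widehat\theta(u)=\theta_{\pi(u)}(u)$ and $(\pounds^E_\eta\theta)(\xi)=\rho(\eta)(\theta(\xi))-\theta([\eta,\xi]_E)$. **Spray and Berwald connection.** A semispray is a section $S$ of $\pounds^\pi E$ with $J(S)=C$; it is a spray if moreover $\llbracket C,S\rrbracket=S$. An Ehresmann connection is a $C^\infty(E)$-linear map $\mathcal H:\Gamma(\pi^*\pi)\to\Gamma(\pounds^\pi E)$ with $j\circ\mathcal H=\mathrm{id}$; its vertical map $\mathcal V:\Gamma(\pounds^\pi E)\to\Gamma(\pi^*\pi)$ is the $C^\infty(E)$-linear map with $\mathcal V\circ i=\mathrm{id}$ and $\ker\mathcal V=\operatorname{Im}\mathcal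 H$. The Berwald connection of a spray $S$ is the Ehresmann connection with $\mathcal H(\widehat\eta)=\tfrac12(\eta^C+\llbracket\eta^V,S\rrbracket)$ for all $\eta\in\Gamma(E)$. **Vertical and $h$-Berwald differentials.** For $\bar\xi\in\Gamma(\pi^*\pi)$ and $F\in C^\infty(E)$: $\nabla^v_{\bar\xi}F=\rho_\pounds(i\bar\xi)F$, and $\nabla^v_{\bar\xi}\bar\eta=j\llbracket i\bar\xi,\widetilde\sigma\rrbracket$ for any $\widetilde\sigma$ with $j\widetilde\sigma=\bar\eta$; $\nabla^h_{\bar\xi}F=\rho_\pounds(\mathcal H\bar\xi)F$, and $\nabla^h_{\bar\xi}\bar\eta=\mathcal V\llbracket\mathcal H\bar\xi,i\bar\eta\rrbracket$. These are extended to all tensors on $\pi^*\pi$ as tensor derivations (commuting with contractions); $(\nabla^vA)(\bar\xi,\dots)=(\nabla^v_{\bar\xi}A)(\dots)$, and similarly for $\nabla^h$. **Lie derivation.** A section $\widetilde\xi$ of $\pounds^\pi E$ is projectable if its first component is $X\circ\pi$ for some $X\in\Gamma(E)$ ($\eta^C$ and $\eta^V$ are projectable). For projectable $\widetilde\xi$, $\widetilde{\mathcal L}_{\widetilde\xi}$ is the tensor derivation on tensors of $\pi^*\pi$ with $\widetilde{\mathcal L}_{\widetilde\xi}F=\rho_\pounds(\widetilde\xi)F$ and $\widetilde{\mathcal L}_{\widetilde\xi}\bar\eta=i^{-1}\llbracket\widetilde\xi,i\bar\eta\rrbracket$. A projectable section $\widetilde\xi$ is a curvature collineation of a tensor $A$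 of type $(1,k)$, $k\in\{1,2,3\}$, on $\pi^*\pi$ if $\widetilde{\mathcal L}_{\widetilde\xi}A=0$. **Berwald curvature.** $\mathcal B$ is the $(1,3)$-tensor on $\pi^*\pi$ determined by $\mathcal B(\widehat\eta,\widehat\xi)\widehat\sigma=(\nabla^v\nabla^h\widehat\sigma)(\widehat\eta,\widehat\xi)=\nabla^v_{\widehat\eta}\nabla^h_{\widehat\xi}\widehat\sigma$ for $\eta,\xi,\sigma\in\Gamma(E)$, extended $C^\infty(E)$-linearly, where $\mathcal H$ is the Berwald connection of $S$. *)

theory Defs
  imports "HOL-Analysis.Analysis"
begin

section \<open>Smooth manifolds\<close>

text \<open>Model spaces are finite-dimensional real inner product spaces instead of
  \<open>euclidean_space\<close> types, because the latter have dimension at least one; in this way base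
  manifolds of dimension zero (Lie algebras) and bundles of rank zero are included.\<close>

primrec k_smooth_on ::
    "nat \<Rightarrow> 'a::real_normed_vector set \<Rightarrow> ('a \<Rightarrow> 'b::real_normed_vector) \<Rightarrow> bool" where
  "k_smooth_on 0 S f \<longleftrightarrow> continuous_on S f"
| "k_smooth_on (Suc k) S f \<longleftrightarrow>
     (\<forall>x\<in>S. f differentiable (at x)) \<and>
     (\<forall>v. k_smooth_on k S (\<lambda>x. frechet_derivative f (at x) v))"

text \<open>To be used on open sets \<open>S\<close> only.\<close>
definition smooth_on ::
    "'a::real_normed_vector set \<Rightarrow> ('a \<Rightarrow> 'b::real_normed_vector) \<Rightarrow> bool" where
  "smooth_on S f \<longleftrightarrow> (\<forall>k. k_smooth_on k S f)"

type_synonym ('m, 'a) atlas = "('m set \<times> ('m \<Rightarrow> 'a)) set"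

definition smooth_atlas ::
    "('m::{t2_space,second_countable_topology}, 'a::real_inner) atlas \<Rightarrow> bool" where
  "smooth_atlas A \<longleftrightarrow>
     (\<exists>B::'a set. finite B \<and> span B = UNIV) \<and>
     (\<forall>(U, \<phi>)\<in>A. open U \<and> open (\<phi> ` U) \<and> homeomorphism U (\<phi> ` U) \<phi> (inv_into U \<phi>)) \<and>
     (\<Union>(U, \<phi>)\<in>A. U) = UNIV \<and>
     (\<forall>(U, \<phi>)\<in>A. \<forall>(V, \<psi>)\<in>A. smooth_on (\<phi> ` (U \<inter> V)) (\<psi> \<circ> inv_into U \<phi>))"

definition smooth_funs :: "('m, 'a::real_inner) atlas \<Rightarrow> ('m \<Rightarrow> real) set" where
  "smooth_funs A = {f. \<forall>(U, \<phi>)\<in>A. smooth_on (\<phi> ` U) (f \<circ> inv_into U \<phi>)}"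

definition smooth_map ::
    "('m::topological_space, 'a::real_inner) atlas \<Rightarrow>
     ('n::topological_space, 'b::real_inner) atlas \<Rightarrow> ('m \<Rightarrow> 'n) \<Rightarrow> bool" where
  "smooth_map A B F \<longleftrightarrow>
     continuous_on UNIV F \<and>
     (\<forall>(U, \<phi>)\<in>A. \<forall>(V, \<psi>)\<in>B. smooth_on (\<phi> ` (U \<inter> F -` V)) (\<psi> \<circ> F \<circ> inv_into U \<phi>))"

text \<open>A tangent vector is a pair of its base point and the directional derivative it defines on
  smooth functions, set to \<open>0\<close> on all other functions so that equality of tangent vectors
  is equality in HOL. The base point is recorded because the zero vectors at different points
  define the same functional.\<close>
type_synonym 'm tvec = "'m \<times> (('m \<Rightarrow> real) \<Rightarrow> real)"

definition tangent_space :: "('m, 'a::real_inner) atlas \<Rightarrow> 'm \<Rightarrow> 'm tvec set" where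
  "tangent_space A p =
     {(p, \<lambda>f. if f \<in> smooth_funs A
              then frechet_derivative (f \<circ> inv_into U \<phi>) (at (\<phi> p)) v else 0)
      | U \<phi> v. (U, \<phi>) \<in> A \<and> p \<in> U}"

definition vector_fields :: "('m, 'a::real_inner) atlas \<Rightarrow> ('m \<Rightarrow> 'm tvec) set" where
  "vector_fields A =
     {X. (\<forall>p. X p \<in> tangent_space A p) \<and>
         (\<forall>f\<in>smooth_funs A. (\<lambda>p. snd (X p) f) \<in> smooth_funs A)}"

definition vf_bracket ::
    "('m, 'a::real_inner) atlas \<Rightarrow> ('m \<Rightarrow> 'm tvec) \<Rightarrow> ('m \<Rightarrow> 'm tvec) \<Rightarrow> 'm \<Rightarrow> 'm tvec" where
  "vf_bracket A X Y = (\<lambda>p. (p, \<lambda>f. if f \<in> smooth_funs A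
     then snd (X p) (\<lambda>q. snd (Y q) f) - snd (Y p) (\<lambda>q. snd (X q) f) else 0))"

definition pushforward ::
    "('n, 'b::real_inner) atlas \<Rightarrow> ('m \<Rightarrow> 'n) \<Rightarrow> 'm tvec \<Rightarrow> 'n tvec" where
  "pushforward B F z = (F (fst z), \<lambda>f. if f \<in> smooth_funs B then snd z (f \<circ> F) else 0)"


section \<open>Modules of sections\<close>

definition module_hom ::
    "('p \<Rightarrow> real) set \<Rightarrow>
     's set \<Rightarrow> ('s \<Rightarrow> 's \<Rightarrow> 's) \<Rightarrow> (('p \<Rightarrow> real) \<Rightarrow> 's \<Rightarrow> 's) \<Rightarrow>
     't set \<Rightarrow> ('t \<Rightarrow> 't \<Rightarrow> 't) \<Rightarrow> (('p \<Rightarrow> real) \<Rightarrow> 't \<Rightarrow> 't) \<Rightarrow> ('s \<Rightarrow> 't) \<Rightarrow> bool" where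
  "module_hom R \<Gamma> add smul \<Gamma>' add' smul' h \<longleftrightarrow>
     (\<forall>x\<in>\<Gamma>. h x \<in> \<Gamma>') \<and>
     (\<forall>x\<in>\<Gamma>. \<forall>y\<in>\<Gamma>. h (add x y) = add' (h x) (h y)) \<and>
     (\<forall>f\<in>R. \<forall>x\<in>\<Gamma>. h (smul f x) = smul' f (h x))"

text \<open>Lie bracket on a module \<open>\<Gamma>\<close> of sections over the ring \<open>R\<close> of smooth functions,
  with the Leibniz rule for the anchor; \<open>act x f\<close> is the derivative of \<open>f\<close> along the image
  of \<open>x\<close> under the anchor.\<close>
definition lie_algebroid_bracket ::
    "('p \<Rightarrow> real) set \<Rightarrow> 's set \<Rightarrow> ('s \<Rightarrow> 's \<Rightarrow> 's) \<Rightarrow> (('p \<Rightarrow> real) \<Rightarrow> 's \<Rightarrow> 's) \<Rightarrow>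
     ('s \<Rightarrow> ('p \<Rightarrow> real) \<Rightarrow> ('p \<Rightarrow> real)) \<Rightarrow> ('s \<Rightarrow> 's \<Rightarrow> 's) \<Rightarrow> bool" where
  "lie_algebroid_bracket R \<Gamma> add smul act br \<longleftrightarrow>
     (\<forall>x\<in>\<Gamma>. \<forall>y\<in>\<Gamma>. br x y \<in> \<Gamma>) \<and>
     (\<forall>x\<in>\<Gamma>. \<forall>y\<in>\<Gamma>. \<forall>z\<in>\<Gamma>. br x (add y z) = add (br x y) (br x z)) \<and>
     (\<forall>x\<in>\<Gamma>. \<forall>y\<in>\<Gamma>. \<forall>c. br x (smul (\<lambda>_. c) y) = smul (\<lambda>_. c) (br x y)) \<and>
     (\<forall>x\<in>\<Gamma>. \<forall>y\<in>\<Gamma>. br y x = smul (\<lambda>_. - 1) (br x y)) \<and>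
     (\<forall>x\<in>\<Gamma>. \<forall>y\<in>\<Gamma>. \<forall>z\<in>\<Gamma>. br x (br y z) = add (br (br x y) z) (br y (br x z))) \<and>
     (\<forall>x\<in>\<Gamma>. \<forall>y\<in>\<Gamma>. \<forall>f\<in>R. br x (smul f y) = add (smul f (br x y)) (smul (act x f) y))"


section \<open>Vector bundles and Lie algebroids\<close>

text \<open>\<open>fadd\<close> is meaningful for two elements of the same fibre. \<open>trivs\<close> is a set of local
  trivializations \<open>(W, \<psi>)\<close>, where \<open>\<psi>\<close> is the fibre component of the trivialization
  \<open>u \<mapsto> (proj u, \<psi> u)\<close> over \<open>W\<close>. \<open>lbr\<close> is meaningful for smooth sections.\<close>
record ('m, 'e, 'a, 'b) algebroid =
  base_atlas :: "('m, 'a) atlas"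
  proj :: "'e \<Rightarrow> 'm"
  fadd :: "'e \<Rightarrow> 'e \<Rightarrow> 'e"
  fscale :: "real \<Rightarrow> 'e \<Rightarrow> 'e"
  trivs :: "('m set \<times> ('e \<Rightarrow> 'b)) set"
  anchor :: "'e \<Rightarrow> 'm tvec"
  lbr :: "('m \<Rightarrow> 'e) \<Rightarrow> ('m \<Rightarrow> 'e) \<Rightarrow> 'm \<Rightarrow> 'e"

definition total_atlas :: "('m, 'e, 'a, 'b) algebroid \<Rightarrow> ('e, 'a \<times> 'b) atlas" where
  "total_atlas G = {(proj G -` (U \<inter> W), \<lambda>u. (\<phi> (proj G u), \<psi> u)) | U \<phi> W \<psi>.
      (U, \<phi>) \<in> base_atlas G \<and> (W, \<psi>) \<in> trivs G}"

text \<open>The last condition says that the local trivializations are homeomorphisms with smooth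
  transition maps. The vector space axioms in the fibres follow from the fibrewise bijections
  with the model space.\<close>
definition vector_bundle ::
    "('m::{t2_space,second_countable_topology}, 'e::{t2_space,second_countable_topology},
      'a::real_inner, 'b::real_inner) algebroid \<Rightarrow> bool" where
  "vector_bundle G \<longleftrightarrow>
     smooth_atlas (base_atlas G) \<and>
     (\<forall>u v. proj G u = proj G v \<longrightarrow> proj G (fadd G u v) = proj G u) \<and>
     (\<forall>c u. proj G (fscale G c u) = proj G u) \<and>
     (\<Union>(W, \<psi>)\<in>trivs G. W) = UNIV \<and>
     (\<forall>(W, \<psi>)\<in>trivs G. open W \<and>
        (\<forall>p\<in>W. bij_betw \<psi> {u. proj G u = p} UNIV) \<and>
        (\<forall>u v. proj G u \<in> W \<and> proj G u = proj G v \<longrightarrow> \<psi> (fadd G u v) = \<psi> u + \<psi> v) \<and>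
        (\<forall>c u. proj G u \<in> W \<longrightarrow> \<psi> (fscale G c u) = c *\<^sub>R \<psi> u)) \<and>
     smooth_atlas (total_atlas G)"

abbreviation Cinf_M :: "('m, 'e, 'a::real_inner, 'b) algebroid \<Rightarrow> ('m \<Rightarrow> real) set" where
  "Cinf_M G \<equiv> smooth_funs (base_atlas G)"

abbreviation Cinf_E ::
    "('m, 'e, 'a::real_inner, 'b::real_inner) algebroid \<Rightarrow> ('e \<Rightarrow> real) set" where
  "Cinf_E G \<equiv> smooth_funs (total_atlas G)"

definition sec_E ::
    "('m::topological_space, 'e::topological_space, 'a::real_inner, 'b::real_inner) algebroid \<Rightarrow>
     ('m \<Rightarrow> 'e) set" where
  "sec_E G = {\<eta>. (\<forall>p. proj G (\<eta> p) = p) \<and> smooth_map (base_atlas G) (total_atlas G) \<eta>}"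

definition lie_algebroid ::
    "('m::{t2_space,second_countable_topology}, 'e::{t2_space,second_countable_topology},
      'a::real_inner, 'b::real_inner) algebroid \<Rightarrow> bool" where
  "lie_algebroid G \<longleftrightarrow>
     vector_bundle G \<and>
     (\<forall>u. anchor G u \<in> tangent_space (base_atlas G) (proj G u)) \<and>
     (\<forall>u v f. proj G u = proj G v \<longrightarrow>
        snd (anchor G (fadd G u v)) f = snd (anchor G u) f + snd (anchor G v) f) \<and>
     (\<forall>c u f. snd (anchor G (fscale G c u)) f = c * snd (anchor G u) f) \<and>
     (\<forall>f\<in>Cinf_M G. (\<lambda>u. snd (anchor G u) f) \<in> Cinf_E G) \<and>
     lie_algebroid_bracket (Cinf_M G) (sec_E G)
       (\<lambda>\<xi> \<eta> p. fadd G (\<xi> p) (\<eta> p)) (\<lambda>f \<xi> p. fscale G (f p) (\<xi> p))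
       (\<lambda>\<xi> f p. snd (anchor G (\<xi> p)) f) (lbr G)"


section \<open>Pullback bundle and prolongation\<close>

text \<open>The fibre of the pullback bundle over \<open>u\<close> consists of the pairs \<open>(u, v)\<close> with
  \<open>v\<close> in the fibre of \<open>u\<close>; \<open>fscale G 0 u\<close> is the zero vector of that fibre.\<close>

definition sec_pb ::
    "('m, 'e::topological_space, 'a::real_inner, 'b::real_inner) algebroid \<Rightarrow>
     ('e \<Rightarrow> 'e \<times> 'e) set" where
  "sec_pb G = {\<xi>. (\<forall>u. fst (\<xi> u) = u \<and> proj G (snd (\<xi> u)) = proj G u) \<and>
                  smooth_map (total_atlas G) (total_atlas G) (snd \<circ> \<xi>)}"

definition pb_add ::
    "('m, 'e, 'a, 'b) algebroid \<Rightarrow> ('e \<Rightarrow> 'e \<times> 'e) \<Rightarrow> ('e \<Rightarrow> 'e \<times> 'e) \<Rightarrow> 'e \<Rightarrow> 'e \<times> 'e" where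
  "pb_add G \<xi> \<eta> = (\<lambda>u. (u, fadd G (snd (\<xi> u)) (snd (\<eta> u))))"

definition pb_smul ::
    "('m, 'e, 'a, 'b) algebroid \<Rightarrow> ('e \<Rightarrow> real) \<Rightarrow> ('e \<Rightarrow> 'e \<times> 'e) \<Rightarrow> 'e \<Rightarrow> 'e \<times> 'e" where
  "pb_smul G f \<xi> = (\<lambda>u. (u, fscale G (f u) (snd (\<xi> u))))"

definition pb_zero :: "('m, 'e, 'a, 'b) algebroid \<Rightarrow> 'e \<Rightarrow> 'e \<times> 'e" where
  "pb_zero G = (\<lambda>u. (u, fscale G 0 u))"

definition hat :: "('m, 'e, 'a, 'b) algebroid \<Rightarrow> ('m \<Rightarrow> 'e) \<Rightarrow> 'e \<Rightarrow> 'e \<times> 'e" where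
  "hat G \<eta> = (\<lambda>u. (u, \<eta> (proj G u)))"

definition prolongation ::
    "('m, 'e, 'a::real_inner, 'b::real_inner) algebroid \<Rightarrow> ('e \<times> 'e tvec) set" where
  "prolongation G = {(u, z). (\<exists>v. z \<in> tangent_space (total_atlas G) v) \<and>
                             anchor G u = pushforward (base_atlas G) (proj G) z}"

text \<open>The prolongation is a subbundle of the direct sum of the pullback bundle and the
  tangent bundle of the total space, so smoothness of sections is componentwise.\<close>
definition sec_L ::
    "('m, 'e::topological_space, 'a::real_inner, 'b::real_inner) algebroid \<Rightarrow>
     ('e \<Rightarrow> 'e \<times> 'e tvec) set" where
  "sec_L G = {\<sigma>. (\<forall>v. \<sigma> v \<in> prolongation G \<and> fst (snd (\<sigma> v)) = v) \<and>
                 smooth_map (total_atlas G) (total_atlas G) (fst \<circ> \<sigma>) \<and>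
                 snd \<circ> \<sigma> \<in> vector_fields (total_atlas G)}"

definition L_add ::
    "('m, 'e, 'a, 'b) algebroid \<Rightarrow> ('e \<Rightarrow> 'e \<times> 'e tvec) \<Rightarrow> ('e \<Rightarrow> 'e \<times> 'e tvec) \<Rightarrow>
     'e \<Rightarrow> 'e \<times> 'e tvec" where
  "L_add G \<sigma> \<tau> = (\<lambda>v. (fadd G (fst (\<sigma> v)) (fst (\<tau> v)),
                       (v, \<lambda>f. snd (snd (\<sigma> v)) f + snd (snd (\<tau> v)) f)))"

definition L_smul ::
    "('m, 'e, 'a, 'b) algebroid \<Rightarrow> ('e \<Rightarrow> real) \<Rightarrow> ('e \<Rightarrow> 'e \<times> 'e tvec) \<Rightarrow>
     'e \<Rightarrow> 'e \<times> 'e tvec" where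
  "L_smul G h \<sigma> = (\<lambda>v. (fscale G (h v) (fst (\<sigma> v)), (v, \<lambda>f. h v * snd (snd (\<sigma> v)) f)))"

definition L_zero :: "('m, 'e, 'a, 'b) algebroid \<Rightarrow> 'e \<Rightarrow> 'e \<times> 'e tvec" where
  "L_zero G = (\<lambda>v. (fscale G 0 v, (v, \<lambda>f. 0)))"

definition L_act :: "('e \<Rightarrow> 'e \<times> 'e tvec) \<Rightarrow> ('e \<Rightarrow> real) \<Rightarrow> 'e \<Rightarrow> real" where
  "L_act \<sigma> f = (\<lambda>v. snd (snd (\<sigma> v)) f)"

text \<open>A vector field \<open>U\<close> on \<open>E\<close> is \<open>\<pi>\<close>-related to the vector field \<open>\<rho>(X)\<close>.\<close>
definition related_to_anchor ::
    "('m, 'e, 'a::real_inner, 'b) algebroid \<Rightarrow> ('e \<Rightarrow> 'e tvec) \<Rightarrow> ('m \<Rightarrow> 'e) \<Rightarrow> bool" where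
  "related_to_anchor G U X \<longleftrightarrow>
     (\<forall>v. pushforward (base_atlas G) (proj G) (U v) = anchor G (X (proj G v)))"

text \<open>These conditions determine \<open>br\<close> uniquely on pairs of smooth sections.\<close>
definition prolongation_bracket ::
    "('m::topological_space, 'e::topological_space, 'a::real_inner, 'b::real_inner) algebroid \<Rightarrow>
     (('e \<Rightarrow> 'e \<times> 'e tvec) \<Rightarrow> ('e \<Rightarrow> 'e \<times> 'e tvec) \<Rightarrow> 'e \<Rightarrow> 'e \<times> 'e tvec) \<Rightarrow> bool" where
  "prolongation_bracket G br \<longleftrightarrow>
     lie_algebroid_bracket (Cinf_E G) (sec_L G) (L_add G) (L_smul G) L_act br \<and>
     (\<forall>X\<in>sec_E G. \<forall>Y\<in>sec_E G.
        \<forall>U\<in>vector_fields (total_atlas G). \<forall>W\<in>vector_fields (total_atlas G).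
          related_to_anchor G U X \<and> related_to_anchor G W Y \<longrightarrow>
          br (\<lambda>v. (X (proj G v), U v)) (\<lambda>v. (Y (proj G v), W v)) =
            (\<lambda>v. (lbr G X Y (proj G v), vf_bracket (total_atlas G) U W v)))"

definition i_map ::
    "('m, 'e, 'a::real_inner, 'b::real_inner) algebroid \<Rightarrow> 'e \<times> 'e \<Rightarrow> 'e \<times> 'e tvec" where
  "i_map G = (\<lambda>(u, v). (fscale G 0 u,
     (u, \<lambda>f. if f \<in> Cinf_E G then deriv (\<lambda>t. f (fadd G u (fscale G t v))) 0 else 0)))"

definition j_map :: "'e \<times> 'e tvec \<Rightarrow> 'e \<times> 'e" where
  "j_map = (\<lambda>(u, z). (fst z, u))"

definition Liouville ::
    "('m, 'e, 'a::real_inner, 'b::real_inner) algebroid \<Rightarrow> 'e \<Rightarrow> 'e \<times> 'e tvec" where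
  "Liouville G = (\<lambda>u. i_map G (u, u))"


section \<open>Lifts\<close>

definition vertical_lift ::
    "('m, 'e, 'a::real_inner, 'b::real_inner) algebroid \<Rightarrow> ('m \<Rightarrow> 'e) \<Rightarrow>
     'e \<Rightarrow> 'e \<times> 'e tvec" where
  "vertical_lift G \<eta> = i_map G \<circ> hat G \<eta>"

definition fun_hat :: "('m, 'e, 'a, 'b) algebroid \<Rightarrow> ('m \<Rightarrow> 'e \<Rightarrow> real) \<Rightarrow> 'e \<Rightarrow> real" where
  "fun_hat G \<theta> = (\<lambda>u. \<theta> (proj G u) u)"

text \<open>A family of linear forms on the fibres is a smooth section of the dual bundle iff the
  fibrewise linear function it induces on the total space is smooth. The value \<open>\<theta> p u\<close> is
  irrelevant for \<open>u\<close> outside the fibre over \<open>p\<close>.\<close>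
definition sec_dual ::
    "('m, 'e, 'a::real_inner, 'b::real_inner) algebroid \<Rightarrow> ('m \<Rightarrow> 'e \<Rightarrow> real) set" where
  "sec_dual G = {\<theta>.
     (\<forall>p u v. proj G u = p \<and> proj G v = p \<longrightarrow> \<theta> p (fadd G u v) = \<theta> p u + \<theta> p v) \<and>
     (\<forall>p c u. proj G u = p \<longrightarrow> \<theta> p (fscale G c u) = c * \<theta> p u) \<and>
     fun_hat G \<theta> \<in> Cinf_E G}"

definition dual_lie_deriv ::
    "('m::topological_space, 'e::topological_space, 'a::real_inner, 'b::real_inner) algebroid \<Rightarrow>
     ('m \<Rightarrow> 'e) \<Rightarrow> ('m \<Rightarrow> 'e \<Rightarrow> real) \<Rightarrow> 'm \<Rightarrow> 'e \<Rightarrow> real" where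
  "dual_lie_deriv G \<eta> \<theta> = (SOME \<omega>. \<omega> \<in> sec_dual G \<and>
     (\<forall>\<xi>\<in>sec_E G. \<forall>p.
        \<omega> p (\<xi> p) = snd (anchor G (\<eta> p)) (\<lambda>q. \<theta> q (\<xi> q)) - \<theta> p (lbr G \<eta> \<xi> p)))"

definition complete_lift_field ::
    "('m::topological_space, 'e::topological_space, 'a::real_inner, 'b::real_inner) algebroid \<Rightarrow>
     ('m \<Rightarrow> 'e) \<Rightarrow> 'e \<Rightarrow> 'e tvec" where
  "complete_lift_field G \<eta> = (THE Z. Z \<in> vector_fields (total_atlas G) \<and>
     related_to_anchor G Z \<eta> \<and>
     (\<forall>\<theta>\<in>sec_dual G. \<forall>u.
        snd (Z u) (fun_hat G \<theta>) = fun_hat G (dual_lie_deriv G \<eta> \<theta>) u))"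

definition complete_lift ::
    "('m::topological_space, 'e::topological_space, 'a::real_inner, 'b::real_inner) algebroid \<Rightarrow>
     ('m \<Rightarrow> 'e) \<Rightarrow> 'e \<Rightarrow> 'e \<times> 'e tvec" where
  "complete_lift G \<eta> = (\<lambda>u. (\<eta> (proj G u), complete_lift_field G \<eta> u))"


section \<open>Sprays and connections\<close>

text \<open>In the remaining definitions, \<open>br\<close> is the bracket of the prolongation.\<close>

type_synonym 'e L_bracket =
  "('e \<Rightarrow> 'e \<times> 'e tvec) \<Rightarrow> ('e \<Rightarrow> 'e \<times> 'e tvec) \<Rightarrow> 'e \<Rightarrow> 'e \<times> 'e tvec"

definition semispray ::
    "('m, 'e::topological_space, 'a::real_inner, 'b::real_inner) algebroid \<Rightarrow>
     ('e \<Rightarrow> 'e \<times> 'e tvec) \<Rightarrow> bool" where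
  "semispray G S \<longleftrightarrow> S \<in> sec_L G \<and> i_map G \<circ> j_map \<circ> S = Liouville G"

definition spray ::
    "('m, 'e::topological_space, 'a::real_inner, 'b::real_inner) algebroid \<Rightarrow>
     'e L_bracket \<Rightarrow> ('e \<Rightarrow> 'e \<times> 'e tvec) \<Rightarrow> bool" where
  "spray G br S \<longleftrightarrow> semispray G S \<and> br (Liouville G) S = S"

definition ehresmann ::
    "('m, 'e::topological_space, 'a::real_inner, 'b::real_inner) algebroid \<Rightarrow>
     (('e \<Rightarrow> 'e \<times> 'e) \<Rightarrow> 'e \<Rightarrow> 'e \<times> 'e tvec) \<Rightarrow> bool" where
  "ehresmann G H \<longleftrightarrow>
     module_hom (Cinf_E G) (sec_pb G) (pb_add G) (pb_smul G) (sec_L G) (L_add G) (L_smul G) H \<and>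
     (\<forall>\<xi>\<in>sec_pb G. j_map \<circ> H \<xi> = \<xi>)"

definition vertical_map ::
    "('m, 'e::topological_space, 'a::real_inner, 'b::real_inner) algebroid \<Rightarrow>
     (('e \<Rightarrow> 'e \<times> 'e) \<Rightarrow> 'e \<Rightarrow> 'e \<times> 'e tvec) \<Rightarrow>
     ('e \<Rightarrow> 'e \<times> 'e tvec) \<Rightarrow> 'e \<Rightarrow> 'e \<times> 'e" where
  "vertical_map G H = (SOME V.
     module_hom (Cinf_E G) (sec_L G) (L_add G) (L_smul G) (sec_pb G) (pb_add G) (pb_smul G) V \<and>
     (\<forall>\<xi>\<in>sec_pb G. V (i_map G \<circ> \<xi>) = \<xi>) \<and>
     (\<forall>\<sigma>\<in>sec_L G. V \<sigma> = pb_zero G \<longleftrightarrow> \<sigma> \<in> H ` sec_pb G))"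

definition berwald_connection ::
    "('m::topological_space, 'e::topological_space, 'a::real_inner, 'b::real_inner) algebroid \<Rightarrow>
     'e L_bracket \<Rightarrow> ('e \<Rightarrow> 'e \<times> 'e tvec) \<Rightarrow>
     (('e \<Rightarrow> 'e \<times> 'e) \<Rightarrow> 'e \<Rightarrow> 'e \<times> 'e tvec) \<Rightarrow> bool" where
  "berwald_connection G br S H \<longleftrightarrow> ehresmann G H \<and>
     (\<forall>\<eta>\<in>sec_E G. H (hat G \<eta>) =
        L_smul G (\<lambda>_. 1 / 2) (L_add G (complete_lift G \<eta>) (br (vertical_lift G \<eta>) S)))"


section \<open>Derivations of tensors on the pullback bundle\<close>

text \<open>Tensors of type \<open>(1, k)\<close> are identified with maps on lists of length \<open>k\<close> of
  sections with values in the sections, multilinear over the smooth functions.\<close>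

type_synonym 'e tensor1 = "('e \<Rightarrow> 'e \<times> 'e) list \<Rightarrow> 'e \<Rightarrow> 'e \<times> 'e"

definition is_tensor1 ::
    "('m, 'e::topological_space, 'a::real_inner, 'b::real_inner) algebroid \<Rightarrow> nat \<Rightarrow>
     'e tensor1 \<Rightarrow> bool" where
  "is_tensor1 G k A \<longleftrightarrow>
     (\<forall>xs. length xs = k \<and> set xs \<subseteq> sec_pb G \<longrightarrow>
        A xs \<in> sec_pb G \<and>
        (\<forall>i<k. module_hom (Cinf_E G) (sec_pb G) (pb_add G) (pb_smul G)
                  (sec_pb G) (pb_add G) (pb_smul G) (\<lambda>x. A (xs[i := x]))))"

text \<open>Extension to tensors of type \<open>(1, k)\<close> of a tensor derivation given on sections by
  \<open>D\<close>: commuting with contractions means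
  \<open>(D A)(x\<^sub>1, \<dots>, x\<^sub>k) = D (A(x\<^sub>1, \<dots>, x\<^sub>k)) - (\<Sum>i. A(x\<^sub>1, \<dots>, D x\<^sub>i, \<dots>, x\<^sub>k))\<close>.
  The action on functions does not occur in this form, since the values are sections.\<close>
definition tensor_deriv ::
    "('m, 'e, 'a, 'b) algebroid \<Rightarrow> (('e \<Rightarrow> 'e \<times> 'e) \<Rightarrow> 'e \<Rightarrow> 'e \<times> 'e) \<Rightarrow>
     'e tensor1 \<Rightarrow> 'e tensor1" where
  "tensor_deriv G D A = (\<lambda>xs. pb_add G (D (A xs))
     (pb_smul G (\<lambda>_. - 1)
        (foldr (pb_add G) (map (\<lambda>i. A (xs[i := D (xs ! i)])) [0..<length xs]) (pb_zero G))))"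

definition nabla_v ::
    "('m, 'e::topological_space, 'a::real_inner, 'b::real_inner) algebroid \<Rightarrow>
     'e L_bracket \<Rightarrow> ('e \<Rightarrow> 'e \<times> 'e) \<Rightarrow> ('e \<Rightarrow> 'e \<times> 'e) \<Rightarrow> 'e \<Rightarrow> 'e \<times> 'e" where
  "nabla_v G br \<xi> \<eta> = j_map \<circ> br (i_map G \<circ> \<xi>) (SOME \<sigma>. \<sigma> \<in> sec_L G \<and> j_map \<circ> \<sigma> = \<eta>)"

definition nabla_h ::
    "('m, 'e::topological_space, 'a::real_inner, 'b::real_inner) algebroid \<Rightarrow>
     'e L_bracket \<Rightarrow> (('e \<Rightarrow> 'e \<times> 'e) \<Rightarrow> 'e \<Rightarrow> 'e \<times> 'e tvec) \<Rightarrow>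
     ('e \<Rightarrow> 'e \<times> 'e) \<Rightarrow> ('e \<Rightarrow> 'e \<times> 'e) \<Rightarrow> 'e \<Rightarrow> 'e \<times> 'e" where
  "nabla_h G br H \<xi> \<eta> = vertical_map G H (br (H \<xi>) (i_map G \<circ> \<eta>))"

definition nabla_v_tensor ::
    "('m, 'e::topological_space, 'a::real_inner, 'b::real_inner) algebroid \<Rightarrow>
     'e L_bracket \<Rightarrow> 'e tensor1 \<Rightarrow> 'e tensor1" where
  "nabla_v_tensor G br A = (\<lambda>xs. tensor_deriv G (nabla_v G br (hd xs)) A (tl xs))"

definition nabla_h_sec ::
    "('m, 'e::topological_space, 'a::real_inner, 'b::real_inner) algebroid \<Rightarrow>
     'e L_bracket \<Rightarrow> (('e \<Rightarrow> 'e \<times> 'e) \<Rightarrow> 'e \<Rightarrow> 'e \<times> 'e tvec) \<Rightarrow>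
     ('e \<Rightarrow> 'e \<times> 'e) \<Rightarrow> 'e tensor1" where
  "nabla_h_sec G br H \<sigma> = (\<lambda>xs. nabla_h G br H (hd xs) \<sigma>)"

definition berwald_curvature ::
    "('m::topological_space, 'e::topological_space, 'a::real_inner, 'b::real_inner) algebroid \<Rightarrow>
     'e L_bracket \<Rightarrow> (('e \<Rightarrow> 'e \<times> 'e) \<Rightarrow> 'e \<Rightarrow> 'e \<times> 'e tvec) \<Rightarrow> 'e tensor1" where
  "berwald_curvature G br H = (SOME B. is_tensor1 G 3 B \<and>
     (\<forall>\<eta>\<in>sec_E G. \<forall>\<xi>\<in>sec_E G. \<forall>\<sigma>\<in>sec_E G.
        B [hat G \<eta>, hat G \<xi>, hat G \<sigma>] =
          nabla_v_tensor G br (nabla_h_sec G br H (hat G \<sigma>)) [hat G \<eta>, hat G \<xi>]))"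

definition projectable ::
    "('m::topological_space, 'e::topological_space, 'a::real_inner, 'b::real_inner) algebroid \<Rightarrow>
     ('e \<Rightarrow> 'e \<times> 'e tvec) \<Rightarrow> bool" where
  "projectable G \<sigma> \<longleftrightarrow> \<sigma> \<in> sec_L G \<and> (\<exists>X\<in>sec_E G. fst \<circ> \<sigma> = X \<circ> proj G)"

definition lie_deriv ::
    "('m, 'e::topological_space, 'a::real_inner, 'b::real_inner) algebroid \<Rightarrow>
     'e L_bracket \<Rightarrow> ('e \<Rightarrow> 'e \<times> 'e tvec) \<Rightarrow> ('e \<Rightarrow> 'e \<times> 'e) \<Rightarrow> 'e \<Rightarrow> 'e \<times> 'e" where
  "lie_deriv G br \<sigma> \<eta> = inv_into (sec_pb G) (\<lambda>\<xi>. i_map G \<circ> \<xi>) (br \<sigma> (i_map G \<circ> \<eta>))"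

definition curvature_collineation ::
    "('m::topological_space, 'e::topological_space, 'a::real_inner, 'b::real_inner) algebroid \<Rightarrow>
     'e L_bracket \<Rightarrow> nat \<Rightarrow> 'e tensor1 \<Rightarrow> ('e \<Rightarrow> 'e \<times> 'e tvec) \<Rightarrow> bool" where
  "curvature_collineation G br k A \<sigma> \<longleftrightarrow>
     k \<in> {1, 2, 3} \<and> is_tensor1 G k A \<and> projectable G \<sigma> \<and>
     (\<forall>xs. length xs = k \<and> set xs \<subseteq> sec_pb G \<longrightarrow>
        tensor_deriv G (lie_deriv G br \<sigma>) A xs = pb_zero G)"

definition lie_symmetry ::
    "('m::topological_space, 'e::topological_space, 'a::real_inner, 'b::real_inner) algebroid \<Rightarrow>
     'e L_bracket \<Rightarrow> ('e \<Rightarrow> 'e \<times> 'e tvec) \<Rightarrow> ('m \<Rightarrow> 'e) \<Rightarrow> bool" where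
  "lie_symmetry G br S \<eta> \<longleftrightarrow> \<eta> \<in> sec_E G \<and> br S (complete_lift G \<eta>) = L_zero G"

end

theory Submission
  imports Defs
begin

text \<open>Everything is tested against the functions \<open>g\<close> on \<open>E\<close> that are linear on the fibres: they separate
  the points of the fibres and, together with the functions \<open>f \<circ> \<pi>\<close>, the tangent vectors of \<open>E\<close>. In this
  way \<open>g(\<nabla>\<^sup>v\<^sub>x w) = x\<^sup>V(g(w))\<close> and \<open>g(L x) = \<eta>\<^sup>C(g(x)) - (\<L>\<^sub>\<eta> g)(x)\<close> for the Lie derivation \<open>L\<close> along
  \<open>\<eta>\<^sup>C\<close>, so that \<open>[\<eta>\<^sup>C, X\<^sup>V] = [\<eta>, X]\<^sup>V\<close> gives \<open>L(\<nabla>\<^sup>v\<^sub>X w) = \<nabla>\<^sup>v\<^bsub>[\<eta>,X]\<^esub> w + \<nabla>\<^sup>v\<^sub>X (L w)\<close>. The symmetry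
  \<open>[S, \<eta>\<^sup>C] = 0\<close> and the Jacobi identity give \<open>[\<eta>\<^sup>C, \<H>(Y)] = \<H>([\<eta>, Y])\<close>, hence the analogous rule for
  \<open>\<nabla>\<^sup>h\<close>. Thus \<open>L \<B>\<close> vanishes on basic sections. As it is a tensor and basic sections generate
  \<open>\<Gamma>(\<pi>\<^sup>*\<pi>)\<close> locally, it vanishes.\<close>

section \<open>Smooth functions and bump functions\<close>

text \<open>The vertical map, the Lie derivative of forms and \<open>\<B>\<close> are given by
  \<open>SOME\<close>, the complete lift by \<open>THE\<close>; nothing can be said of them before
  existence, and for \<open>THE\<close> also uniqueness, is proved, and most of the work lies there.
  The obstacle is that the data are prescribed on basic sections only, while a global frame need not
  exist. A local frame cut off by a bump function yields finitely many global forms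
  \<open>\<theta>\<close> and sections \<open>e\<close> with
  \<open>h u = \<Sum> \<theta>(u) e\<close>, where \<open>h = 1\<close> at a given point. Values at
  a point thus become finite sums, and as these do not depend on the frame, pointwise definitions
  fit together smoothly without a partition of unity. The bracket of the prolongation is explicit
  only on projectable sections. Complete lifts, vertical sections and horizontal lifts of basic
  sections are projectable; computations take place among these, and other sections are reached
  through the Leibniz rule. The Jacobi argument for \<open>\<H>\<close> also needs
  \<open>[\<eta>\<^sup>C, Y\<^sup>C] = [\<eta>, Y]\<^sup>C\<close>, which rests on the fact that
  \<open>\<rho>\<close> preserves brackets; this is read off from the bracket of horizontal
  lifts.\<close>

lemma k_smooth_on_subset: "k_smooth_on k T f \<Longrightarrow> S \<subseteq> T \<Longrightarrow> k_smooth_on k S f"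
  by (induction k arbitrary: f) (auto intro: continuous_on_subset)

lemma smooth_on_subset: "smooth_on T f \<Longrightarrow> S \<subseteq> T \<Longrightarrow> smooth_on S f"
  by (auto simp: smooth_on_def intro: k_smooth_on_subset)

lemma k_smooth_on_SucD:
  "k_smooth_on (Suc k) S f \<Longrightarrow> x \<in> S \<Longrightarrow> (f has_derivative frechet_derivative f (at x)) (at x)"
  by (auto simp: frechet_derivative_works)

text \<open>Derivatives are taken along the full neighbourhood filter, so agreement on
  \<open>S\<close> controls them because \<open>S\<close> is open.\<close>

lemma k_smooth_on_cong:
  assumes "open S" "k_smooth_on k S f" "\<And>x. x \<in> S \<Longrightarrow> f x = g x"
  shows "k_smooth_on k S g"
  using assms(2,3)
proof (induction k arbitrary: f g)
  case 0
  then show ?case by (metis continuous_on_cong k_smooth_on.simps(1))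
next
  case (Suc k)
  have g: "(g has_derivative frechet_derivative f (at x)) (at x)" if "x \<in> S" for x
    using has_derivative_transform_within_open[OF k_smooth_on_SucD[OF Suc.prems(1) that]
      assms(1) that] Suc.prems(2) by blast
  have "k_smooth_on k S (\<lambda>x. frechet_derivative g (at x) v)" for v
    by (rule Suc.IH[where f = "\<lambda>x. frechet_derivative f (at x) v"])
      (use Suc.prems(1) frechet_derivative_at[OF g] in auto)
  then show ?case using g by (auto simp: differentiable_def)
qed

text \<open>Lets a derivative in closed form replace \<open>frechet_derivative\<close>, which it
  equals by uniqueness; the induction steps below all go through this rule.\<close>

lemma k_smooth_onI_Suc:
  assumes "open S" "\<And>x. x \<in> S \<Longrightarrow> (f has_derivative F x) (at x)"
    and "\<And>v. k_smooth_on k S (\<lambda>x. F x v)"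
  shows "k_smooth_on (Suc k) S f"
proof -
  have "k_smooth_on k S (\<lambda>x. frechet_derivative f (at x) v)" for v
    by (rule k_smooth_on_cong[OF assms(1) assms(3)[of v]])
      (use frechet_derivative_at[OF assms(2)] in auto)
  then show ?thesis using assms(2) by (auto simp: differentiable_def)
qed

lemma smooth_on_cong:
  "open S \<Longrightarrow> smooth_on S f \<Longrightarrow> (\<And>x. x \<in> S \<Longrightarrow> f x = g x) \<Longrightarrow> smooth_on S g"
  unfolding smooth_on_def using k_smooth_on_cong by blast

lemma k_smooth_on_lower: "k_smooth_on (Suc k) S f \<Longrightarrow> k_smooth_on k S f"
proof (induction k arbitrary: f)
  case 0
  then show ?case
    by (auto intro!: continuous_at_imp_continuous_on differentiable_imp_continuous_within)
qed (simp; blast)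

lemma smooth_on_continuous: "smooth_on S f \<Longrightarrow> continuous_on S f"
  unfolding smooth_on_def by (metis k_smooth_on.simps(1))

lemma smooth_on_has_derivative:
  "smooth_on S f \<Longrightarrow> x \<in> S \<Longrightarrow> (f has_derivative frechet_derivative f (at x)) (at x)"
  unfolding smooth_on_def using k_smooth_on_SucD by blast

lemma smooth_on_frechet:
  "smooth_on S f \<Longrightarrow> smooth_on S (\<lambda>x. frechet_derivative f (at x) v)"
  unfolding smooth_on_def by (metis k_smooth_on.simps(2))

lemma k_smooth_on_local:
  assumes "\<And>x. x \<in> S \<Longrightarrow> \<exists>T. open T \<and> x \<in> T \<and> k_smooth_on k T f"
  shows "k_smooth_on k S f"
  using assms
proof (induction k arbitrary: f)
  case 0
  then show ?case
    by (metis continuous_at_imp_continuous_on continuous_on_eq_continuous_at k_smooth_on.simps(1))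
next
  case (Suc k)
  have "k_smooth_on k S (\<lambda>x. frechet_derivative f (at x) v)" for v
    by (rule Suc.IH) (use Suc.prems in fastforce)
  then show ?case using Suc.prems by fastforce
qed

lemma smooth_on_local:
  assumes "\<And>x. x \<in> S \<Longrightarrow> \<exists>T. open T \<and> x \<in> T \<and> smooth_on T f"
  shows "smooth_on S f"
  using assms k_smooth_on_local unfolding smooth_on_def by meson

lemma smooth_on_const: "open S \<Longrightarrow> smooth_on S (\<lambda>_. c)"
proof -
  assume S: "open S"
  have "k_smooth_on k S (\<lambda>_. c)" for k
  proof (induction k arbitrary: c)
    case (Suc k)
    then show ?case
      by (intro k_smooth_onI_Suc[where F = "\<lambda>_ _. 0", OF S]) (auto intro: derivative_eq_intros)
  qed auto
  then show ?thesis by (auto simp: smooth_on_def)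
qed

lemma smooth_on_linear:
  assumes S: "open S" and "bounded_linear f" shows "smooth_on S f"
  unfolding smooth_on_def
proof
  fix k
  show "k_smooth_on k S f"
  proof (cases k)
    case 0
    then show ?thesis using assms by (simp add: linear_continuous_on)
  next
    case (Suc n)
    show ?thesis unfolding Suc
      by (rule k_smooth_onI_Suc[OF S, where F = "\<lambda>_. f"])
        (use smooth_on_const[OF S] assms in \<open>auto intro: bounded_linear_imp_has_derivative
          simp: smooth_on_def\<close>)
  qed
qed

lemma k_smooth_on_add:
  assumes S: "open S" and "k_smooth_on k S f" "k_smooth_on k S g"
  shows "k_smooth_on k S (\<lambda>x. f x + g x)"
  using assms(2,3)
proof (induction k arbitrary: f g)
  case (Suc k)
  show ?case
    by (rule k_smooth_onI_Suc[OF S has_derivative_add[OF k_smooth_on_SucD k_smooth_on_SucD]])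
      (use Suc in auto)
qed (auto intro: continuous_intros)

lemma smooth_on_add:
  "open S \<Longrightarrow> smooth_on S f \<Longrightarrow> smooth_on S g \<Longrightarrow> smooth_on S (\<lambda>x. f x + g x)"
  by (auto simp: smooth_on_def intro: k_smooth_on_add)

lemma k_smooth_on_sum:
  assumes "open S" "\<And>i. i \<in> I \<Longrightarrow> k_smooth_on k S (f i)"
  shows "k_smooth_on k S (\<lambda>x. \<Sum>i\<in>I. f i x)"
  using assms(2)
  by (induction I rule: infinite_finite_induct)
    (use assms(1) smooth_on_const in \<open>auto simp: smooth_on_def intro!: k_smooth_on_add\<close>)

lemma smooth_on_sum:
  "open S \<Longrightarrow> (\<And>i. i \<in> I \<Longrightarrow> smooth_on S (f i)) \<Longrightarrow> smooth_on S (\<lambda>x. \<Sum>i\<in>I. f i x)"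
  by (auto simp: smooth_on_def intro: k_smooth_on_sum)

text \<open>Each term of the product rule keeps one undifferentiated factor, which is smooth of one
  order more than needed; hence \<open>k_smooth_on_lower\<close>.\<close>

lemma k_smooth_on_scaleR:
  assumes S: "open S" and "k_smooth_on k S f" "k_smooth_on k S g"
  shows "k_smooth_on k S (\<lambda>x. f x *\<^sub>R g x)"
  using assms(2,3)
proof (induction k arbitrary: f g)
  case (Suc k)
  show ?case
    by (rule k_smooth_onI_Suc[OF S has_derivative_scaleR[OF k_smooth_on_SucD k_smooth_on_SucD]])
      (use Suc k_smooth_on_lower[OF Suc.prems(1)] k_smooth_on_lower[OF Suc.prems(2)] S
       in \<open>auto intro!: k_smooth_on_add\<close>)
qed (auto intro: continuous_intros)

lemma smooth_on_scaleR:
  "open S \<Longrightarrow> smooth_on S f \<Longrightarrow> smooth_on S g \<Longrightarrow> smooth_on S (\<lambda>x. f x *\<^sub>R g x)"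
  by (auto simp: smooth_on_def intro: k_smooth_on_scaleR)

lemma smooth_on_mult:
  "open S \<Longrightarrow> smooth_on S f \<Longrightarrow> smooth_on S g \<Longrightarrow> smooth_on S (\<lambda>x. f x * g x :: real)"
  using smooth_on_scaleR[of S f g] by simp

lemma k_smooth_on_bounded_linear:
  assumes S: "open S" and L: "bounded_linear L" and "k_smooth_on k S f"
  shows "k_smooth_on k S (\<lambda>x. L (f x))"
  using assms(3)
proof (induction k arbitrary: f)
  case 0
  then show ?case using bounded_linear.continuous_on[OF L] by simp
next
  case (Suc k)
  show ?case
    by (rule k_smooth_onI_Suc[OF S bounded_linear.has_derivative[OF L k_smooth_on_SucD]])
      (use Suc in auto)
qed

lemma smooth_on_bounded_linear:
  "open S \<Longrightarrow> bounded_linear L \<Longrightarrow> smooth_on S f \<Longrightarrow> smooth_on S (\<lambda>x. L (f x))"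
  by (auto simp: smooth_on_def intro: k_smooth_on_bounded_linear)

text \<open>The derivative of \<open>1/f\<close> is \<open>-(1/f) f' (1/f)\<close>, which contains
  \<open>1/f\<close> itself only to the order already settled, so the induction closes.\<close>

lemma smooth_on_inverse:
  fixes f :: "'a::real_normed_vector \<Rightarrow> real"
  assumes S: "open S" and f: "smooth_on S f" and nz: "\<And>x. x \<in> S \<Longrightarrow> f x \<noteq> 0"
  shows "smooth_on S (\<lambda>x. inverse (f x))"
proof -
  have "k_smooth_on k S (\<lambda>x. inverse (f x))" for k
  proof (induction k)
    case 0
    then show ?case using smooth_on_continuous[OF f] nz by (auto intro: continuous_intros)
  next
    case (Suc k)
    let ?F = "\<lambda>x v. (- 1) *\<^sub>R (inverse (f x) *\<^sub>R (frechet_derivative f (at x) v *\<^sub>R inverse (f x)))"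
    show ?case
    proof (rule k_smooth_onI_Suc[OF S, where F = ?F])
      show "((\<lambda>x. inverse (f x)) has_derivative ?F x) (at x)" if "x \<in> S" for x
        using Deriv.has_derivative_inverse[OF nz[OF that] smooth_on_has_derivative[OF f that]]
        by (simp add: mult.assoc)
      show "k_smooth_on k S (\<lambda>x. ?F x v)" for v
        using smooth_on_frechet[OF f] smooth_on_const[OF S]
        by (intro k_smooth_on_scaleR[OF S] Suc) (auto simp: smooth_on_def)
    qed
  qed
  then show ?thesis by (simp add: smooth_on_def)
qed

section \<open>Orthonormal coordinates, the chain rule and compact balls\<close>

definition coord_basis :: "'a::real_inner set \<Rightarrow> bool" where
  "coord_basis B \<longleftrightarrow> finite B \<and> (\<forall>x. (\<Sum>b\<in>B. (x \<bullet> b) *\<^sub>R b) = x)"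

text \<open>An orthogonal spanning set is normalized after removing the zero vector, which
  orthogonality permits. In dimension zero the resulting basis is empty.\<close>

lemma coord_basis_exists:
  assumes "finite B" "span B = (UNIV :: 'a::real_inner set)"
  shows "\<exists>B::'a set. coord_basis B"
proof -
  obtain C where C: "finite C" "span C = (UNIV :: 'a set)" "pairwise orthogonal C"
    using basis_orthogonal[OF assms(1)] assms(2) by metis
  let ?n = "\<lambda>c::'a. c /\<^sub>R norm c"
  have orth: "c \<bullet> d = 0" if "c \<in> C" "d \<in> C" "c \<noteq> d" for c d
    using C(3) that by (auto simp: pairwise_def orthogonal_def)
  \<comment> \<open>Distinct vectors of \<open>C\<close> stay distinct after normalization, since
    otherwise a nonzero vector would be orthogonal to itself. This allows reindexing the sum over
    the image.\<close>
  have inj: "inj_on ?n (C - {0})"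
  proof (rule inj_onI, rule ccontr)
    fix c d assume cd: "c \<in> C - {0}" "d \<in> C - {0}" "?n c = ?n d" "c \<noteq> d"
    have "?n c \<bullet> ?n d = 0" using orth[of c d] cd(1,2,4) by simp
    then have "?n c = 0" using cd(3) by (metis inner_eq_zero_iff)
    then show False using cd(1) by auto
  qed
  have "(\<Sum>b\<in>?n ` (C - {0}). (x \<bullet> b) *\<^sub>R b) = x" for x
  proof -
    have "x \<in> range (\<lambda>u. \<Sum>c\<in>C. u c *\<^sub>R c)" unfolding span_finite[OF C(1), symmetric] C(2) ..
    then obtain u where u: "x = (\<Sum>c\<in>C. u c *\<^sub>R c)" by blast
    have xc: "x \<bullet> c = u c * (c \<bullet> c)" if "c \<in> C" for c
    proof -
      have "x \<bullet> c = (\<Sum>d\<in>C. if d = c then u c * (c \<bullet> c) else 0)"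
        unfolding u inner_sum_left by (rule sum.cong) (use orth that in auto)
      then show ?thesis using that C(1) by simp
    qed
    have "(\<Sum>b\<in>?n ` (C - {0}). (x \<bullet> b) *\<^sub>R b) = (\<Sum>c\<in>C - {0}. (x \<bullet> ?n c) *\<^sub>R ?n c)"
      by (simp add: sum.reindex[OF inj])
    also have "\<dots> = (\<Sum>c\<in>C - {0}. u c *\<^sub>R c)"
      by (rule sum.cong) (auto simp: xc power2_norm_eq_inner[symmetric] power2_eq_square)
    also have "\<dots> = x" unfolding u using C(1) by (intro sum.mono_neutral_left) auto
    finally show ?thesis .
  qed
  moreover have "finite (?n ` (C - {0}))" using C(1) by (intro finite_imageI finite_Diff)
  ultimately have "coord_basis (?n ` (C - {0}))" unfolding coord_basis_def by (intro conjI allI)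
  then show ?thesis ..
qed

text \<open>The chain rule inserts the varying vector \<open>f'(x) v\<close> into
  \<open>g'(f x)\<close>. Expanding that vector in \<open>B\<close> leaves derivatives of
  \<open>g\<close> in fixed directions \<open>b\<close>, composed with \<open>f\<close>, and these
  are covered by the induction hypothesis.\<close>

lemma k_smooth_on_compose:
  fixes f :: "'a::real_normed_vector \<Rightarrow> 'b::real_inner"
  assumes B: "coord_basis (B::'b set)" and S: "open S" and T: "open T" and sub: "f ` S \<subseteq> T"
    and f: "k_smooth_on k S f" and g: "k_smooth_on k T g"
  shows "k_smooth_on k S (\<lambda>x. g (f x))"
  using f g
proof (induction k arbitrary: g)
  case 0
  then show ?case using sub by (auto intro: continuous_on_compose2)
next
  case (Suc k)
  let ?F = "\<lambda>x v. \<Sum>b\<in>B. (frechet_derivative f (at x) v \<bullet> b) *\<^sub>R frechet_derivative g (at (f x)) b"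
  show ?case
  proof (rule k_smooth_onI_Suc[OF S, where F = ?F])
    fix x assume x: "x \<in> S"
    have dg: "(g has_derivative frechet_derivative g (at (f x))) (at (f x))"
      using k_smooth_on_SucD[OF Suc.prems(2)] x sub by blast
    interpret dg: bounded_linear "frechet_derivative g (at (f x))"
      using dg by (rule has_derivative_bounded_linear)
    have "frechet_derivative g (at (f x)) w = (\<Sum>b\<in>B. (w \<bullet> b) *\<^sub>R frechet_derivative g (at (f x)) b)" for w
    proof -
      have "w = (\<Sum>b\<in>B. (w \<bullet> b) *\<^sub>R b)" using B by (simp add: coord_basis_def)
      then have "frechet_derivative g (at (f x)) w = frechet_derivative g (at (f x)) (\<Sum>b\<in>B. (w \<bullet> b) *\<^sub>R b)"
        by simp
      then show ?thesis by (simp add: dg.sum dg.scaleR)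
    qed
    then show "((\<lambda>x. g (f x)) has_derivative ?F x) (at x)"
      by (intro has_derivative_eq_rhs[OF has_derivative_compose[OF k_smooth_on_SucD[OF Suc.prems(1) x] dg]] ext)
  next
    fix v
    show "k_smooth_on k S (\<lambda>x. ?F x v)"
    proof (intro k_smooth_on_sum[OF S] k_smooth_on_scaleR[OF S])
      show "k_smooth_on k S (\<lambda>x. frechet_derivative f (at x) v \<bullet> b)" for b
        by (rule k_smooth_on_bounded_linear[OF S bounded_linear_inner_left]) (use Suc in auto)
      show "k_smooth_on k S (\<lambda>x. frechet_derivative g (at (f x)) b)" for b
        by (rule Suc.IH) (use Suc.prems k_smooth_on_lower in auto)
    qed
  qed
qed

lemma smooth_on_compose:
  fixes f :: "'a::real_normed_vector \<Rightarrow> 'b::real_inner"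
  assumes "coord_basis (B::'b set)" "open S" "open T" "f ` S \<subseteq> T" "smooth_on S f" "smooth_on T g"
  shows "smooth_on S (\<lambda>x. g (f x))"
  using assms by (auto simp: smooth_on_def intro: k_smooth_on_compose)

lemma coord_basis_real: "coord_basis {1::real}"
  by (simp add: coord_basis_def)

lemma smooth_on_coords:
  fixes f :: "'a::real_normed_vector \<Rightarrow> 'b::real_inner"
  assumes B: "coord_basis (B::'b set)" and S: "open S"
    and "\<And>b. b \<in> B \<Longrightarrow> smooth_on S (\<lambda>x. f x \<bullet> b)"
  shows "smooth_on S f"
proof -
  have "smooth_on S (\<lambda>x. \<Sum>b\<in>B. (f x \<bullet> b) *\<^sub>R b)"
    by (intro smooth_on_sum smooth_on_scaleR smooth_on_const S assms(3))
  then show ?thesis using B by (simp add: coord_basis_def)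
qed

text \<open>A coefficient box is a finite sum of compact segments, hence compact, and the ball is a
  closed subset of a large enough box.\<close>

lemma compact_cball_coord_basis:
  assumes B: "coord_basis (B::'a::real_inner set)"
  shows "compact (cball (x::'a) r)"
proof -
  let ?K = "\<lambda>(R::real) B::'a set. {y. \<exists>c. (\<forall>b\<in>B. c b \<in> {- R..R}) \<and> y = (\<Sum>b\<in>B. c b *\<^sub>R b)}"
  have comp: "compact (?K R B')" if "finite B'" for R B'
    using that
  proof (induction B')
    case (insert b F)
    have "?K R (insert b F) = (\<Union>s\<in>(\<lambda>c. c *\<^sub>R b) ` {- R..R}. \<Union>t\<in>?K R F. {s + t})" (is "?l = ?r")
    proof
      show "?l \<subseteq> ?r" using insert by fastforce
      show "?r \<subseteq> ?l"
      proof
        fix y assume "y \<in> ?r"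
        then obtain s c where sc: "s \<in> {-R..R}" "\<forall>b\<in>F. c b \<in> {-R..R}" "y = s *\<^sub>R b + (\<Sum>b\<in>F. c b *\<^sub>R b)"
          by blast
        have "(\<Sum>b\<in>F. c b *\<^sub>R b) = (\<Sum>d\<in>F. (c(b := s)) d *\<^sub>R d)"
          using insert by (intro sum.cong) auto
        then show "y \<in> ?l" using sc insert by (auto intro!: exI[of _ "c(b := s)"])
      qed
    qed
    moreover have "compact ?r"
    proof -
      have "compact ((\<lambda>c. c *\<^sub>R b) ` {- R..R})"
        by (intro compact_continuous_image continuous_intros) auto
      then show ?thesis using compact_sums'[OF _ insert.IH] by blast
    qed
    ultimately show ?case by simp
  qed simp
  \<comment> \<open>By Cauchy-Schwarz the coefficient of \<open>b\<close> is bounded by the summand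
    for \<open>b\<close>; the sum is one bound for all coefficients.\<close>
  define R where "R = (\<Sum>b\<in>B. (norm x + r) * norm b)"
  have "cball x r \<subseteq> ?K R B"
  proof
    fix y assume y: "y \<in> cball x r"
    then have "norm (y - x) \<le> r" by (simp add: dist_norm norm_minus_commute)
    then have ny: "norm y \<le> norm x + r" using norm_triangle_sub[of y x] by linarith
    have "y \<bullet> b \<in> {- R..R}" if "b \<in> B" for b
    proof -
      have "\<bar>y \<bullet> b\<bar> \<le> norm y * norm b" by (rule Cauchy_Schwarz_ineq2)
      also have "\<dots> \<le> (norm x + r) * norm b" using ny by (simp add: mult_right_mono)
      also have "\<dots> \<le> R" unfolding R_def
        by (rule member_le_sum[OF that])
          (use B order_trans[OF norm_ge_zero ny] in \<open>auto simp: coord_basis_def intro!: mult_nonneg_nonneg\<close>)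
      finally show ?thesis by auto
    qed
    then show "y \<in> ?K R B" using B unfolding coord_basis_def by (auto intro!: exI[of _ "\<lambda>b. y \<bullet> b"])
  qed
  then have eq: "cball x r = ?K R B \<inter> cball x r" by blast
  have "compact (?K R B \<inter> cball x r)"
    by (intro compact_Int_closed comp closed_cball) (use B in \<open>simp add: coord_basis_def\<close>)
  then show ?thesis by (subst eq)
qed

text \<open>The functions \<open>p(1/t) exp(-1/t)\<close> (\<open>t > 0\<close>), \<open>p\<close> a polynomial, extended by zero, are closed
  under differentiation; for \<open>p = 1\<close> this yields a flat function.\<close>
definition flat :: "real poly \<Rightarrow> real \<Rightarrow> real" where
  "flat p t = (if t > 0 then poly p (inverse t) * exp (- inverse t) else 0)"

text \<open>With \<open>s = 1/t\<close> this is the behaviour of \<open>flat p t\<close> as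
  \<open>t\<close> tends to 0 from the right.\<close>

lemma tendsto_poly_exp: "((\<lambda>s. poly p s * exp (- s)) \<longlongrightarrow> 0) (at_top :: real filter)"
proof (induction p)
  case (pCons a p)
  have e: "s * poly p s * exp (- s) = (\<Sum>i\<le>degree p. coeff p i * (s ^ (Suc i) / exp s))" for s
    by (simp add: poly_altdef exp_minus field_simps sum_distrib_left sum_distrib_right)
  have "((\<lambda>s. \<Sum>i\<le>degree p. coeff p i * (s ^ (Suc i) / exp s)) \<longlongrightarrow>
      (\<Sum>i\<le>degree p. coeff p i * 0)) (at_top :: real filter)"
    by (intro tendsto_intros tendsto_power_div_exp_0)
  then have "((\<lambda>s. a * (s ^ 0 / exp s) + s * poly p s * exp (- s)) \<longlongrightarrow> a * 0 + 0) (at_top :: real filter)"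
    unfolding e by (intro tendsto_add tendsto_mult tendsto_const tendsto_power_div_exp_0) simp
  then show ?case by (simp add: exp_minus field_simps)
qed simp

text \<open>Differentiating \<open>p(1/t) exp(-1/t)\<close> gives
  \<open>t^(-2) (p - p')(1/t) exp(-1/t)\<close>, and \<open>t^(-2)\<close> is
  \<open>monom 1 2\<close> evaluated at \<open>1/t\<close>.\<close>

lemma flat_has_derivative:
  "(flat p has_real_derivative flat (monom 1 2 * (p - pderiv p)) t) (at t)"
proof (cases t "0::real" rule: linorder_cases)
  case less
  have "((\<lambda>_. 0) has_real_derivative 0) (at t)" by simp
  then have "(flat p has_real_derivative 0) (at t)"
    by (rule DERIV_cong_ev[THEN iffD1, rotated -1])
      (use less eventually_nhds_in_open[of "{..<0}" t] in \<open>auto simp: flat_def elim!: eventually_mono\<close>)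
  then show ?thesis using less by (simp add: flat_def)
next
  case equal
  \<comment> \<open>With \<open>s = 1/h\<close> the right difference quotient at 0 is
    \<open>s p(s) exp(-s)\<close>; the left one vanishes identically.\<close>
  have "((\<lambda>h. poly (monom 1 1 * p) (inverse h) * exp (- inverse h)) \<longlongrightarrow> 0) (at_right 0)"
    using tendsto_poly_exp[of "monom 1 1 * p"] filterlim_inverse_at_top_right
    by (rule filterlim_compose)
  then have "((\<lambda>h. flat p h / h) \<longlongrightarrow> 0) (at_right 0)"
    by (rule Lim_transform_eventually)
      (auto simp: flat_def eventually_at_right_field poly_monom field_simps intro!: exI[of _ 1])
  moreover have "((\<lambda>h. flat p h / h) \<longlongrightarrow> 0) (at_left 0)"
    by (rule tendsto_eventually) (auto simp: flat_def eventually_at_left_field intro!: exI[of _ "-1"])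
  ultimately have "((\<lambda>h. flat p h / h) \<longlongrightarrow> 0) (at 0)" by (simp add: filterlim_at_split)
  then show ?thesis using equal by (simp add: DERIV_def flat_def)
next
  case greater
  have "((\<lambda>t. poly p (inverse t) * exp (- inverse t)) has_real_derivative
      flat (monom 1 2 * (p - pderiv p)) t) (at t)"
    using greater
    by (auto intro!: derivative_eq_intros simp: flat_def poly_monom power2_eq_square field_simps)
  then show ?thesis
    by (rule DERIV_cong_ev[THEN iffD1, rotated -1])
      (use greater eventually_nhds_in_open[of "{0<..}" t] in \<open>auto simp: flat_def elim!: eventually_mono\<close>)
qed

lemma smooth_on_flat: "smooth_on UNIV (flat p)"
proof -
  have "k_smooth_on k UNIV (flat p)" for k
  proof (induction k arbitrary: p)
    case 0
    then show ?case using flat_has_derivative[THEN DERIV_isCont] by (auto simp: continuous_at_imp_continuous_on)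
  next
    case (Suc k)
    have "k_smooth_on k UNIV (\<lambda>t. flat (monom 1 2 * (p - pderiv p)) t *\<^sub>R v)" for v :: real
      using smooth_on_const[of UNIV v] by (intro k_smooth_on_scaleR Suc) (auto simp: smooth_on_def)
    then show ?case
      by (intro k_smooth_onI_Suc[where F = "\<lambda>t v. flat (monom 1 2 * (p - pderiv p)) t *\<^sub>R v"])
        (use flat_has_derivative[of p] in \<open>auto simp: has_field_derivative_def simp del: mult_minus_left\<close>)
  qed
  then show ?thesis by (simp add: smooth_on_def)
qed

text \<open>\<open>flat 1\<close> is applied to \<open>r\<^sup>2 - |x - x0|\<^sup>2\<close>, which
  is negative outside the ball. The square of the norm is used because it is smooth also at the
  centre.\<close>

lemma smooth_on_bump:
  fixes x0 :: "'a::real_inner"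
  assumes "r > 0"
  obtains k :: "'a \<Rightarrow> real"
  where "smooth_on UNIV k" "k x0 = 1" "\<And>x. x \<notin> cball x0 r \<Longrightarrow> k x = 0"
proof -
  let ?q = "\<lambda>x::'a. r\<^sup>2 - (x - x0) \<bullet> (x - x0)"
  have q: "smooth_on UNIV ?q"
    unfolding smooth_on_def
  proof
    fix k
    show "k_smooth_on k UNIV ?q"
    proof (cases k)
      case (Suc n)
      have "smooth_on UNIV (\<lambda>x. - 2 * (x \<bullet> v) + 2 * (x0 \<bullet> v))" for v
        by (intro smooth_on_add smooth_on_mult smooth_on_const smooth_on_linear[OF _ bounded_linear_inner_left]) auto
      then show ?thesis unfolding Suc
        by (intro k_smooth_onI_Suc[where F = "\<lambda>x v. - 2 * (x \<bullet> v) + 2 * (x0 \<bullet> v)"])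
          (auto intro!: derivative_eq_intros simp: smooth_on_def inner_commute inner_simps algebra_simps)
    qed (auto intro!: continuous_intros)
  qed
  \<comment> \<open>Division by the value at the centre normalizes \<open>k x0\<close> to 1.\<close>
  define k where "k x = flat 1 (?q x) * inverse (flat 1 (r\<^sup>2))" for x
  have "smooth_on UNIV k"
    unfolding k_def using smooth_on_compose[OF coord_basis_real _ _ _ q smooth_on_flat]
    by (intro smooth_on_mult smooth_on_const) auto
  moreover have "k x0 = 1" using assms by (simp add: k_def flat_def)
  moreover have "k x = 0" if "x \<notin> cball x0 r" for x
  proof -
    have "r < norm (x - x0)" using that by (simp add: dist_norm norm_minus_commute)
    then have "r\<^sup>2 < (norm (x - x0))\<^sup>2" using assms by (intro power_strict_mono) auto
    then show ?thesis by (simp add: k_def flat_def power2_norm_eq_inner)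
  qed
  ultimately show ?thesis using that by blast
qed

section \<open>Smooth manifolds\<close>

lemma frechet_derivative_eqI: "(f has_derivative f') (at x) \<Longrightarrow> frechet_derivative f (at x) = f'"
  using frechet_derivative_at by metis

text \<open>Charts and trivializations are total functions that carry meaning only on their domains,
  and they take vector values; both are outside the reach of \<open>smooth_funs\<close>.\<close>

definition smooth_loc ::
    "('m, 'a::real_inner) atlas \<Rightarrow> 'm set \<Rightarrow> ('m \<Rightarrow> 'c::real_normed_vector) \<Rightarrow> bool" where
  "smooth_loc A W f \<longleftrightarrow> (\<forall>(U, \<phi>)\<in>A. smooth_on (\<phi> ` (U \<inter> W)) (f \<circ> inv_into U \<phi>))"

lemma smooth_locD:
  "smooth_loc A W f \<Longrightarrow> (U, \<phi>) \<in> A \<Longrightarrow> smooth_on (\<phi> ` (U \<inter> W)) (f \<circ> inv_into U \<phi>)"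
  by (auto simp: smooth_loc_def)

lemma smooth_locI:
  "(\<And>U \<phi>. (U, \<phi>) \<in> A \<Longrightarrow> smooth_on (\<phi> ` (U \<inter> W)) (\<lambda>x. f (inv_into U \<phi> x))) \<Longrightarrow> smooth_loc A W f"
  by (auto simp: smooth_loc_def o_def)

lemma smooth_locD':
  "smooth_loc A W f \<Longrightarrow> (U, \<phi>) \<in> A \<Longrightarrow> smooth_on (\<phi> ` (U \<inter> W)) (\<lambda>x. f (inv_into U \<phi> x))"
  by (auto simp: smooth_loc_def o_def)

lemma smooth_funs_iff: "f \<in> smooth_funs A \<longleftrightarrow> smooth_loc A UNIV f"
  by (simp add: smooth_funs_def smooth_loc_def)

lemma smooth_loc_subset: "smooth_loc A W f \<Longrightarrow> W' \<subseteq> W \<Longrightarrow> smooth_loc A W' f"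
  unfolding smooth_loc_def by (fastforce intro: smooth_on_subset)

lemma smooth_map_iff:
  "smooth_map A B F \<longleftrightarrow>
     continuous_on UNIV F \<and> (\<forall>(V, \<psi>)\<in>B. smooth_loc A (F -` V) (\<psi> \<circ> F))"
  unfolding smooth_map_def smooth_loc_def by (auto simp: comp_assoc)

definition tvec_at :: "('m, 'a::real_inner) atlas \<Rightarrow> 'm set \<Rightarrow> ('m \<Rightarrow> 'a) \<Rightarrow> 'm \<Rightarrow> 'a \<Rightarrow> 'm tvec" where
  "tvec_at A U \<phi> p v = (p, \<lambda>f. if f \<in> smooth_funs A
     then frechet_derivative (f \<circ> inv_into U \<phi>) (at (\<phi> p)) v else 0)"

lemma tangent_space_alt:
  "tangent_space A p = {tvec_at A U \<phi> p v | U \<phi> v. (U, \<phi>) \<in> A \<and> p \<in> U}"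
  by (simp add: tangent_space_def tvec_at_def)

lemma tangent_space_fst: "z \<in> tangent_space A p \<Longrightarrow> fst z = p"
  by (auto simp: tangent_space_def)

lemma tangent_space_nonsmooth: "z \<in> tangent_space A p \<Longrightarrow> f \<notin> smooth_funs A \<Longrightarrow> snd z f = 0"
  by (auto simp: tangent_space_def)

locale smooth_manifold =
  fixes A :: "('m::{t2_space,second_countable_topology}, 'a::real_inner) atlas"
  assumes atlas: "smooth_atlas A"
begin

lemma chart:
  assumes "(U, \<phi>) \<in> A"
  shows "open U" "open (\<phi> ` U)" "inj_on \<phi> U" "continuous_on U \<phi>"
    "continuous_on (\<phi> ` U) (inv_into U \<phi>)"
proof -
  have *: "open U" "open (\<phi> ` U)" "homeomorphism U (\<phi> ` U) \<phi> (inv_into U \<phi>)"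
    using bspec[OF conjunct1[OF conjunct2[OF atlas[unfolded smooth_atlas_def]]] assms] by auto
  then show "open U" "open (\<phi> ` U)" "continuous_on U \<phi>" "continuous_on (\<phi> ` U) (inv_into U \<phi>)"
    by (auto simp: homeomorphism_def)
  show "inj_on \<phi> U" by (rule inj_on_inverseI[of _ "inv_into U \<phi>"]) (rule homeomorphism_apply1[OF *(3)])
qed

lemma chart_inv: "(U, \<phi>) \<in> A \<Longrightarrow> p \<in> U \<Longrightarrow> inv_into U \<phi> (\<phi> p) = p"
  using chart(3) by simp

lemma chart_ex: obtains U \<phi> where "(U, \<phi>) \<in> A" "p \<in> U"
proof -
  have "p \<in> (\<Union>(U, \<phi>)\<in>A. U)"
    unfolding conjunct1[OF conjunct2[OF conjunct2[OF atlas[unfolded smooth_atlas_def]]]] ..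
  then show ?thesis using that by auto
qed

lemma model_basis: obtains B :: "'a set" where "coord_basis B"
  using conjunct1[OF atlas[unfolded smooth_atlas_def]] coord_basis_exists by metis

lemma chart_image_open:
  assumes c: "(U, \<phi>) \<in> A" and W: "open W" shows "open (\<phi> ` (U \<inter> W))"
proof -
  have "\<phi> ` (U \<inter> W) = \<phi> ` U \<inter> inv_into U \<phi> -` W" using chart_inv[OF c] by force
  then show ?thesis
    using continuous_on_open_vimage[OF chart(2)[OF c], of "inv_into U \<phi>"] chart(5)[OF c] W
    by (metis Int_commute)
qed

lemma transition:
  "(U, \<phi>) \<in> A \<Longrightarrow> (V, \<psi>) \<in> A \<Longrightarrow> smooth_on (\<phi> ` (U \<inter> V)) (\<psi> \<circ> inv_into U \<phi>)"
  using conjunct2[OF conjunct2[OF conjunct2[OF atlas[unfolded smooth_atlas_def]]]] by fast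

text \<open>One chart suffices, because the expression in any other chart is obtained by composing
  with a smooth transition map.\<close>

lemma smooth_loc_chart:
  fixes f :: "'m \<Rightarrow> 'c::real_normed_vector"
  assumes c: "(U, \<phi>) \<in> A" and W: "open W" "W \<subseteq> U" and f: "smooth_on (\<phi> ` W) (f \<circ> inv_into U \<phi>)"
  shows "smooth_loc A W f"
  unfolding smooth_loc_def
proof (intro ballI, clarify)
  fix V \<psi> assume d: "(V, \<psi>) \<in> A"
  obtain B :: "'a set" where B: "coord_basis B" by (rule model_basis)
  have op: "open (\<psi> ` (V \<inter> W))" using chart_image_open[OF d W(1)] .
  have op': "open (\<phi> ` W)" using chart_image_open[OF c W(1)] W(2) by (simp add: Int_absorb1)
  have "smooth_on (\<psi> ` (V \<inter> W)) (\<lambda>x. (f \<circ> inv_into U \<phi>) ((\<phi> \<circ> inv_into V \<psi>) x))"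
  proof (rule smooth_on_compose[OF B op op' _ _ f])
    show "smooth_on (\<psi> ` (V \<inter> W)) (\<phi> \<circ> inv_into V \<psi>)"
      by (rule smooth_on_subset[OF transition[OF d c]]) (use W in auto)
    show "(\<phi> \<circ> inv_into V \<psi>) ` \<psi> ` (V \<inter> W) \<subseteq> \<phi> ` W"
      using chart_inv[OF d] by auto
  qed
  then show "smooth_on (\<psi> ` (V \<inter> W)) (f \<circ> inv_into V \<psi>)"
    by (rule smooth_on_cong[OF op]) (use chart_inv[OF d] chart_inv[OF c] W in auto)
qed

lemma smooth_loc_local:
  assumes "\<And>p. p \<in> W \<Longrightarrow> \<exists>W'. open W' \<and> p \<in> W' \<and> smooth_loc A W' f"
  shows "smooth_loc A W f"
  unfolding smooth_loc_def
proof (intro ballI, clarify, rule smooth_on_local)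
  fix U \<phi> x assume c: "(U, \<phi>) \<in> A" "x \<in> \<phi> ` (U \<inter> W)"
  then obtain p where p: "p \<in> U" "p \<in> W" "x = \<phi> p" by blast
  obtain W' where "open W'" "p \<in> W'" "smooth_loc A W' f" using assms[OF p(2)] by blast
  then show "\<exists>T. open T \<and> x \<in> T \<and> smooth_on T (f \<circ> inv_into U \<phi>)"
    using c p chart_image_open[OF c(1)] unfolding smooth_loc_def by blast
qed

lemma smooth_loc_cong:
  assumes "open W" "smooth_loc A W f" "\<And>p. p \<in> W \<Longrightarrow> f p = g p" shows "smooth_loc A W g"
  unfolding smooth_loc_def
proof (intro ballI, clarify)
  fix U \<phi> assume c: "(U, \<phi>) \<in> A"
  show "smooth_on (\<phi> ` (U \<inter> W)) (g \<circ> inv_into U \<phi>)"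
    by (rule smooth_on_cong[OF chart_image_open[OF c assms(1)], of "f \<circ> inv_into U \<phi>"])
      (use assms c chart_inv[OF c] in \<open>auto simp: smooth_loc_def\<close>)
qed

lemma smooth_loc_const: "open W \<Longrightarrow> smooth_loc A W (\<lambda>_. c)"
  by (intro smooth_locI smooth_on_const chart_image_open)

lemma smooth_loc_add:
  "open W \<Longrightarrow> smooth_loc A W f \<Longrightarrow> smooth_loc A W g \<Longrightarrow> smooth_loc A W (\<lambda>p. f p + g p)"
  by (intro smooth_locI smooth_on_add chart_image_open) (auto intro: smooth_locD')

lemma smooth_loc_scaleR:
  "open W \<Longrightarrow> smooth_loc A W f \<Longrightarrow> smooth_loc A W g \<Longrightarrow> smooth_loc A W (\<lambda>p. f p *\<^sub>R g p)"
  by (intro smooth_locI smooth_on_scaleR chart_image_open) (auto intro: smooth_locD')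

lemma smooth_loc_mult:
  "open W \<Longrightarrow> smooth_loc A W f \<Longrightarrow> smooth_loc A W g \<Longrightarrow> smooth_loc A W (\<lambda>p. f p * g p :: real)"
  using smooth_loc_scaleR[of W f g] by simp

lemma smooth_loc_bounded_linear:
  "open W \<Longrightarrow> bounded_linear L \<Longrightarrow> smooth_loc A W f \<Longrightarrow> smooth_loc A W (\<lambda>p. L (f p))"
  by (intro smooth_locI smooth_on_bounded_linear[of _ L] chart_image_open) (auto intro: smooth_locD')

lemma smooth_loc_inverse:
  fixes f :: "'m \<Rightarrow> real"
  assumes "open W" "smooth_loc A W f" "\<And>p. p \<in> W \<Longrightarrow> f p \<noteq> 0"
  shows "smooth_loc A W (\<lambda>p. inverse (f p))"
proof (rule smooth_locI)
  fix U \<phi> assume c: "(U, \<phi>) \<in> A"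
  show "smooth_on (\<phi> ` (U \<inter> W)) (\<lambda>x. inverse (f (inv_into U \<phi> x)))"
    by (rule smooth_on_inverse[OF chart_image_open[OF c assms(1)] smooth_locD'[OF assms(2) c]])
      (use assms(3) chart_inv[OF c] in auto)
qed

lemma smooth_loc_coords:
  fixes f :: "'m \<Rightarrow> 'b::real_inner"
  assumes "coord_basis (B::'b set)" "open W" "\<And>b. b \<in> B \<Longrightarrow> smooth_loc A W (\<lambda>p. f p \<bullet> b)"
  shows "smooth_loc A W f"
  by (intro smooth_locI smooth_on_coords[OF assms(1)] chart_image_open smooth_locD'[OF assms(3)] assms(2))

lemma smooth_loc_compose:
  fixes f :: "'m \<Rightarrow> 'b::real_inner"
  assumes B: "coord_basis (B::'b set)" and W: "open W" and T: "open T" and "f ` W \<subseteq> T"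
    and "smooth_loc A W f" "smooth_on T g"
  shows "smooth_loc A W (\<lambda>p. g (f p))"
proof (rule smooth_locI)
  fix U \<phi> assume c: "(U, \<phi>) \<in> A"
  show "smooth_on (\<phi> ` (U \<inter> W)) (\<lambda>x. g (f (inv_into U \<phi> x)))"
    by (rule smooth_on_compose[OF B chart_image_open[OF c W] T _ smooth_locD'[OF assms(5) c] assms(6)])
      (use assms(4) chart_inv[OF c] in auto)
qed

lemma smooth_loc_continuous:
  assumes W: "open W" and f: "smooth_loc A W f" shows "continuous_on W f"
proof (rule continuous_at_imp_continuous_on, rule ballI)
  fix p assume p: "p \<in> W"
  obtain U \<phi> where c: "(U, \<phi>) \<in> A" "p \<in> U" by (rule chart_ex)
  have "continuous_on (\<phi> ` (U \<inter> W)) (f \<circ> inv_into U \<phi>)"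
    by (rule smooth_on_continuous[OF smooth_locD[OF f c(1)]])
  moreover have "continuous_on (U \<inter> W) \<phi>" using chart(4)[OF c(1)] by (rule continuous_on_subset) auto
  ultimately have "continuous_on (U \<inter> W) ((f \<circ> inv_into U \<phi>) \<circ> \<phi>)" using continuous_on_compose by blast
  then have "continuous_on (U \<inter> W) f"
    by (rule continuous_on_eq) (use chart_inv[OF c(1)] in auto)
  then show "isCont f p"
    using c(2) p continuous_on_eq_continuous_at[OF open_Int[OF chart(1)[OF c(1)] W], of f] by blast
qed

lemma smooth_loc_self: "(U, \<phi>) \<in> A \<Longrightarrow> smooth_loc A U \<phi>"
  unfolding smooth_loc_def using transition by auto

lemma smooth_funs_const: "(\<lambda>_. c) \<in> smooth_funs A"
  by (simp add: smooth_funs_iff smooth_loc_const)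

lemma smooth_funs_add: "f \<in> smooth_funs A \<Longrightarrow> g \<in> smooth_funs A \<Longrightarrow> (\<lambda>p. f p + g p) \<in> smooth_funs A"
  by (simp add: smooth_funs_iff smooth_loc_add)

lemma smooth_funs_mult: "f \<in> smooth_funs A \<Longrightarrow> g \<in> smooth_funs A \<Longrightarrow> (\<lambda>p. f p * g p) \<in> smooth_funs A"
  by (simp add: smooth_funs_iff smooth_loc_mult)

lemma smooth_funs_cmult: "g \<in> smooth_funs A \<Longrightarrow> (\<lambda>p. c * g p) \<in> smooth_funs A"
  by (intro smooth_funs_mult smooth_funs_const)

lemma smooth_funs_minus: "g \<in> smooth_funs A \<Longrightarrow> (\<lambda>p. - g p) \<in> smooth_funs A"
  using smooth_funs_cmult[of g "-1"] by simp

lemma smooth_funs_diff: "f \<in> smooth_funs A \<Longrightarrow> g \<in> smooth_funs A \<Longrightarrow> (\<lambda>p. f p - g p) \<in> smooth_funs A"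
  using smooth_funs_add[OF _ smooth_funs_minus, of f g] by simp

lemma smooth_funs_sum_list:
  "(\<And>x. x \<in> set xs \<Longrightarrow> f x \<in> smooth_funs A) \<Longrightarrow> (\<lambda>p. \<Sum>x\<leftarrow>xs. f x p) \<in> smooth_funs A"
  by (induction xs) (auto intro: smooth_funs_const smooth_funs_add)

lemmas smooth_funs_intros = smooth_funs_const smooth_funs_add smooth_funs_mult smooth_funs_minus
  smooth_funs_diff smooth_funs_sum_list

text \<open>Where \<open>h\<close> is nonzero, \<open>f\<close> is the product of \<open>1/h\<close>
  and \<open>h f\<close>. This form suits functions that are controlled only after multiplication by
  the cut-off factor of a frame.\<close>

lemma smooth_funs_locI:
  assumes "\<And>p. \<exists>h\<in>smooth_funs A. h p \<noteq> 0 \<and> (\<lambda>q. h q * f q) \<in> smooth_funs A"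
  shows "f \<in> smooth_funs A"
  unfolding smooth_funs_iff
proof (rule smooth_loc_local)
  fix p
  obtain h where h: "h \<in> smooth_funs A" "h p \<noteq> 0" "(\<lambda>q. h q * f q) \<in> smooth_funs A"
    using assms by blast
  let ?W = "{q. h q \<noteq> 0}"
  have "continuous_on UNIV h" using h(1) smooth_loc_continuous[of UNIV] by (simp add: smooth_funs_iff)
  then have W: "open ?W" by (intro open_Collect_neq continuous_on_const)
  have "smooth_loc A ?W (\<lambda>q. inverse (h q) * (h q * f q))"
    by (rule smooth_loc_mult[OF W smooth_loc_inverse[OF W]])
      (use h in \<open>auto simp: smooth_funs_iff intro: smooth_loc_subset[OF _ subset_UNIV]\<close>)
  then have "smooth_loc A ?W f" by (rule smooth_loc_cong[OF W]) auto
  then show "\<exists>W'. open W' \<and> p \<in> W' \<and> smooth_loc A W' f" using W h(2) by blast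
qed

text \<open>\<open>W\<close> and the complement of \<open>K\<close> form an open cover, and on the
  latter the product is zero whatever values \<open>F\<close> takes there.\<close>

lemma smooth_funs_extend:
  assumes "k \<in> smooth_funs A" "closed K" "K \<subseteq> W" "open W" "\<And>q. q \<notin> K \<Longrightarrow> k q = 0"
    and "smooth_loc A W F"
  shows "(\<lambda>q. k q * F q) \<in> smooth_funs A"
  unfolding smooth_funs_iff
proof (rule smooth_loc_local)
  fix p
  have "smooth_loc A W (\<lambda>q. k q * F q)"
    using assms by (intro smooth_loc_mult)
      (auto simp: smooth_funs_iff intro: smooth_loc_subset[OF _ subset_UNIV])
  moreover have "smooth_loc A (- K) (\<lambda>q. k q * F q)"
    by (rule smooth_loc_cong[OF _ smooth_loc_const[of _ 0]]) (use assms in auto)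
  moreover have "p \<in> W \<or> p \<in> - K" using assms(3) by blast
  ultimately show "\<exists>W'. open W' \<and> p \<in> W' \<and> smooth_loc A W' (\<lambda>q. k q * F q)"
    using assms(4) open_Compl[OF assms(2)] by blast
qed

lemma bump:
  assumes "open W" "p \<in> W"
  obtains k K where "k \<in> smooth_funs A" "closed K" "K \<subseteq> W" "k p = 1" "\<And>q. q \<notin> K \<Longrightarrow> k q = 0"
proof -
  obtain U \<phi> where c: "(U, \<phi>) \<in> A" "p \<in> U" by (rule chart_ex)
  obtain B :: "'a set" where B: "coord_basis B" by (rule model_basis)
  have "open (\<phi> ` (U \<inter> W))" using chart_image_open[OF c(1) assms(1)] .
  moreover have "\<phi> p \<in> \<phi> ` (U \<inter> W)" using assms(2) c(2) by blast
  ultimately obtain r where r: "r > 0" "cball (\<phi> p) r \<subseteq> \<phi> ` (U \<inter> W)"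
    unfolding open_contains_cball by blast
  obtain \<kappa> :: "'a \<Rightarrow> real" where \<kappa>: "smooth_on UNIV \<kappa>" "\<kappa> (\<phi> p) = 1"
    "\<And>x. x \<notin> cball (\<phi> p) r \<Longrightarrow> \<kappa> x = 0"
    by (rule smooth_on_bump[OF r(1), of "\<phi> p"]) blast
  define K where "K = inv_into U \<phi> ` cball (\<phi> p) r"
  have cont: "continuous_on (cball (\<phi> p) r) (inv_into U \<phi>)"
    using chart(5)[OF c(1)] by (rule continuous_on_subset) (use r in auto)
  \<comment> \<open>A compact subset of a Hausdorff space: \<open>K\<close> is closed in the whole
    manifold, not just in \<open>U\<close>, and this is what makes the extension of \<open>k\<close>
    by zero smooth.\<close>
  have K: "closed K"
    unfolding K_def by (intro compact_imp_closed compact_continuous_image cont compact_cball_coord_basis[OF B])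
  have KO: "K \<subseteq> U \<inter> W" unfolding K_def using r chart_inv[OF c(1)] by force
  define k where "k q = (if q \<in> U then \<kappa> (\<phi> q) else 0)" for q
  have k0: "k q = 0" if "q \<notin> K" for q
    using that \<kappa>(3)[of "\<phi> q"] chart_inv[OF c(1)] unfolding k_def K_def by force
  have "k \<in> smooth_funs A"
    unfolding smooth_funs_iff
  proof (rule smooth_loc_local)
    fix q
    have "smooth_loc A U (\<lambda>q. \<kappa> (\<phi> q))"
      by (rule smooth_loc_compose[OF B chart(1)[OF c(1)] open_UNIV _ smooth_loc_self[OF c(1)] \<kappa>(1)]) simp
    then have "smooth_loc A U k" by (rule smooth_loc_cong[OF chart(1)[OF c(1)]]) (simp add: k_def)
    moreover have "smooth_loc A (- K) k"
      by (rule smooth_loc_cong[OF _ smooth_loc_const[of _ 0]]) (use K k0 in auto)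
    moreover have "q \<in> U \<or> q \<in> - K" using KO by blast
    ultimately show "\<exists>W'. open W' \<and> q \<in> W' \<and> smooth_loc A W' k"
      using open_Compl[OF K] chart(1)[OF c(1)] by blast
  qed
  then show ?thesis using that[of k K] K KO k0 c(2) \<kappa>(2) by (auto simp: k_def)
qed

section \<open>Tangent vectors and vector fields\<close>

lemma smooth_funs_chart_derivative:
  assumes c: "(U, \<phi>) \<in> A" "p \<in> U" and f: "f \<in> smooth_funs A"
  shows "((f \<circ> inv_into U \<phi>) has_derivative frechet_derivative (f \<circ> inv_into U \<phi>) (at (\<phi> p))) (at (\<phi> p))"
proof -
  have "smooth_on (\<phi> ` U) (f \<circ> inv_into U \<phi>)" using f c(1) by (auto simp: smooth_funs_def)
  then show ?thesis by (rule smooth_on_has_derivative) (use c(2) in auto)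
qed

text \<open>The definition lets the chart vary with the vector. The derivative of the transition map
  carries the coordinates to a prescribed chart, so that several vectors at \<open>p\<close> can be
  compared in the same one.\<close>

lemma tangent_space_chart:
  assumes z: "z \<in> tangent_space A p" and c: "(U, \<phi>) \<in> A" "p \<in> U"
  shows "\<exists>v. z = tvec_at A U \<phi> p v"
proof -
  obtain V \<psi> w where d: "(V, \<psi>) \<in> A" "p \<in> V" and z: "z = tvec_at A V \<psi> p w"
    using z unfolding tangent_space_alt by blast
  let ?T = "\<phi> \<circ> inv_into V \<psi>"
  have op: "open (\<psi> ` (V \<inter> U))" using chart_image_open[OF d(1) chart(1)[OF c(1)]] .
  have x: "\<psi> p \<in> \<psi> ` (V \<inter> U)" using c d by blast
  have dT: "(?T has_derivative frechet_derivative ?T (at (\<psi> p))) (at (\<psi> p))"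
    by (rule smooth_on_has_derivative[OF transition[OF d(1) c(1)] x])
  have Tp: "?T (\<psi> p) = \<phi> p" using chart_inv[OF d] by simp
  have "frechet_derivative (f \<circ> inv_into V \<psi>) (at (\<psi> p)) w =
      frechet_derivative (f \<circ> inv_into U \<phi>) (at (\<phi> p)) (frechet_derivative ?T (at (\<psi> p)) w)"
    if f: "f \<in> smooth_funs A" for f
  proof -
    let ?D = "\<lambda>w. frechet_derivative (f \<circ> inv_into U \<phi>) (at (\<phi> p)) (frechet_derivative ?T (at (\<psi> p)) w)"
    have "((f \<circ> inv_into U \<phi>) has_derivative frechet_derivative (f \<circ> inv_into U \<phi>) (at (\<phi> p))) (at (?T (\<psi> p)))"
      unfolding Tp by (rule smooth_funs_chart_derivative[OF c f])
    then have "((\<lambda>x. (f \<circ> inv_into U \<phi>) (?T x)) has_derivative ?D) (at (\<psi> p))"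
      by (rule has_derivative_compose[OF dT])
    then have "((f \<circ> inv_into V \<psi>) has_derivative ?D) (at (\<psi> p))"
      by (rule has_derivative_transform_within_open[OF _ op x])
        (use chart_inv[OF d(1)] chart_inv[OF c(1)] in auto)
    then show ?thesis using frechet_derivative_eqI by metis
  qed
  then have "z = tvec_at A U \<phi> p (frechet_derivative ?T (at (\<psi> p)) w)"
    unfolding z tvec_at_def by auto
  then show ?thesis ..
qed

lemma tvec_at_in: "(U, \<phi>) \<in> A \<Longrightarrow> p \<in> U \<Longrightarrow> tvec_at A U \<phi> p v \<in> tangent_space A p"
  unfolding tangent_space_alt by blast

lemma tangent_space_lincomb:
  assumes z: "z \<in> tangent_space A p" and w: "w \<in> tangent_space A p"
  shows "(p, \<lambda>f. a * snd z f + b * snd w f) \<in> tangent_space A p"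
proof -
  obtain U \<phi> where c: "(U, \<phi>) \<in> A" "p \<in> U" by (rule chart_ex)
  obtain v v' where v: "z = tvec_at A U \<phi> p v" "w = tvec_at A U \<phi> p v'"
    using tangent_space_chart[OF z c] tangent_space_chart[OF w c] by blast
  have "(p, \<lambda>f. a * snd z f + b * snd w f) = tvec_at A U \<phi> p (a *\<^sub>R v + b *\<^sub>R v')"
    unfolding v tvec_at_def
    using has_derivative_linear[OF smooth_funs_chart_derivative[OF c]]
    by (auto simp: linear_add linear_scale)
  then show ?thesis using tvec_at_in[OF c] by simp
qed

lemma tangent_space_rules:
  assumes z: "z \<in> tangent_space A p" and f: "f \<in> smooth_funs A" and g: "g \<in> smooth_funs A"
  shows "snd z (\<lambda>_. r) = 0"
    "snd z (\<lambda>q. f q + g q) = snd z f + snd z g"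
    "snd z (\<lambda>q. f q * g q) = f p * snd z g + snd z f * g p"
proof -
  obtain U \<phi> v where c: "(U, \<phi>) \<in> A" "p \<in> U" and v: "z = tvec_at A U \<phi> p v"
    using z unfolding tangent_space_alt by blast
  note D = smooth_funs_chart_derivative[OF c]
  have [simp]: "inv_into U \<phi> (\<phi> p) = p" by (rule chart_inv[OF c])
  have 1: "(((\<lambda>_. r) \<circ> inv_into U \<phi>) has_derivative (\<lambda>_. 0)) (at (\<phi> p))" by (simp add: o_def)
  show "snd z (\<lambda>_. r) = 0"
    using frechet_derivative_eqI[OF 1] by (simp add: v tvec_at_def)
  note 2 = has_derivative_add[OF D[OF f] D[OF g]]
  show "snd z (\<lambda>q. f q + g q) = snd z f + snd z g"
    using frechet_derivative_eqI[OF 2] by (simp add: v tvec_at_def f g smooth_funs_add o_def)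
  note 3 = has_derivative_mult[OF D[OF f] D[OF g]]
  show "snd z (\<lambda>q. f q * g q) = f p * snd z g + snd z f * g p"
    using frechet_derivative_eqI[OF 3] by (simp add: v tvec_at_def f g smooth_funs_mult o_def)
qed

text \<open>Base point and direction vary together. Expanding the direction in a coordinate basis
  separates them into derivatives in fixed directions and smooth coefficients.\<close>

lemma smooth_loc_frechet:
  assumes c: "(U, \<phi>) \<in> A" and f: "f \<in> smooth_funs A" and v: "smooth_loc A U v"
  shows "smooth_loc A U (\<lambda>p. frechet_derivative (f \<circ> inv_into U \<phi>) (at (\<phi> p)) (v p))"
proof -
  obtain B :: "'a set" where B: "coord_basis B" by (rule model_basis)
  note U = chart(1)[OF c]
  let ?D = "\<lambda>x. frechet_derivative (f \<circ> inv_into U \<phi>) (at x)"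
  have "smooth_on (\<phi> ` U) (f \<circ> inv_into U \<phi>)" using f c by (auto simp: smooth_funs_def)
  then have D: "smooth_loc A U (\<lambda>p. ?D (\<phi> p) b)" for b
    by (intro smooth_loc_compose[OF B U chart(2)[OF c] _ smooth_loc_self[OF c]] smooth_on_frechet)
      (auto simp: o_def)
  have "smooth_loc A U (\<lambda>p. \<Sum>b\<in>B'. (v p \<bullet> b) * ?D (\<phi> p) b)" if "finite B'" for B'
    using that
  proof induction
    case empty
    then show ?case by (simp add: smooth_loc_const U)
  next
    case (insert b F)
    then show ?case
      unfolding sum.insert[OF insert(1,2)]
      by (intro smooth_loc_add smooth_loc_mult U D smooth_loc_bounded_linear[OF U bounded_linear_inner_left v])
  qed
  then have "smooth_loc A U (\<lambda>p. \<Sum>b\<in>B. (v p \<bullet> b) * ?D (\<phi> p) b)" using B by (simp add: coord_basis_def)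
  then show ?thesis
  proof (rule smooth_loc_cong[OF U])
    fix p assume p: "p \<in> U"
    have lin: "linear (?D (\<phi> p))"
      using smooth_funs_chart_derivative[OF c p f] by (rule has_derivative_linear)
    have "?D (\<phi> p) (v p) = ?D (\<phi> p) (\<Sum>b\<in>B. (v p \<bullet> b) *\<^sub>R b)" using B by (simp add: coord_basis_def)
    also have "\<dots> = (\<Sum>b\<in>B. (v p \<bullet> b) * ?D (\<phi> p) b)" by (simp add: linear_sum[OF lin] linear_scale[OF lin])
    finally show "(\<Sum>b\<in>B. (v p \<bullet> b) * ?D (\<phi> p) b) = ?D (\<phi> p) (v p)" ..
  qed
qed

lemma vector_fields_lincomb:
  assumes X: "X \<in> vector_fields A" and Y: "Y \<in> vector_fields A"
    and a: "a \<in> smooth_funs A" and b: "b \<in> smooth_funs A"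
  shows "(\<lambda>p. (p, \<lambda>f. a p * snd (X p) f + b p * snd (Y p) f)) \<in> vector_fields A"
  using assms tangent_space_lincomb unfolding vector_fields_def
  by (auto intro!: smooth_funs_intros)

end

text \<open>\<open>smooth_map\<close> speaks of charts of the target only. Writing \<open>g\<close>
  in a chart around \<open>F p\<close> and applying the chain rule turns this into a statement about
  functions.\<close>

lemma smooth_map_pullback:
  fixes B :: "('n::{t2_space,second_countable_topology}, 'b::real_inner) atlas"
  assumes "smooth_manifold A" "smooth_manifold B"
    and F: "smooth_map A B F" and g: "smooth_loc B W g" and W: "open W"
  shows "smooth_loc A (F -` W) (g \<circ> F)"
proof -
  interpret A: smooth_manifold A by fact
  interpret B: smooth_manifold B by fact
  have cont: "continuous_on UNIV F" using F by (simp add: smooth_map_iff)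
  show ?thesis
  proof (rule A.smooth_loc_local)
    fix p assume p: "p \<in> F -` W"
    obtain V \<psi> where d: "(V, \<psi>) \<in> B" "F p \<in> V" by (rule B.chart_ex)
    obtain C :: "'b set" where C: "coord_basis C" by (rule B.model_basis)
    let ?W = "F -` (V \<inter> W)"
    have op: "open ?W"
      by (intro open_vimage cont open_Int W B.chart(1)[OF d(1)])
    have s: "smooth_loc A ?W (\<psi> \<circ> F)"
      using F d by (auto simp: smooth_map_iff intro: smooth_loc_subset)
    have "smooth_on (\<psi> ` (V \<inter> W)) (g \<circ> inv_into V \<psi>)" using g d by (auto simp: smooth_loc_def)
    then have "smooth_loc A ?W (\<lambda>p. (g \<circ> inv_into V \<psi>) ((\<psi> \<circ> F) p))"
      by (intro A.smooth_loc_compose[OF C op B.chart_image_open[OF d(1) W] _ s]) (auto simp: o_def)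
    then have "smooth_loc A ?W (g \<circ> F)"
      by (rule A.smooth_loc_cong[OF op]) (use B.chart_inv[OF d(1)] in auto)
    then show "\<exists>W'. open W' \<and> p \<in> W' \<and> smooth_loc A W' (g \<circ> F)" using op p d(2) by blast
  qed
qed

lemma smooth_map_pullback_funs:
  assumes "smooth_manifold A" "smooth_manifold B" "smooth_map A B F" "g \<in> smooth_funs B"
  shows "(\<lambda>p. g (F p)) \<in> smooth_funs A"
  using smooth_map_pullback[OF assms(1-3), of UNIV g] assms(4) by (simp add: smooth_funs_iff o_def)

section \<open>Vector bundles\<close>

text \<open>These are the functions \<open>fun_hat G \<theta>\<close> of sections
  \<open>\<theta>\<close> of the dual bundle. Elements of \<open>sec_dual\<close> have arbitrary
  values off the fibre, whereas here identities between forms are plain equalities of functions on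
  \<open>E\<close>.\<close>

definition lin_funs ::
    "('m, 'e, 'a::real_inner, 'b::real_inner) algebroid \<Rightarrow> ('e \<Rightarrow> real) set" where
  "lin_funs G = {g \<in> Cinf_E G.
     (\<forall>u v. proj G u = proj G v \<longrightarrow> g (fadd G u v) = g u + g v) \<and>
     (\<forall>c u. g (fscale G c u) = c * g u)}"



lemma lin_funs_sec_dual: "g \<in> lin_funs G \<Longrightarrow> (\<lambda>_. g) \<in> sec_dual G"
  unfolding sec_dual_def lin_funs_def fun_hat_def by auto

lemma smooth_map_id: "smooth_manifold A \<Longrightarrow> smooth_map A A (\<lambda>x. x)"
  unfolding smooth_map_iff by (auto simp: o_def vimage_def dest: smooth_manifold.smooth_loc_self)

locale vbundle =
  fixes G :: "('m::{t2_space,second_countable_topology}, 'e::{t2_space,second_countable_topology},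
      'a::real_inner, 'b::real_inner) algebroid"
  assumes vb: "vector_bundle G"
begin

lemmas vb_parts =
  conjunct1[OF vb[unfolded vector_bundle_def]]
  conjunct1[OF conjunct2[OF vb[unfolded vector_bundle_def]]]
  conjunct1[OF conjunct2[OF conjunct2[OF vb[unfolded vector_bundle_def]]]]
  conjunct1[OF conjunct2[OF conjunct2[OF conjunct2[OF vb[unfolded vector_bundle_def]]]]]
  conjunct1[OF conjunct2[OF conjunct2[OF conjunct2[OF conjunct2[OF vb[unfolded vector_bundle_def]]]]]]
  conjunct2[OF conjunct2[OF conjunct2[OF conjunct2[OF conjunct2[OF vb[unfolded vector_bundle_def]]]]]]

sublocale M: smooth_manifold "base_atlas G"
  by (rule smooth_manifold.intro) (rule vb_parts(1))

sublocale E: smooth_manifold "total_atlas G"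
  by (rule smooth_manifold.intro) (rule vb_parts(6))

lemma proj_fadd [simp]: "proj G u = proj G v \<Longrightarrow> proj G (fadd G u v) = proj G u"
  using vb_parts(2) by blast

lemma proj_fscale [simp]: "proj G (fscale G c u) = proj G u"
  using vb_parts(3) by blast

lemma sec_dual_lin_funs:
  assumes "\<theta> \<in> sec_dual G" shows "fun_hat G \<theta> \<in> lin_funs G"
proof -
  have "\<theta> (proj G (fadd G u v)) (fadd G u v) = \<theta> (proj G u) u + \<theta> (proj G v) v"
    if "proj G u = proj G v" for u v
    using assms that[symmetric] unfolding sec_dual_def by simp
  then show ?thesis using assms unfolding sec_dual_def lin_funs_def fun_hat_def by simp
qed

lemma triv_ex: obtains W \<psi> where "(W, \<psi>) \<in> trivs G" "p \<in> W"
proof -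
  have "p \<in> (\<Union>(W, \<psi>)\<in>trivs G. W)" unfolding vb_parts(4) ..
  then show ?thesis using that by auto
qed

lemma triv:
  assumes "(W, \<psi>) \<in> trivs G"
  shows "open W" "p \<in> W \<Longrightarrow> bij_betw \<psi> {u. proj G u = p} UNIV"
    "proj G u \<in> W \<Longrightarrow> proj G u = proj G v \<Longrightarrow> \<psi> (fadd G u v) = \<psi> u + \<psi> v"
    "proj G u \<in> W \<Longrightarrow> \<psi> (fscale G c u) = c *\<^sub>R \<psi> u"
proof -
  have *: "open W \<and>
        (\<forall>p\<in>W. bij_betw \<psi> {u. proj G u = p} UNIV) \<and>
        (\<forall>u v. proj G u \<in> W \<and> proj G u = proj G v \<longrightarrow> \<psi> (fadd G u v) = \<psi> u + \<psi> v) \<and>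
        (\<forall>c u. proj G u \<in> W \<longrightarrow> \<psi> (fscale G c u) = c *\<^sub>R \<psi> u)"
    using bspec[OF vb_parts(5) assms] unfolding prod.case .
  show "open W" using * by blast
  show "p \<in> W \<Longrightarrow> bij_betw \<psi> {u. proj G u = p} UNIV"
    "proj G u \<in> W \<Longrightarrow> proj G u = proj G v \<Longrightarrow> \<psi> (fadd G u v) = \<psi> u + \<psi> v"
    "proj G u \<in> W \<Longrightarrow> \<psi> (fscale G c u) = c *\<^sub>R \<psi> u"
    using * by blast+
qed

definition fib :: "('e \<Rightarrow> 'b) \<Rightarrow> 'm \<Rightarrow> 'b \<Rightarrow> 'e" where
  "fib \<psi> p = inv_into {u. proj G u = p} \<psi>"

lemma fib:
  assumes "(W, \<psi>) \<in> trivs G" "p \<in> W"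
  shows "proj G (fib \<psi> p y) = p" "\<psi> (fib \<psi> p y) = y"
    "proj G u = p \<Longrightarrow> fib \<psi> p (\<psi> u) = u"
proof -
  note b = triv(2)[OF assms]
  have "y \<in> \<psi> ` {u. proj G u = p}" using b by (simp add: bij_betw_def)
  then show "proj G (fib \<psi> p y) = p" "\<psi> (fib \<psi> p y) = y"
    unfolding fib_def using inv_into_into[of y \<psi> "{u. proj G u = p}"] f_inv_into_f[of y \<psi>] by simp_all
  show "proj G u = p \<Longrightarrow> fib \<psi> p (\<psi> u) = u"
    unfolding fib_def using b by (simp add: bij_betw_def)
qed

lemma triv_inj:
  assumes "(W, \<psi>) \<in> trivs G" "proj G u \<in> W" "proj G v = proj G u" "\<psi> u = \<psi> v"
  shows "u = v"
proof -
  have "u = fib \<psi> (proj G u) (\<psi> u)" by (rule fib(3)[OF assms(1,2) refl, symmetric])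
  also have "\<dots> = v" unfolding assms(4) by (rule fib(3)[OF assms(1-3)])
  finally show ?thesis .
qed

lemma fib_linear:
  assumes "(W, \<psi>) \<in> trivs G" "p \<in> W"
  shows "fib \<psi> p (y + y') = fadd G (fib \<psi> p y) (fib \<psi> p y')"
    and "fib \<psi> p (c *\<^sub>R y) = fscale G c (fib \<psi> p y)"
proof -
  note f = fib(1,2)[OF assms]
  show "fib \<psi> p (y + y') = fadd G (fib \<psi> p y) (fib \<psi> p y')"
    by (rule triv_inj[OF assms(1)]) (simp_all add: f assms(2) triv(3)[OF assms(1)])
  show "fib \<psi> p (c *\<^sub>R y) = fscale G c (fib \<psi> p y)"
    by (rule triv_inj[OF assms(1)]) (simp_all add: f assms(2) triv(4)[OF assms(1)])
qed

lemma total_chart: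
  "(U, \<phi>) \<in> base_atlas G \<Longrightarrow> (W, \<psi>) \<in> trivs G \<Longrightarrow>
    (proj G -` (U \<inter> W), \<lambda>u. (\<phi> (proj G u), \<psi> u)) \<in> total_atlas G"
  unfolding total_atlas_def by blast

text \<open>The atlases provide finite dimension for the models \<open>'a\<close> and
  \<open>'a \<times> 'b\<close>; the second components of a basis of the product span
  \<open>'b\<close>.\<close>

lemma fiber_basis: obtains B :: "'b set" where "coord_basis B"
proof -
  obtain C :: "('a \<times> 'b) set" where C: "coord_basis C" by (rule E.model_basis)
  have "y \<in> span (snd ` C)" for y :: 'b
  proof -
    have "y = snd (\<Sum>c\<in>C. ((0, y) \<bullet> c) *\<^sub>R c)" using C by (simp add: coord_basis_def)
    also have "\<dots> = (\<Sum>c\<in>C. ((0, y) \<bullet> c) *\<^sub>R snd c)" by (simp add: snd_sum)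
    also have "\<dots> \<in> span (snd ` C)" by (intro span_sum span_scale span_base) auto
    finally show ?thesis .
  qed
  then have "span (snd ` C) = UNIV" by blast
  moreover have "finite (snd ` C)" using C by (simp add: coord_basis_def)
  ultimately show ?thesis using coord_basis_exists that by blast
qed

text \<open>Read off from the charts of the total space, in which the projection is the first
  coordinate followed by an inverse chart of the base.\<close>

lemma proj_continuous: "continuous_on UNIV (proj G)"
proof (rule continuous_at_imp_continuous_on, rule ballI)
  fix u
  obtain U \<phi> where c: "(U, \<phi>) \<in> base_atlas G" "proj G u \<in> U" by (rule M.chart_ex)
  obtain W \<psi> where t: "(W, \<psi>) \<in> trivs G" "proj G u \<in> W" by (rule triv_ex)
  let ?D = "proj G -` (U \<inter> W)" and ?\<chi> = "\<lambda>u. (\<phi> (proj G u), \<psi> u)"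
  note tc = total_chart[OF c(1) t(1)]
  have "continuous_on ?D (\<lambda>u. fst (?\<chi> u))" by (intro continuous_on_fst E.chart(4)[OF tc])
  then have "continuous_on ?D (\<lambda>u. inv_into U \<phi> (fst (?\<chi> u)))"
    by (rule continuous_on_compose2[OF M.chart(5)[OF c(1)]]) auto
  then have "continuous_on ?D (proj G)"
    by (rule continuous_on_eq) (use M.chart_inv[OF c(1)] in auto)
  then show "isCont (proj G) u"
    using continuous_on_eq_continuous_at[OF E.chart(1)[OF tc]] c t by blast
qed

lemma triv_smooth:
  assumes c: "(U, \<phi>) \<in> base_atlas G" and t: "(W, \<psi>) \<in> trivs G"
  shows "smooth_loc (total_atlas G) (proj G -` (U \<inter> W)) (\<lambda>u. \<phi> (proj G u))"
    "smooth_loc (total_atlas G) (proj G -` (U \<inter> W)) \<psi>"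
proof -
  note tc = total_chart[OF c t]
  show "smooth_loc (total_atlas G) (proj G -` (U \<inter> W)) (\<lambda>u. \<phi> (proj G u))"
    using E.smooth_loc_bounded_linear[OF E.chart(1)[OF tc] bounded_linear_fst E.smooth_loc_self[OF tc]]
    by simp
  show "smooth_loc (total_atlas G) (proj G -` (U \<inter> W)) \<psi>"
    using E.smooth_loc_bounded_linear[OF E.chart(1)[OF tc] bounded_linear_snd E.smooth_loc_self[OF tc]]
    by simp
qed

lemma proj_smooth: "smooth_map (total_atlas G) (base_atlas G) (proj G)"
  unfolding smooth_map_iff
proof (intro conjI proj_continuous ballI, clarify)
  fix U \<phi> assume c: "(U, \<phi>) \<in> base_atlas G"
  show "smooth_loc (total_atlas G) (proj G -` U) (\<phi> \<circ> proj G)"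
  proof (rule E.smooth_loc_local)
    fix u assume u: "u \<in> proj G -` U"
    obtain W \<psi> where t: "(W, \<psi>) \<in> trivs G" "proj G u \<in> W" by (rule triv_ex)
    show "\<exists>W'. open W' \<and> u \<in> W' \<and> smooth_loc (total_atlas G) W' (\<phi> \<circ> proj G)"
      using triv_smooth(1)[OF c t(1)] E.chart(1)[OF total_chart[OF c t(1)]] u t(2)
      unfolding o_def by blast
  qed
qed

lemma pull: "f \<in> Cinf_M G \<Longrightarrow> (\<lambda>u. f (proj G u)) \<in> Cinf_E G"
  by (rule smooth_map_pullback_funs[OF E.smooth_manifold_axioms M.smooth_manifold_axioms proj_smooth])

lemma local_data:
  obtains U \<phi> W \<psi> k K where "(U, \<phi>) \<in> base_atlas G" "p \<in> U" "(W, \<psi>) \<in> trivs G" "p \<in> W"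
    "k \<in> Cinf_M G" "closed K" "K \<subseteq> U \<inter> W" "k p = 1" "\<And>q. q \<notin> K \<Longrightarrow> k q = 0"
proof -
  obtain U \<phi> where c: "(U, \<phi>) \<in> base_atlas G" "p \<in> U" by (rule M.chart_ex)
  obtain W \<psi> where t: "(W, \<psi>) \<in> trivs G" "p \<in> W" by (rule triv_ex)
  obtain k K where "k \<in> Cinf_M G" "closed K" "K \<subseteq> U \<inter> W" "k p = 1" "\<And>q. q \<notin> K \<Longrightarrow> k q = 0"
    using M.bump[of "U \<inter> W" p] M.chart(1)[OF c(1)] triv(1)[OF t(1)] c t by blast
  then show ?thesis using that c t by blast
qed

text \<open>A fibre coordinate of a trivialization becomes a global linear function after
  multiplication by a bump function of the base. These are the test functions from which all
  separation statements follow.\<close>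

lemma coord_form_lin:
  assumes c: "(U, \<phi>) \<in> base_atlas G" and t: "(W, \<psi>) \<in> trivs G"
    and k: "k \<in> Cinf_M G" "closed K" "K \<subseteq> U \<inter> W" "\<And>q. q \<notin> K \<Longrightarrow> k q = 0"
  shows "(\<lambda>u. k (proj G u) * (\<psi> u \<bullet> b)) \<in> lin_funs G"
proof -
  note tc = total_chart[OF c t]
  have "(\<lambda>u. k (proj G u) * (\<psi> u \<bullet> b)) \<in> Cinf_E G"
  proof (rule E.smooth_funs_extend[of "\<lambda>u. k (proj G u)" "proj G -` K" "proj G -` (U \<inter> W)"])
    show "closed (proj G -` K)" by (rule closed_vimage[OF k(2) proj_continuous])
    show "smooth_loc (total_atlas G) (proj G -` (U \<inter> W)) (\<lambda>u. \<psi> u \<bullet> b)"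
      by (rule E.smooth_loc_bounded_linear[OF E.chart(1)[OF tc] bounded_linear_inner_left triv_smooth(2)[OF c t]])
  qed (use k pull E.chart(1)[OF tc] in auto)
  moreover have k0: "k (proj G u) = 0" if "proj G u \<notin> W" for u using k(3,4) that by blast
  have "k (proj G (fadd G u v)) * (\<psi> (fadd G u v) \<bullet> b) =
      k (proj G u) * (\<psi> u \<bullet> b) + k (proj G v) * (\<psi> v \<bullet> b)" if "proj G u = proj G v" for u v
  proof (cases "proj G u \<in> W")
    case True
    then show ?thesis using triv(3)[OF t True that] that by (simp add: inner_add_left distrib_left)
  next
    case False
    then show ?thesis using k0[of u] that by simp
  qed
  moreover have "k (proj G (fscale G c u)) * (\<psi> (fscale G c u) \<bullet> b) =
      c * (k (proj G u) * (\<psi> u \<bullet> b))" for c u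
    using k0[of u] triv(4)[OF t, of u c] by (cases "proj G u \<in> W") simp_all
  ultimately show ?thesis unfolding lin_funs_def by blast
qed

lemma lin_smooth: "g \<in> lin_funs G \<Longrightarrow> g \<in> Cinf_E G"
  by (simp add: lin_funs_def)

lemma lin_fadd: "g \<in> lin_funs G \<Longrightarrow> proj G u = proj G v \<Longrightarrow> g (fadd G u v) = g u + g v"
  by (simp add: lin_funs_def)

lemma lin_fscale: "g \<in> lin_funs G \<Longrightarrow> g (fscale G c u) = c * g u"
  by (simp add: lin_funs_def)

text \<open>Where the bump function is 1, the cut-off coordinate forms are the coordinates of the
  trivialization.\<close>

lemma lin_sep:
  assumes "proj G u = proj G v" "\<And>g. g \<in> lin_funs G \<Longrightarrow> g u = g v"
  shows "u = v"
proof -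
  obtain U \<phi> W \<psi> k K where d: "(U, \<phi>) \<in> base_atlas G" "proj G u \<in> U" "(W, \<psi>) \<in> trivs G" "proj G u \<in> W"
    "k \<in> Cinf_M G" "closed K" "K \<subseteq> U \<inter> W" "k (proj G u) = 1" "\<And>q. q \<notin> K \<Longrightarrow> k q = 0"
    by (rule local_data[of "proj G u"]) blast
  have "\<psi> u \<bullet> b = \<psi> v \<bullet> b" for b
    using assms(2)[OF coord_form_lin[OF d(1,3,5,6,7,9), of b]] d(8) assms(1) by simp
  then have "\<psi> u = \<psi> v" by (rule vector_eq_rdot[THEN iffD1, OF allI])
  then show ?thesis using triv_inj[OF d(3,4)] assms(1) by simp
qed

lemma lin_funs_mult_base: "f \<in> Cinf_M G \<Longrightarrow> g \<in> lin_funs G \<Longrightarrow> (\<lambda>u. f (proj G u) * g u) \<in> lin_funs G"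
  by (auto simp: lin_funs_def pull E.smooth_funs_mult algebra_simps)

lemma lin_funs_add: "f \<in> lin_funs G \<Longrightarrow> g \<in> lin_funs G \<Longrightarrow> (\<lambda>u. f u + g u) \<in> lin_funs G"
  by (auto simp: lin_funs_def E.smooth_funs_add algebra_simps)

lemma lin_funs_zero: "(\<lambda>u. 0) \<in> lin_funs G"
  by (auto simp: lin_funs_def E.smooth_funs_const)

text \<open>Smoothness into \<open>E\<close> is tested on the base projection and on linear
  functions. Applied to the cut-off forms, the test gives \<open>k\<close> times a fibre coordinate
  of \<open>F\<close>; dividing by \<open>k\<close> near a point where it is nonzero recovers the
  coordinate.\<close>

lemma smooth_into_total:
  fixes N :: "('n::{t2_space,second_countable_topology}, 'c::real_inner) atlas"
  assumes N: "smooth_manifold N" and P: "smooth_map N (base_atlas G) (\<lambda>x. proj G (F x))"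
    and g: "\<And>g. g \<in> lin_funs G \<Longrightarrow> (\<lambda>x. g (F x)) \<in> smooth_funs N"
  shows "smooth_map N (total_atlas G) F"
proof -
  interpret N: smooth_manifold N by fact
  let ?P = "\<lambda>x. proj G (F x)"
  have contP: "continuous_on UNIV ?P" using P by (simp add: smooth_map_iff)
  obtain B :: "'b set" where B: "coord_basis B" by (rule fiber_basis)
  have op: "open (F -` (proj G -` (U \<inter> W)))" if "(U, \<phi>) \<in> base_atlas G" "(W, \<psi>) \<in> trivs G" for U \<phi> W \<psi>
    using open_vimage[OF open_Int[OF M.chart(1)[OF that(1)] triv(1)[OF that(2)]] contP]
    by (simp add: vimage_def)
  have s2: "smooth_loc N (F -` (proj G -` (U \<inter> W))) (\<lambda>x. \<psi> (F x))"
    if c: "(U, \<phi>) \<in> base_atlas G" and t: "(W, \<psi>) \<in> trivs G" for U \<phi> W \<psi>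
  proof (rule N.smooth_loc_local)
    fix x assume x: "x \<in> F -` (proj G -` (U \<inter> W))"
    obtain k K where k: "k \<in> Cinf_M G" "closed K" "K \<subseteq> U \<inter> W" "k (?P x) = 1" "\<And>q. q \<notin> K \<Longrightarrow> k q = 0"
      using M.bump[of "U \<inter> W" "?P x"] M.chart(1)[OF c] triv(1)[OF t] x by blast
    let ?V = "{y. k (?P y) \<noteq> 0}"
    have kP: "(\<lambda>y. k (?P y)) \<in> smooth_funs N"
      by (rule smooth_map_pullback_funs[where g = k, OF N M.smooth_manifold_axioms P k(1)])
    have V: "open ?V"
      using N.smooth_loc_continuous[OF open_UNIV kP[unfolded smooth_funs_iff]]
      by (intro open_Collect_neq continuous_on_const)
    have "smooth_loc N ?V (\<lambda>y. \<psi> (F y))"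
    proof (rule N.smooth_loc_coords[OF B V])
      fix b
      have "(\<lambda>y. k (?P y) * (\<psi> (F y) \<bullet> b)) \<in> smooth_funs N"
        by (rule g[OF coord_form_lin[OF c t k(1,2,3,5)]])
      then have "smooth_loc N ?V (\<lambda>y. inverse (k (?P y)) * (k (?P y) * (\<psi> (F y) \<bullet> b)))"
        using kP by (intro N.smooth_loc_mult[OF V N.smooth_loc_inverse[OF V]])
          (auto simp: smooth_funs_iff intro: smooth_loc_subset[OF _ subset_UNIV])
      then show "smooth_loc N ?V (\<lambda>y. \<psi> (F y) \<bullet> b)" by (rule N.smooth_loc_cong[OF V]) auto
    qed
    then show "\<exists>W'. open W' \<and> x \<in> W' \<and> smooth_loc N W' (\<lambda>x. \<psi> (F x))" using V k(4) by auto
  qed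
  have s: "smooth_loc N (F -` (proj G -` (U \<inter> W))) (\<lambda>x. (\<phi> (?P x), \<psi> (F x)))"
    if c: "(U, \<phi>) \<in> base_atlas G" and t: "(W, \<psi>) \<in> trivs G" for U \<phi> W \<psi>
  proof -
    have "smooth_loc N (?P -` U) (\<lambda>x. \<phi> (?P x))" using P c by (auto simp: smooth_map_iff o_def)
    then have "smooth_loc N (F -` (proj G -` (U \<inter> W))) (\<lambda>x. \<phi> (?P x))"
      by (rule smooth_loc_subset) auto
    from N.smooth_loc_add[OF op[OF c t]
        N.smooth_loc_bounded_linear[OF op[OF c t] _ this, of "\<lambda>v. (v, 0::'b)"]
        N.smooth_loc_bounded_linear[OF op[OF c t] _ s2[OF c t], of "\<lambda>v. (0::'a, v)"]]
    show ?thesis by (simp add: bounded_linear_Pair bounded_linear_ident bounded_linear_zero)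
  qed
  \<comment> \<open>\<open>smooth_map\<close> demands continuity as well. The chart expression is
    smooth, hence continuous, and composing with the continuous inverse chart gives \<open>F\<close>
    back.\<close>
  have cont: "continuous_on UNIV F"
  proof (rule continuous_at_imp_continuous_on, rule ballI)
    fix x
    obtain U \<phi> where c: "(U, \<phi>) \<in> base_atlas G" "?P x \<in> U" by (rule M.chart_ex)
    obtain W \<psi> where t: "(W, \<psi>) \<in> trivs G" "?P x \<in> W" by (rule triv_ex)
    note tc = total_chart[OF c(1) t(1)] and op = op[OF c(1) t(1)]
    let ?\<chi> = "\<lambda>u. (\<phi> (proj G u), \<psi> u)" and ?D = "proj G -` (U \<inter> W)"
    have "continuous_on (F -` ?D) (\<lambda>x. inv_into ?D ?\<chi> (?\<chi> (F x)))"
      by (rule continuous_on_compose2[OF E.chart(5)[OF tc] N.smooth_loc_continuous[OF op s[OF c(1) t(1)]]])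
        auto
    then have "continuous_on (F -` ?D) F"
      by (rule continuous_on_eq) (rule E.chart_inv[OF tc], auto)
    then show "isCont F x" using continuous_on_eq_continuous_at[OF op] c t by blast
  qed
  show ?thesis
    unfolding smooth_map_iff using cont s
    by (auto simp: total_atlas_def o_def)
qed

section \<open>Sections of the bundle and of its pullback\<close>

lemma sec_EI:
  assumes "\<And>p. proj G (X p) = p" "\<And>g. g \<in> lin_funs G \<Longrightarrow> (\<lambda>p. g (X p)) \<in> Cinf_M G"
  shows "X \<in> sec_E G"
proof -
  have "smooth_map (base_atlas G) (base_atlas G) (\<lambda>p. proj G (X p))"
    unfolding assms(1) by (rule smooth_map_id[OF M.smooth_manifold_axioms])
  from smooth_into_total[OF M.smooth_manifold_axioms this assms(2)]
  show ?thesis using assms(1) by (simp add: sec_E_def)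
qed

lemma sec_E_proj [simp]: "X \<in> sec_E G \<Longrightarrow> proj G (X p) = p"
  by (simp add: sec_E_def)

lemma sec_E_smooth:
  assumes "X \<in> sec_E G" "f \<in> Cinf_E G" shows "(\<lambda>p. f (X p)) \<in> Cinf_M G"
proof -
  have "smooth_map (base_atlas G) (total_atlas G) X" using assms(1) unfolding sec_E_def by blast
  from smooth_map_pullback_funs[OF M.smooth_manifold_axioms E.smooth_manifold_axioms this assms(2)]
  show ?thesis .
qed

lemma smooth_into_total_fibre:
  assumes "\<And>u. proj G (F u) = proj G u" "\<And>g. g \<in> lin_funs G \<Longrightarrow> (\<lambda>u. g (F u)) \<in> Cinf_E G"
  shows "smooth_map (total_atlas G) (total_atlas G) F"
proof -
  have "smooth_map (total_atlas G) (base_atlas G) (\<lambda>u. proj G (F u))"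
    unfolding assms(1) by (rule proj_smooth)
  from smooth_into_total[OF E.smooth_manifold_axioms this assms(2)] show ?thesis .
qed

lemma sec_pbI:
  assumes "\<And>u. fst (x u) = u" "\<And>u. proj G (snd (x u)) = proj G u"
    "\<And>g. g \<in> lin_funs G \<Longrightarrow> (\<lambda>u. g (snd (x u))) \<in> Cinf_E G"
  shows "x \<in> sec_pb G"
proof -
  have "smooth_map (total_atlas G) (total_atlas G) (\<lambda>u. snd (x u))"
    by (rule smooth_into_total_fibre) (use assms in simp_all)
  then show ?thesis using assms(1,2) by (simp add: sec_pb_def o_def)
qed

lemma sec_pb_fst [simp]: "x \<in> sec_pb G \<Longrightarrow> fst (x u) = u"
  unfolding sec_pb_def by blast

lemma sec_pb_proj [simp]: "x \<in> sec_pb G \<Longrightarrow> proj G (snd (x u)) = proj G u"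
  unfolding sec_pb_def by blast

lemma sec_pb_smooth_map: "x \<in> sec_pb G \<Longrightarrow> smooth_map (total_atlas G) (total_atlas G) (snd \<circ> x)"
  unfolding sec_pb_def by blast

lemma sec_pb_smooth:
  assumes "x \<in> sec_pb G" "f \<in> Cinf_E G" shows "(\<lambda>u. f (snd (x u))) \<in> Cinf_E G"
  using smooth_map_pullback_funs[OF E.smooth_manifold_axioms E.smooth_manifold_axioms
      sec_pb_smooth_map[OF assms(1)] assms(2)] by (simp only: o_apply)

lemma sec_E_eqI:
  assumes "X \<in> sec_E G" "Y \<in> sec_E G" "\<And>g p. g \<in> lin_funs G \<Longrightarrow> g (X p) = g (Y p)"
  shows "X = Y"
  by (intro ext lin_sep) (simp_all add: assms)

lemma sec_pb_eqI:
  assumes "x \<in> sec_pb G" "y \<in> sec_pb G" "\<And>g u. g \<in> lin_funs G \<Longrightarrow> g (snd (x u)) = g (snd (y u))"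
  shows "x = y"
proof
  fix u
  have "snd (x u) = snd (y u)" by (rule lin_sep) (simp_all add: assms)
  then show "x u = y u" by (simp add: prod_eq_iff assms)
qed

lemma fibre_nonempty: "\<exists>u. proj G u = p"
proof -
  obtain W \<psi> where t: "(W, \<psi>) \<in> trivs G" "p \<in> W" by (rule triv_ex)
  show ?thesis using fib(1)[OF t] by blast
qed

text \<open>The chosen vector does not affect the value: linear functions vanish on every multiple
  by 0, and they separate the fibre.\<close>

definition zero_sec :: "'m \<Rightarrow> 'e" where
  "zero_sec p = fscale G 0 (SOME u. proj G u = p)"

lemma zero_sec_proj [simp]: "proj G (zero_sec p) = p"
  unfolding zero_sec_def using someI_ex[OF fibre_nonempty] by simp

lemma lin_zero_sec [simp]: "g \<in> lin_funs G \<Longrightarrow> g (zero_sec p) = 0"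
  unfolding zero_sec_def by (simp add: lin_fscale)

lemma zero_sec_in: "zero_sec \<in> sec_E G"
  by (rule sec_EI) (auto simp: M.smooth_funs_const)

lemma fscale_zero: "fscale G 0 u = zero_sec (proj G u)"
  by (rule lin_sep) (auto simp: lin_fscale)

lemma sec_E_add: "X \<in> sec_E G \<Longrightarrow> Y \<in> sec_E G \<Longrightarrow> (\<lambda>p. fadd G (X p) (Y p)) \<in> sec_E G"
  by (rule sec_EI) (auto simp: lin_fadd lin_smooth sec_E_smooth M.smooth_funs_add)

lemma sec_E_smul: "f \<in> Cinf_M G \<Longrightarrow> X \<in> sec_E G \<Longrightarrow> (\<lambda>p. fscale G (f p) (X p)) \<in> sec_E G"
  by (rule sec_EI) (auto simp: lin_fscale lin_smooth sec_E_smooth M.smooth_funs_mult)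

lemma pb_add_in: "x \<in> sec_pb G \<Longrightarrow> y \<in> sec_pb G \<Longrightarrow> pb_add G x y \<in> sec_pb G"
  by (rule sec_pbI) (auto simp: pb_add_def lin_fadd lin_smooth sec_pb_smooth E.smooth_funs_add)

lemma pb_smul_in: "f \<in> Cinf_E G \<Longrightarrow> x \<in> sec_pb G \<Longrightarrow> pb_smul G f x \<in> sec_pb G"
  by (rule sec_pbI) (auto simp: pb_smul_def lin_fscale lin_smooth sec_pb_smooth E.smooth_funs_mult)

lemma pb_zero_in: "pb_zero G \<in> sec_pb G"
  by (rule sec_pbI) (auto simp: pb_zero_def lin_fscale E.smooth_funs_const)

lemma hat_in: "X \<in> sec_E G \<Longrightarrow> hat G X \<in> sec_pb G"
  using pull[OF sec_E_smooth[OF _ lin_smooth], of X] by (intro sec_pbI) (simp_all add: hat_def)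

lemma lin_pb_add: "g \<in> lin_funs G \<Longrightarrow> x \<in> sec_pb G \<Longrightarrow> y \<in> sec_pb G \<Longrightarrow>
    g (snd (pb_add G x y u)) = g (snd (x u)) + g (snd (y u))"
  by (simp add: pb_add_def lin_fadd)

lemma lin_pb_smul: "g \<in> lin_funs G \<Longrightarrow> g (snd (pb_smul G f x u)) = f u * g (snd (x u))"
  by (simp add: pb_smul_def lin_fscale)

lemma lin_pb_zero: "g \<in> lin_funs G \<Longrightarrow> g (snd (pb_zero G u)) = 0"
  by (simp add: pb_zero_def lin_fscale)

text \<open>A local frame and its dual forms, cut off so as to be global. The identity is
  \<open>h u = \<Sum> \<theta>(u) e(\<pi>(u))\<close>, tested against linear functions;
  \<open>h\<close> records the cut-off and is 1 at the point of interest.\<close>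

definition frame :: "'m \<Rightarrow> ('m \<Rightarrow> real) \<Rightarrow> (('e \<Rightarrow> real) \<times> ('m \<Rightarrow> 'e)) list \<Rightarrow> bool" where
  "frame p h fr \<longleftrightarrow> h \<in> Cinf_M G \<and> h p = 1 \<and> set fr \<subseteq> lin_funs G \<times> sec_E G \<and>
     (\<forall>g\<in>lin_funs G. \<forall>u. h (proj G u) * g u = (\<Sum>(\<theta>, e)\<leftarrow>fr. \<theta> u * g (e (proj G u))))"

text \<open>With a bump function \<open>k\<close>, a basis \<open>b\<close> of the model fibre and a trivialization \<open>\<psi>\<close>, take
  \<open>h = k\<^sup>2\<close>, the forms \<open>k \<langle>\<psi>, b\<rangle>\<close> and the sections \<open>k \<psi>\<^sup>-\<^sup>1(b)\<close>.\<close>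
lemma frame_exists: "\<exists>h fr. frame p h fr"
proof -
  obtain U \<phi> W \<psi> k K where c: "(U, \<phi>) \<in> base_atlas G" "p \<in> U" and t: "(W, \<psi>) \<in> trivs G" "p \<in> W"
    and k: "k \<in> Cinf_M G" "closed K" "K \<subseteq> U \<inter> W" "k p = 1" "\<And>q. q \<notin> K \<Longrightarrow> k q = 0"
    by (rule local_data[of "p"]) blast
  obtain B :: "'b set" where B: "coord_basis B" by (rule fiber_basis)
  then obtain bs where bs: "set bs = B" "distinct bs" using finite_distinct_list coord_basis_def by metis
  \<comment> \<open>Outside \<open>W\<close> the inverse \<open>fib\<close> need not land in the
    fibre over \<open>q\<close>, so multiplying by \<open>k q = 0\<close> alone would not give a
    section.\<close>
  define e where "e b q = (if q \<in> W then fscale G (k q) (fib \<psi> q b) else zero_sec q)" for b q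
  let ?\<theta> = "\<lambda>b u. k (proj G u) * (\<psi> u \<bullet> b)"
  let ?D = "proj G -` (U \<inter> W)" and ?\<chi> = "\<lambda>u. (\<phi> (proj G u), \<psi> u)"
  note tc = total_chart[OF c(1) t(1)]
  have UW: "open (U \<inter> W)" using M.chart(1)[OF c(1)] triv(1)[OF t(1)] by blast
  have kW: "k q = 0" if "q \<notin> W" for q using k(3,5) that by blast
  have ge: "g (e b q) = k q * g (fib \<psi> q b)" if "g \<in> lin_funs G" for g b q
    using that kW by (simp add: e_def lin_fscale)
  have "e b \<in> sec_E G" for b
  proof (rule sec_EI)
    show "proj G (e b q) = q" for q using fib(1)[OF t(1)] by (simp add: e_def)
    fix g assume g: "g \<in> lin_funs G"
    have "smooth_loc (base_atlas G) (U \<inter> W) (\<lambda>q. g (fib \<psi> q b))"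
    proof (rule M.smooth_loc_chart[OF c(1) UW])
      have op: "open (\<phi> ` (U \<inter> W))" by (rule M.chart_image_open[OF c(1) triv(1)[OF t(1)]])
      obtain C :: "('a \<times> 'b) set" where C: "coord_basis C" by (rule E.model_basis)
      have s: "smooth_on (?\<chi> ` ?D) (g \<circ> inv_into ?D ?\<chi>)"
        using lin_smooth[OF g] tc by (auto simp: smooth_funs_def)
      \<comment> \<open>In coordinates the section with constant component \<open>b\<close> is the
        affine map \<open>x \<mapsto> (x, b)\<close>.\<close>
      have l: "smooth_on (\<phi> ` (U \<inter> W)) (\<lambda>x. (x, 0) + (0, b))"
        by (intro smooth_on_add[OF op] smooth_on_linear[OF op] smooth_on_const[OF op]
            bounded_linear_Pair bounded_linear_ident bounded_linear_zero)
      have im: "(inv_into U \<phi> x \<in> U \<inter> W) \<and> \<phi> (inv_into U \<phi> x) = x" if "x \<in> \<phi> ` (U \<inter> W)" for x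
        using that M.chart_inv[OF c(1)] by auto
      have chi: "?\<chi> (fib \<psi> q b) = (\<phi> q, b)" if "q \<in> U \<inter> W" for q using that fib[OF t(1)] by simp
      have sub: "(\<lambda>x. (x, 0) + (0, b)) ` \<phi> ` (U \<inter> W) \<subseteq> ?\<chi> ` ?D"
      proof (rule image_subsetI)
        fix x assume "x \<in> \<phi> ` (U \<inter> W)"
        then obtain q where q: "q \<in> U" "q \<in> W" "x = \<phi> q" by blast
        then have "(x, 0) + (0, b) = ?\<chi> (fib \<psi> q b)" "fib \<psi> q b \<in> ?D"
          using chi[of q] fib(1)[OF t(1)] by auto
        then show "(x, 0) + (0, b) \<in> ?\<chi> ` ?D" by (rule image_eqI)
      qed
      show "smooth_on (\<phi> ` (U \<inter> W)) ((\<lambda>q. g (fib \<psi> q b)) \<circ> inv_into U \<phi>)"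
      proof (rule smooth_on_cong[OF op smooth_on_compose[OF C op E.chart(2)[OF tc] sub l s]])
        fix x assume x: "x \<in> \<phi> ` (U \<inter> W)"
        let ?q = "inv_into U \<phi> x"
        have "inv_into ?D ?\<chi> (?\<chi> (fib \<psi> ?q b)) = fib \<psi> ?q b"
          by (rule E.chart_inv[OF tc]) (use im[OF x] fib(1)[OF t(1)] in auto)
        then show "(g \<circ> inv_into ?D ?\<chi>) ((x, 0) + (0, b)) = ((\<lambda>q. g (fib \<psi> q b)) \<circ> inv_into U \<phi>) x"
          using chi[of ?q] im[OF x] by simp
      qed
    qed auto
    then have "(\<lambda>q. k q * g (fib \<psi> q b)) \<in> Cinf_M G"
      by (rule M.smooth_funs_extend[OF k(1-3) UW k(5), rotated])
    then show "(\<lambda>q. g (e b q)) \<in> Cinf_M G" using ge[OF g] by simp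
  qed
  moreover have "?\<theta> b \<in> lin_funs G" for b by (rule coord_form_lin[OF c(1) t(1) k(1,2,3,5)])
  moreover have "(k (proj G u))\<^sup>2 * g u = (\<Sum>b\<leftarrow>bs. ?\<theta> b u * g (e b (proj G u)))"
    if g: "g \<in> lin_funs G" for g u
  proof (cases "proj G u \<in> W")
    case True
    let ?q = "proj G u"
    note f = fib[OF t(1) True] fib_linear[OF t(1) True]
    have lin: "linear (\<lambda>y. g (fib \<psi> ?q y))"
      by (rule linearI) (auto simp: f lin_fadd[OF g] lin_fscale[OF g])
    have "g u = g (fib \<psi> ?q (\<Sum>b\<in>B. (\<psi> u \<bullet> b) *\<^sub>R b))" using B f(3) by (simp add: coord_basis_def)
    also have "\<dots> = (\<Sum>b\<in>B. (\<psi> u \<bullet> b) * g (fib \<psi> ?q b))"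
      by (simp add: linear_sum[OF lin] linear_scale[OF lin])
    finally show ?thesis using bs
      by (simp add: sum_list_distinct_conv_sum_set ge[OF g] sum_distrib_left power2_eq_square mult_ac)
  next
    case False
    then show ?thesis by (simp add: kW)
  qed
  ultimately have "frame p (\<lambda>q. (k q)\<^sup>2) (map (\<lambda>b. (?\<theta> b, e b)) bs)"
    using k(1,4) unfolding frame_def
    by (auto simp: power2_eq_square M.smooth_funs_mult o_def)
  then show ?thesis by blast
qed

text \<open>The derivatives of \<open>k \<langle>\<phi> - \<phi>(p), a\<rangle> \<circ> \<pi>\<close> and \<open>k \<langle>\<psi>, b\<rangle>\<close> recover the coordinates of a tangent
  vector of the total space.\<close>
lemma tangent_coords:
  assumes c: "(U, \<phi>) \<in> base_atlas G" "proj G u \<in> U" and t: "(W, \<psi>) \<in> trivs G" "proj G u \<in> W"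
    and k: "k \<in> Cinf_M G" "closed K" "K \<subseteq> U \<inter> W" "k (proj G u) = 1" "\<And>q. q \<notin> K \<Longrightarrow> k q = 0"
    and z: "z = tvec_at (total_atlas G) (proj G -` (U \<inter> W)) (\<lambda>u. (\<phi> (proj G u), \<psi> u)) u v"
  shows "(\<lambda>q. k q * ((\<phi> q - \<phi> (proj G u)) \<bullet> a)) \<in> Cinf_M G"
    and "snd z (\<lambda>w. k (proj G w) * ((\<phi> (proj G w) - \<phi> (proj G u)) \<bullet> a)) = fst v \<bullet> a"
    and "snd z (\<lambda>w. k (proj G w) * (\<psi> w \<bullet> b)) =
      snd v \<bullet> b + frechet_derivative (k \<circ> inv_into U \<phi>) (at (\<phi> (proj G u))) (fst v) * (\<psi> u \<bullet> b)"
proof -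
  let ?p = "proj G u" and ?D = "proj G -` (U \<inter> W)" and ?\<chi> = "\<lambda>u. (\<phi> (proj G u), \<psi> u)"
  let ?\<kappa> = "k \<circ> inv_into U \<phi>"
  let ?D\<kappa> = "frechet_derivative ?\<kappa> (at (\<phi> ?p))"
  note tc = total_chart[OF c(1) t(1)]
  have u: "u \<in> ?D" using c t by simp
  have UW: "open (U \<inter> W)" using M.chart(1)[OF c(1)] triv(1)[OF t(1)] by blast
  have op: "open (?\<chi> ` ?D)" by (rule E.chart(2)[OF tc])
  have "smooth_loc (base_atlas G) (U \<inter> W) (\<lambda>q. (\<phi> q + - \<phi> ?p) \<bullet> a)"
    by (intro M.smooth_loc_bounded_linear[OF UW bounded_linear_inner_left] M.smooth_loc_add[OF UW]
        M.smooth_loc_const[OF UW] smooth_loc_subset[OF M.smooth_loc_self[OF c(1)]]) auto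
  then show f: "(\<lambda>q. k q * ((\<phi> q - \<phi> ?p) \<bullet> a)) \<in> Cinf_M G"
    using M.smooth_funs_extend[OF k(1-3) UW k(5)] by simp
  have k1: "?\<kappa> (\<phi> ?p) = 1" using k(4) M.chart_inv[OF c] by simp
  have "(?\<kappa> has_derivative ?D\<kappa>) (at (fst (?\<chi> u)))"
    using M.smooth_funs_chart_derivative[OF c k(1)] by simp
  from has_derivative_compose[OF bounded_linear_imp_has_derivative[OF bounded_linear_fst] this]
  have d\<kappa>: "((\<lambda>x. ?\<kappa> (fst x)) has_derivative (\<lambda>x. ?D\<kappa> (fst x))) (at (?\<chi> u))" .
  have inv: "proj G (inv_into ?D ?\<chi> x) = inv_into U \<phi> (fst x)" "\<psi> (inv_into ?D ?\<chi> x) = snd x"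
    "\<phi> (inv_into U \<phi> (fst x)) = fst x"
    if x: "x \<in> ?\<chi> ` ?D" for x
  proof -
    obtain w where w: "w \<in> ?D" "x = ?\<chi> w" using x by blast
    have "inv_into ?D ?\<chi> x = w" unfolding w(2) by (rule E.chart_inv[OF tc w(1)])
    moreover have "inv_into U \<phi> (fst x) = proj G w" unfolding w(2) using w(1) M.chart_inv[OF c(1)] by simp
    ultimately show "proj G (inv_into ?D ?\<chi> x) = inv_into U \<phi> (fst x)" "\<psi> (inv_into ?D ?\<chi> x) = snd x"
      "\<phi> (inv_into U \<phi> (fst x)) = fst x" using w by auto
  qed
  have x: "?\<chi> u \<in> ?\<chi> ` ?D" using u by blast
  have "((\<lambda>x. ?\<kappa> (fst x) * ((fst x - \<phi> ?p) \<bullet> a)) has_derivative (\<lambda>x. fst x \<bullet> a)) (at (?\<chi> u))"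
    by (rule derivative_eq_intros d\<kappa> refl | simp add: k1[simplified])+
  then have "(((\<lambda>w. k (proj G w) * ((\<phi> (proj G w) - \<phi> ?p) \<bullet> a)) \<circ> inv_into ?D ?\<chi>) has_derivative
      (\<lambda>x. fst x \<bullet> a)) (at (?\<chi> u))"
    by (rule has_derivative_transform_within_open[OF _ op x]) (simp only: o_apply inv)
  from frechet_derivative_eqI[OF this]
  show "snd z (\<lambda>w. k (proj G w) * ((\<phi> (proj G w) - \<phi> ?p) \<bullet> a)) = fst v \<bullet> a"
    by (simp only: z tvec_at_def snd_conv pull[OF f] if_True)
  have "((\<lambda>x. ?\<kappa> (fst x) * (snd x \<bullet> b)) has_derivative (\<lambda>x. snd x \<bullet> b + ?D\<kappa> (fst x) * (\<psi> u \<bullet> b))) (at (?\<chi> u))"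
    by (rule derivative_eq_intros d\<kappa> refl | simp add: k1[simplified])+
  then have "(((\<lambda>w. k (proj G w) * (\<psi> w \<bullet> b)) \<circ> inv_into ?D ?\<chi>) has_derivative
      (\<lambda>x. snd x \<bullet> b + ?D\<kappa> (fst x) * (\<psi> u \<bullet> b))) (at (?\<chi> u))"
    by (rule has_derivative_transform_within_open[OF _ op x]) (simp only: o_apply inv)
  note eq = frechet_derivative_eqI[OF this]
  have "(\<lambda>w. k (proj G w) * (\<psi> w \<bullet> b)) \<in> Cinf_E G"
    by (rule lin_smooth) (rule coord_form_lin[OF c(1) t(1) k(1,2,3,5)])
  then show "snd z (\<lambda>w. k (proj G w) * (\<psi> w \<bullet> b)) = snd v \<bullet> b + ?D\<kappa> (fst v) * (\<psi> u \<bullet> b)"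
    using eq by (simp only: z tvec_at_def snd_conv if_True)
qed

section \<open>Tangent vectors of the total space and vertical vectors\<close>

lemma tangent_sep:
  assumes z: "z \<in> tangent_space (total_atlas G) u" and z': "z' \<in> tangent_space (total_atlas G) u"
    and b: "\<And>f. f \<in> Cinf_M G \<Longrightarrow> snd z (\<lambda>w. f (proj G w)) = snd z' (\<lambda>w. f (proj G w))"
    and l: "\<And>g. g \<in> lin_funs G \<Longrightarrow> snd z g = snd z' g"
  shows "z = z'"
proof -
  obtain U \<phi> W \<psi> k K where c: "(U, \<phi>) \<in> base_atlas G" "proj G u \<in> U" and t: "(W, \<psi>) \<in> trivs G" "proj G u \<in> W"
    and k: "k \<in> Cinf_M G" "closed K" "K \<subseteq> U \<inter> W" "k (proj G u) = 1" "\<And>q. q \<notin> K \<Longrightarrow> k q = 0"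
    by (rule local_data[of "proj G u"]) blast
  note tc = total_chart[OF c(1) t(1)]
  have u: "u \<in> proj G -` (U \<inter> W)" using c t by simp
  obtain v v' where v: "z = tvec_at (total_atlas G) (proj G -` (U \<inter> W)) (\<lambda>u. (\<phi> (proj G u), \<psi> u)) u v"
    "z' = tvec_at (total_atlas G) (proj G -` (U \<inter> W)) (\<lambda>u. (\<phi> (proj G u), \<psi> u)) u v'"
    using E.tangent_space_chart[OF z tc u] E.tangent_space_chart[OF z' tc u] by blast
  note tv = tangent_coords[OF c t k v(1)] and tv' = tangent_coords[OF c t k v(2)]
  have "fst v \<bullet> a = fst v' \<bullet> a" for a using b[OF tv(1)] tv(2) tv'(2) by simp
  then have 1: "fst v = fst v'" by (rule vector_eq_rdot[THEN iffD1, OF allI])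
  \<comment> \<open>The derivative of a cut-off form also contains the derivative of
    \<open>k\<close> along \<open>fst v\<close>; it cancels because the base components are already
    known to agree.\<close>
  have "snd v \<bullet> b = snd v' \<bullet> b" for b
    using l[OF coord_form_lin[OF c(1) t(1) k(1,2,3,5)]] tv(3) tv'(3) 1 by simp
  then have "snd v = snd v'" by (rule vector_eq_rdot[THEN iffD1, OF allI])
  then have "v = v'" using 1 by (rule prod_eqI[rotated])
  then show ?thesis unfolding v by simp
qed

text \<open>In a chart built from a trivialization the curve \<open>u + t w\<close> is a straight
  line with velocity \<open>(0, \<psi> w)\<close>.\<close>

lemma i_map_tvec:
  assumes c: "(U, \<phi>) \<in> base_atlas G" and t: "(W, \<psi>) \<in> trivs G" and u: "proj G u \<in> U \<inter> W"
    and w: "proj G w = proj G u"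
  shows "snd (i_map G (u, w)) =
    tvec_at (total_atlas G) (proj G -` (U \<inter> W)) (\<lambda>u. (\<phi> (proj G u), \<psi> u)) u (0, \<psi> w)"
proof -
  let ?D = "proj G -` (U \<inter> W)" and ?\<chi> = "\<lambda>u. (\<phi> (proj G u), \<psi> u)"
  note tc = total_chart[OF c t]
  have "deriv (\<lambda>s. f (fadd G u (fscale G s w))) 0 =
      frechet_derivative (f \<circ> inv_into ?D ?\<chi>) (at (?\<chi> u)) (0, \<psi> w)" if f: "f \<in> Cinf_E G" for f
  proof -
    let ?F = "frechet_derivative (f \<circ> inv_into ?D ?\<chi>) (at (?\<chi> u))"
    have F: "((f \<circ> inv_into ?D ?\<chi>) has_derivative ?F) (at (?\<chi> u + 0 *\<^sub>R (0, \<psi> w)))"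
      using E.smooth_funs_chart_derivative[OF tc _ f, of u] u by (simp add: zero_prod_def[symmetric])
    have "((\<lambda>s. ?\<chi> u + s *\<^sub>R (0, \<psi> w)) has_derivative (\<lambda>s. s *\<^sub>R (0, \<psi> w))) (at 0)"
      by (auto intro!: derivative_eq_intros)
    from has_derivative_compose[OF this F]
    have "((\<lambda>s. (f \<circ> inv_into ?D ?\<chi>) (?\<chi> u + s *\<^sub>R (0, \<psi> w))) has_derivative (\<lambda>s. ?F (s *\<^sub>R (0, \<psi> w)))) (at 0)" .
    moreover have "(f \<circ> inv_into ?D ?\<chi>) (?\<chi> u + s *\<^sub>R (0, \<psi> w)) = f (fadd G u (fscale G s w))" for s
    proof -
      have "?\<chi> u + s *\<^sub>R (0, \<psi> w) = ?\<chi> (fadd G u (fscale G s w))"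
        using triv(3,4)[OF t] u w by simp
      moreover have "inv_into ?D ?\<chi> (?\<chi> (fadd G u (fscale G s w))) = fadd G u (fscale G s w)"
        by (rule E.chart_inv[OF tc]) (use u w in simp)
      ultimately show ?thesis by simp
    qed
    moreover have "?F (s *\<^sub>R (0, \<psi> w)) = ?F (0, \<psi> w) * s" for s
      using has_derivative_linear[OF F] by (simp add: linear_scale del: scaleR_Pair)
    ultimately have "((\<lambda>s. f (fadd G u (fscale G s w))) has_derivative (*) (?F (0, \<psi> w))) (at 0)" by simp
    then have "((\<lambda>s. f (fadd G u (fscale G s w))) has_real_derivative ?F (0, \<psi> w)) (at 0)"
      by (simp add: has_field_derivative_def)
    then show ?thesis by (rule DERIV_imp_deriv)
  qed
  then show ?thesis unfolding tvec_at_def i_map_def by auto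
qed

lemma i_map_tangent:
  assumes w: "proj G w = proj G u"
  shows "snd (i_map G (u, w)) \<in> tangent_space (total_atlas G) u"
proof -
  obtain U \<phi> where c: "(U, \<phi>) \<in> base_atlas G" "proj G u \<in> U" by (rule M.chart_ex)
  obtain W \<psi> where t: "(W, \<psi>) \<in> trivs G" "proj G u \<in> W" by (rule triv_ex)
  show ?thesis using i_map_tvec[OF c(1) t(1) _ w] E.tvec_at_in[OF total_chart[OF c(1) t(1)]] c(2) t(2) by simp
qed

lemma i_map_pull:
  "f \<in> Cinf_M G \<Longrightarrow> proj G w = proj G u \<Longrightarrow> snd (snd (i_map G (u, w))) (\<lambda>v. f (proj G v)) = 0"
  by (simp add: i_map_def)

text \<open>Along \<open>u + t w\<close> a linear function is the affine function
  \<open>g u + t g w\<close>.\<close>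

lemma i_map_lin:
  assumes g: "g \<in> lin_funs G" and w: "proj G w = proj G u"
  shows "snd (snd (i_map G (u, w))) g = g w"
proof -
  have "((\<lambda>t. g u + t * g w) has_real_derivative g w) (at 0)" by (auto intro!: derivative_eq_intros)
  then show ?thesis using lin_smooth[OF g] w by (simp add: i_map_def lin_fadd[OF g] lin_fscale[OF g] DERIV_imp_deriv)
qed

lemma i_map_fst [simp]: "fst (i_map G (u, w)) = fscale G 0 u"
  by (simp add: i_map_def)

lemma i_map_base [simp]: "fst (snd (i_map G (u, w))) = u"
  by (simp add: i_map_def)

text \<open>Annihilating all \<open>f \<circ> \<pi>\<close> forces the base component in a chart to
  vanish; the fibre component is the coordinate of some vector of the fibre. This is the pointwise
  content of exactness in the middle.\<close>

lemma i_map_surj_vertical: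
  assumes z: "z \<in> tangent_space (total_atlas G) u"
    and b: "\<And>f. f \<in> Cinf_M G \<Longrightarrow> snd z (\<lambda>w. f (proj G w)) = 0"
  shows "\<exists>w. proj G w = proj G u \<and> z = snd (i_map G (u, w))"
proof -
  obtain U \<phi> W \<psi> k K where c: "(U, \<phi>) \<in> base_atlas G" "proj G u \<in> U" and t: "(W, \<psi>) \<in> trivs G" "proj G u \<in> W"
    and k: "k \<in> Cinf_M G" "closed K" "K \<subseteq> U \<inter> W" "k (proj G u) = 1" "\<And>q. q \<notin> K \<Longrightarrow> k q = 0"
    by (rule local_data[of "proj G u"]) blast
  note tc = total_chart[OF c(1) t(1)]
  have u: "u \<in> proj G -` (U \<inter> W)" using c t by simp
  obtain v where v: "z = tvec_at (total_atlas G) (proj G -` (U \<inter> W)) (\<lambda>u. (\<phi> (proj G u), \<psi> u)) u v"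
    using E.tangent_space_chart[OF z tc u] by blast
  note tv = tangent_coords[OF c t k v(1)]
  have "fst v \<bullet> a = 0" for a using b[OF tv(1)] tv(2) by simp
  then have 1: "fst v = 0" by (rule inner_eq_zero_iff[THEN iffD1])
  let ?w = "fib \<psi> (proj G u) (snd v)"
  have w: "proj G ?w = proj G u" "\<psi> ?w = snd v" by (rule fib[OF t])+
  have "v = (0, \<psi> ?w)" using 1 w(2) by (simp add: prod_eq_iff)
  then have "z = snd (i_map G (u, ?w))" using i_map_tvec[OF c(1) t(1) _ w(1)] c t v by simp
  then show ?thesis using w(1) by blast
qed

text \<open>In a chart the components are 0 and the fibre coordinate of \<open>snd (x u)\<close>, so
  smoothness reduces to a derivative in a smoothly varying direction.\<close>

lemma i_map_vector_field:
  assumes x: "x \<in> sec_pb G" shows "(\<lambda>u. snd (i_map G (x u))) \<in> vector_fields (total_atlas G)"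
proof -
  have xu: "x u = (u, snd (x u))" for u using sec_pb_fst[OF x] by (metis prod.collapse)
  have tan: "snd (i_map G (x u)) \<in> tangent_space (total_atlas G) u" for u
    using i_map_tangent[OF sec_pb_proj[OF x]] xu by metis
  have "(\<lambda>u. snd (snd (i_map G (x u))) f) \<in> Cinf_E G" if f: "f \<in> Cinf_E G" for f
    unfolding smooth_funs_iff
  proof (rule E.smooth_loc_local)
    fix u
    obtain U \<phi> where c: "(U, \<phi>) \<in> base_atlas G" "proj G u \<in> U" by (rule M.chart_ex)
    obtain W \<psi> where t: "(W, \<psi>) \<in> trivs G" "proj G u \<in> W" by (rule triv_ex)
    let ?D = "proj G -` (U \<inter> W)" and ?\<chi> = "\<lambda>u. (\<phi> (proj G u), \<psi> u)"
    note tc = total_chart[OF c(1) t(1)] and op = E.chart(1)[OF total_chart[OF c(1) t(1)]]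
    have "smooth_map (total_atlas G) (total_atlas G) (snd \<circ> x)" by (rule sec_pb_smooth_map[OF x])
    from smooth_map_pullback[OF E.smooth_manifold_axioms E.smooth_manifold_axioms this triv_smooth(2)[OF c(1) t(1)] op]
    have "smooth_loc (total_atlas G) ?D (\<lambda>v. \<psi> (snd (x v)))"
      using sec_pb_proj[OF x] by (simp add: o_def vimage_def)
    from E.smooth_loc_bounded_linear[OF op _ this, of "\<lambda>v. (0::'a, v)"]
    have "smooth_loc (total_atlas G) ?D (\<lambda>v. (0::'a, \<psi> (snd (x v))))"
      by (simp add: bounded_linear_Pair bounded_linear_ident bounded_linear_zero)
    from E.smooth_loc_frechet[OF tc f this]
    have "smooth_loc (total_atlas G) ?D (\<lambda>v. snd (snd (i_map G (x v))) f)"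
    proof (rule E.smooth_loc_cong[OF op])
      fix v assume "v \<in> ?D"
      then have "snd (i_map G (v, snd (x v))) = tvec_at (total_atlas G) ?D ?\<chi> v (0, \<psi> (snd (x v)))"
        by (intro i_map_tvec c t sec_pb_proj x) simp
      then show "frechet_derivative (f \<circ> inv_into ?D ?\<chi>) (at (?\<chi> v)) (0, \<psi> (snd (x v))) =
          snd (snd (i_map G (x v))) f"
        by (subst xu) (simp add: tvec_at_def f)
    qed
    then show "\<exists>W'. open W' \<and> u \<in> W' \<and> smooth_loc (total_atlas G) W' (\<lambda>u. snd (snd (i_map G (x u))) f)"
      using op c t by blast
  qed
  then show ?thesis using tan unfolding vector_fields_def by auto
qed

section \<open>Pointwise linear functionals and frame expansions\<close>

lemma frame_lin: "frame p h fr \<Longrightarrow> (\<theta>, e) \<in> set fr \<Longrightarrow> \<theta> \<in> lin_funs G"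
  unfolding frame_def by blast

lemma frame_sec: "frame p h fr \<Longrightarrow> (\<theta>, e) \<in> set fr \<Longrightarrow> e \<in> sec_E G"
  unfolding frame_def by blast

lemma frame_expand:
  "frame p h fr \<Longrightarrow> g \<in> lin_funs G \<Longrightarrow> h (proj G u) * g u = (\<Sum>(\<theta>, e)\<leftarrow>fr. \<theta> u * g (e (proj G u)))"
  unfolding frame_def by blast

lemma frame_fun: "frame p h fr \<Longrightarrow> h \<in> Cinf_M G"
  unfolding frame_def by blast

lemma frame_one: "frame p h fr \<Longrightarrow> h p = 1"
  unfolding frame_def by blast

text \<open>One slot of a tensor, evaluated at one point. Working with real-valued functionals at a
  point avoids treating modules of maps between sections; the two companions below serve sections of
  the pullback bundle and linear functions.\<close>

definition linear_at_E :: "'m \<Rightarrow> (('m \<Rightarrow> 'e) \<Rightarrow> real) \<Rightarrow> bool" where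
  "linear_at_E p \<Phi> \<longleftrightarrow>
     (\<forall>X\<in>sec_E G. \<forall>Y\<in>sec_E G. \<Phi> (\<lambda>q. fadd G (X q) (Y q)) = \<Phi> X + \<Phi> Y) \<and>
     (\<forall>f\<in>Cinf_M G. \<forall>X\<in>sec_E G. \<Phi> (\<lambda>q. fscale G (f q) (X q)) = f p * \<Phi> X)"

definition linear_at_pb :: "'e \<Rightarrow> (('e \<Rightarrow> 'e \<times> 'e) \<Rightarrow> real) \<Rightarrow> bool" where
  "linear_at_pb u \<Phi> \<longleftrightarrow>
     (\<forall>x\<in>sec_pb G. \<forall>y\<in>sec_pb G. \<Phi> (pb_add G x y) = \<Phi> x + \<Phi> y) \<and>
     (\<forall>f\<in>Cinf_E G. \<forall>x\<in>sec_pb G. \<Phi> (pb_smul G f x) = f u * \<Phi> x)"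

definition linear_at_lin :: "'e \<Rightarrow> (('e \<Rightarrow> real) \<Rightarrow> real) \<Rightarrow> bool" where
  "linear_at_lin u c \<longleftrightarrow>
     (\<forall>g\<in>lin_funs G. \<forall>g'\<in>lin_funs G. c (\<lambda>v. g v + g' v) = c g + c g') \<and>
     (\<forall>f\<in>Cinf_M G. \<forall>g\<in>lin_funs G. c (\<lambda>v. f (proj G v) * g v) = f (proj G u) * c g)"

lemma linear_at_E_add: "linear_at_E p \<Phi> \<Longrightarrow> X \<in> sec_E G \<Longrightarrow> Y \<in> sec_E G \<Longrightarrow>
    \<Phi> (\<lambda>q. fadd G (X q) (Y q)) = \<Phi> X + \<Phi> Y"
  unfolding linear_at_E_def by simp

lemma linear_at_E_smul: "linear_at_E p \<Phi> \<Longrightarrow> f \<in> Cinf_M G \<Longrightarrow> X \<in> sec_E G \<Longrightarrow>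
    \<Phi> (\<lambda>q. fscale G (f q) (X q)) = f p * \<Phi> X"
  unfolding linear_at_E_def by simp

lemma linear_at_pb_add: "linear_at_pb u \<Phi> \<Longrightarrow> x \<in> sec_pb G \<Longrightarrow> y \<in> sec_pb G \<Longrightarrow>
    \<Phi> (pb_add G x y) = \<Phi> x + \<Phi> y"
  unfolding linear_at_pb_def by simp

lemma linear_at_pb_smul: "linear_at_pb u \<Phi> \<Longrightarrow> f \<in> Cinf_E G \<Longrightarrow> x \<in> sec_pb G \<Longrightarrow>
    \<Phi> (pb_smul G f x) = f u * \<Phi> x"
  unfolding linear_at_pb_def by simp

lemma linear_at_lin_add: "linear_at_lin u c \<Longrightarrow> g \<in> lin_funs G \<Longrightarrow> g' \<in> lin_funs G \<Longrightarrow>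
    c (\<lambda>v. g v + g' v) = c g + c g'"
  unfolding linear_at_lin_def by simp

lemma linear_at_lin_mult: "linear_at_lin u c \<Longrightarrow> f \<in> Cinf_M G \<Longrightarrow> g \<in> lin_funs G \<Longrightarrow>
    c (\<lambda>v. f (proj G v) * g v) = f (proj G u) * c g"
  unfolding linear_at_lin_def by simp

text \<open>\<open>fadd\<close> makes sense only within a fibre, so a finite linear combination of
  sections is constructed by induction. The same \<open>X\<close> serves all functionals and all
  points.\<close>

lemma linear_at_E_comb:
  assumes "set L \<subseteq> Cinf_M G \<times> sec_E G"
  shows "\<exists>X\<in>sec_E G. (\<forall>g\<in>lin_funs G. \<forall>p. g (X p) = (\<Sum>(a, e)\<leftarrow>L. a p * g (e p))) \<and>
    (\<forall>p \<Phi>. linear_at_E p \<Phi> \<longrightarrow> \<Phi> X = (\<Sum>(a, e)\<leftarrow>L. a p * \<Phi> e))"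
  using assms
proof (induction L)
  case Nil
  have "\<Phi> zero_sec = 0" if "linear_at_E p \<Phi>" for p \<Phi>
  proof -
    have "zero_sec = (\<lambda>q. fscale G 0 (zero_sec q))" by (simp add: fscale_zero)
    moreover have "\<Phi> (\<lambda>q. fscale G 0 (zero_sec q)) = 0 * \<Phi> zero_sec"
      by (rule linear_at_E_smul[OF that M.smooth_funs_const zero_sec_in])
    ultimately show ?thesis by simp
  qed
  then show ?case by (intro bexI[of _ zero_sec]) (simp_all add: zero_sec_in)
next
  case (Cons ae L)
  obtain a e where ae: "ae = (a, e)" "a \<in> Cinf_M G" "e \<in> sec_E G" using Cons.prems by auto
  obtain X where X: "X \<in> sec_E G"
    and X1: "\<forall>g\<in>lin_funs G. \<forall>p. g (X p) = (\<Sum>(a, e)\<leftarrow>L. a p * g (e p))"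
    and X2: "\<forall>p \<Phi>. linear_at_E p \<Phi> \<longrightarrow> \<Phi> X = (\<Sum>(a, e)\<leftarrow>L. a p * \<Phi> e)"
    using Cons by auto
  let ?Y = "\<lambda>q. fscale G (a q) (e q)"
  have Y: "?Y \<in> sec_E G" by (rule sec_E_smul[OF ae(2,3)])
  have "\<Phi> (\<lambda>q. fadd G (?Y q) (X q)) = a p * \<Phi> e + (\<Sum>(a, e)\<leftarrow>L. a p * \<Phi> e)"
    if l: "linear_at_E p \<Phi>" for p \<Phi>
  proof -
    have "\<Phi> (\<lambda>q. fadd G (?Y q) (X q)) = \<Phi> ?Y + \<Phi> X" by (rule linear_at_E_add[OF l Y X])
    moreover have "\<Phi> ?Y = a p * \<Phi> e" by (rule linear_at_E_smul[OF l ae(2,3)])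
    ultimately show ?thesis using X2 l by simp
  qed
  then show ?case
    using sec_E_add[OF Y X] X1 X ae
    by (intro bexI[of _ "\<lambda>q. fadd G (?Y q) (X q)"]) (simp_all add: lin_fadd lin_fscale)
qed

text \<open>\<open>h X\<close> is the combination of the \<open>e\<close> with coefficients
  \<open>\<theta>(X)\<close>. The point \<open>q\<close> may differ from the centre \<open>p\<close>
  of the frame, which is what smoothness arguments require.\<close>

lemma linear_at_E_expand:
  assumes fr: "frame p h fr" and l: "linear_at_E q \<Phi>" and X: "X \<in> sec_E G"
  shows "h q * \<Phi> X = (\<Sum>(\<theta>, e)\<leftarrow>fr. \<theta> (X q) * \<Phi> e)"
proof -
  let ?L = "map (\<lambda>(\<theta>, e). (\<lambda>q. \<theta> (X q), e)) fr"
  have "set ?L \<subseteq> Cinf_M G \<times> sec_E G"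
    using frame_lin[OF fr] frame_sec[OF fr] sec_E_smooth[OF X] lin_smooth by fastforce
  then obtain Y where Y: "Y \<in> sec_E G"
    and Y1: "\<forall>g\<in>lin_funs G. \<forall>p. g (Y p) = (\<Sum>(a, e)\<leftarrow>?L. a p * g (e p))"
    and Y2: "\<forall>p \<Phi>. linear_at_E p \<Phi> \<longrightarrow> \<Phi> Y = (\<Sum>(a, e)\<leftarrow>?L. a p * \<Phi> e)"
    using linear_at_E_comb by blast
  have "Y = (\<lambda>q. fscale G (h q) (X q))"
  proof (rule sec_E_eqI[OF Y sec_E_smul[OF frame_fun[OF fr] X]])
    fix g p assume g: "g \<in> lin_funs G"
    show "g (Y p) = g (fscale G (h p) (X p))"
      using frame_expand[OF fr g, of "X p"] Y1 g X by (simp add: lin_fscale o_def split_def)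
  qed
  moreover have "\<Phi> (\<lambda>q. fscale G (h q) (X q)) = h q * \<Phi> X"
    by (rule linear_at_E_smul[OF l frame_fun[OF fr] X])
  ultimately show ?thesis using Y2 l by (simp add: o_def split_def)
qed

lemma linear_at_pb_comb:
  assumes "set L \<subseteq> Cinf_E G \<times> sec_pb G"
  shows "\<exists>x\<in>sec_pb G. (\<forall>g\<in>lin_funs G. \<forall>u. g (snd (x u)) = (\<Sum>(a, e)\<leftarrow>L. a u * g (snd (e u)))) \<and>
    (\<forall>u \<Phi>. linear_at_pb u \<Phi> \<longrightarrow> \<Phi> x = (\<Sum>(a, e)\<leftarrow>L. a u * \<Phi> e))"
  using assms
proof (induction L)
  case Nil
  have "\<Phi> (pb_zero G) = 0" if "linear_at_pb p \<Phi>" for p \<Phi>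
  proof -
    have "pb_zero G = pb_smul G (\<lambda>_. 0) (pb_zero G)"
      by (rule sec_pb_eqI) (simp_all add: pb_zero_in pb_smul_in E.smooth_funs_const lin_pb_zero lin_pb_smul)
    moreover have "\<Phi> (pb_smul G (\<lambda>_. 0) (pb_zero G)) = 0 * \<Phi> (pb_zero G)"
      by (rule linear_at_pb_smul[OF that E.smooth_funs_const pb_zero_in])
    ultimately show ?thesis by simp
  qed
  then show ?case by (intro bexI[of _ "pb_zero G"]) (simp_all add: pb_zero_in lin_pb_zero)
next
  case (Cons ae L)
  obtain a e where ae: "ae = (a, e)" "a \<in> Cinf_E G" "e \<in> sec_pb G" using Cons.prems by auto
  obtain x where x: "x \<in> sec_pb G"
    and x1: "\<forall>g\<in>lin_funs G. \<forall>u. g (snd (x u)) = (\<Sum>(a, e)\<leftarrow>L. a u * g (snd (e u)))"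
    and x2: "\<forall>u \<Phi>. linear_at_pb u \<Phi> \<longrightarrow> \<Phi> x = (\<Sum>(a, e)\<leftarrow>L. a u * \<Phi> e)"
    using Cons by auto
  let ?y = "pb_smul G a e"
  have y: "?y \<in> sec_pb G" by (rule pb_smul_in[OF ae(2,3)])
  have "\<Phi> (pb_add G ?y x) = a u * \<Phi> e + (\<Sum>(a, e)\<leftarrow>L. a u * \<Phi> e)"
    if l: "linear_at_pb u \<Phi>" for u \<Phi>
  proof -
    have "\<Phi> (pb_add G ?y x) = \<Phi> ?y + \<Phi> x" by (rule linear_at_pb_add[OF l y x])
    moreover have "\<Phi> ?y = a u * \<Phi> e" by (rule linear_at_pb_smul[OF l ae(2,3)])
    ultimately show ?thesis using x2 l by simp
  qed
  then show ?case
    using pb_add_in[OF y x] x1 x y ae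
    by (intro bexI[of _ "pb_add G ?y x"]) (simp_all add: lin_pb_add lin_pb_smul)
qed

text \<open>\<open>h x\<close> is a combination of basic sections \<open>hat G e\<close> with the
  functions \<open>\<theta>(x)\<close> on \<open>E\<close> as coefficients, and \<open>h = 1\<close>
  at the projection of \<open>u\<close>.\<close>

lemma linear_at_pb_zero:
  assumes l: "linear_at_pb u \<Phi>" and hat: "\<And>X. X \<in> sec_E G \<Longrightarrow> \<Phi> (hat G X) = 0" and x: "x \<in> sec_pb G"
  shows "\<Phi> x = 0"
proof -
  obtain h fr where fr: "frame (proj G u) h fr" using frame_exists by blast
  let ?L = "map (\<lambda>(\<theta>, e). (\<lambda>u. \<theta> (snd (x u)), hat G e)) fr"
  have "set ?L \<subseteq> Cinf_E G \<times> sec_pb G"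
    using frame_lin[OF fr] frame_sec[OF fr] sec_pb_smooth[OF x] lin_smooth hat_in by fastforce
  then obtain y where y: "y \<in> sec_pb G"
    and y1: "\<forall>g\<in>lin_funs G. \<forall>u. g (snd (y u)) = (\<Sum>(a, e)\<leftarrow>?L. a u * g (snd (e u)))"
    and y2: "\<forall>u \<Phi>. linear_at_pb u \<Phi> \<longrightarrow> \<Phi> y = (\<Sum>(a, e)\<leftarrow>?L. a u * \<Phi> e)"
    using linear_at_pb_comb by blast
  have "y = pb_smul G (\<lambda>u. h (proj G u)) x"
  proof (rule sec_pb_eqI[OF y pb_smul_in[OF pull[OF frame_fun[OF fr]] x]])
    fix g v assume g: "g \<in> lin_funs G"
    show "g (snd (y v)) = g (snd (pb_smul G (\<lambda>u. h (proj G u)) x v))"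
      using frame_expand[OF fr g, of "snd (x v)"] y1 g x
      by (simp add: lin_pb_smul o_def split_def hat_def)
  qed
  moreover have "\<Phi> (pb_smul G (\<lambda>u. h (proj G u)) x) = h (proj G u) * \<Phi> x"
    by (rule linear_at_pb_smul[OF l pull[OF frame_fun[OF fr]] x])
  ultimately have "\<Phi> x = \<Phi> y" using frame_one[OF fr] by simp
  also have "\<dots> = (\<Sum>(a, e)\<leftarrow>?L. a u * \<Phi> e)" using y2 l by blast
  also have "\<dots> = (\<Sum>\<theta>e\<leftarrow>fr. 0)"
    unfolding map_map o_def using hat frame_sec[OF fr]
    by (intro arg_cong[where f = sum_list] map_cong refl) auto
  finally show ?thesis by simp
qed

text \<open>The frame identity read dually: \<open>h g\<close> is the combination of the forms
  \<open>\<theta>\<close> with the base functions \<open>g(e)\<close> as coefficients.\<close>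

lemma linear_at_lin_expand:
  assumes fr: "frame (proj G u) h fr" and l: "linear_at_lin u c" and g: "g \<in> lin_funs G"
  shows "c g = (\<Sum>(\<theta>, e)\<leftarrow>fr. g (e (proj G u)) * c \<theta>)"
proof -
  have z: "c (\<lambda>v. 0) = 0"
  proof -
    have "c (\<lambda>v. (\<lambda>_. 0) (proj G v) * (\<lambda>v. 0) v) = (\<lambda>_. 0) (proj G u) * c (\<lambda>v. 0)"
      by (rule linear_at_lin_mult[OF l M.smooth_funs_const lin_funs_zero])
    then show ?thesis by simp
  qed
  have "(\<lambda>v. \<Sum>(\<theta>, e)\<leftarrow>L. \<theta> v * g (e (proj G v))) \<in> lin_funs G \<and>
      c (\<lambda>v. \<Sum>(\<theta>, e)\<leftarrow>L. \<theta> v * g (e (proj G v))) = (\<Sum>(\<theta>, e)\<leftarrow>L. g (e (proj G u)) * c \<theta>)"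
    if "set L \<subseteq> set fr" for L
    using that
  proof (induction L)
    case Nil
    then show ?case using z lin_funs_zero by simp
  next
    case (Cons te L)
    obtain \<theta> e where te: "te = (\<theta>, e)" by fastforce
    have t: "\<theta> \<in> lin_funs G" "e \<in> sec_E G" using frame_lin[OF fr] frame_sec[OF fr] Cons.prems te by auto
    have ge: "(\<lambda>p. g (e p)) \<in> Cinf_M G" by (rule sec_E_smooth[OF t(2) lin_smooth[OF g]])
    let ?s = "\<lambda>v. g (e (proj G v)) * \<theta> v" and ?r = "\<lambda>v. \<Sum>(\<theta>, e)\<leftarrow>L. \<theta> v * g (e (proj G v))"
    have s: "?s \<in> lin_funs G" using lin_funs_mult_base[OF ge t(1)] .
    have r: "?r \<in> lin_funs G" "c ?r = (\<Sum>(\<theta>, e)\<leftarrow>L. g (e (proj G u)) * c \<theta>)" using Cons by auto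
    have "c ?s = g (e (proj G u)) * c \<theta>" by (rule linear_at_lin_mult[OF l ge t(1)])
    moreover have "c (\<lambda>v. ?s v + ?r v) = c ?s + c ?r" by (rule linear_at_lin_add[OF l s r(1)])
    moreover have "(\<lambda>v. \<Sum>(\<theta>, e)\<leftarrow>te # L. \<theta> v * g (e (proj G v))) = (\<lambda>v. ?s v + ?r v)"
      by (simp add: te mult.commute)
    ultimately show ?case using lin_funs_add[OF s r(1)] r(2) by (simp add: te)
  qed
  from this[OF subset_refl]
  have "c (\<lambda>v. h (proj G v) * g v) = (\<Sum>(\<theta>, e)\<leftarrow>fr. g (e (proj G u)) * c \<theta>)"
    using frame_expand[OF fr g] by simp
  moreover have "c (\<lambda>v. h (proj G v) * g v) = h (proj G u) * c g"
    by (rule linear_at_lin_mult[OF l frame_fun[OF fr] g])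
  ultimately show ?thesis using frame_one[OF fr] by simp
qed

text \<open>The frame coefficients of \<open>v\<close> are taken as constants; at the centre of the
  frame the resulting global section has the value \<open>v\<close>.\<close>

lemma sec_through: "\<exists>X\<in>sec_E G. X (proj G v) = v"
proof -
  obtain h fr where fr: "frame (proj G v) h fr" using frame_exists by blast
  let ?L = "map (\<lambda>(\<theta>, e). (\<lambda>_. \<theta> v, e)) fr"
  have "set ?L \<subseteq> Cinf_M G \<times> sec_E G"
    using frame_sec[OF fr] M.smooth_funs_const by fastforce
  then obtain X where X: "X \<in> sec_E G"
    and X1: "\<forall>g\<in>lin_funs G. \<forall>p. g (X p) = (\<Sum>(a, e)\<leftarrow>?L. a p * g (e p))"
    using linear_at_E_comb by blast
  have "g (X (proj G v)) = g v" if "g \<in> lin_funs G" for g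
    using X1 that frame_expand[OF fr that, of v] frame_one[OF fr] by (simp add: o_def split_def)
  then have "X (proj G v) = v" using X by (intro lin_sep) simp_all
  then show ?thesis using X by blast
qed

section \<open>Extension from basic sections to sections of the pullback bundle\<close>

definition frm :: "'m \<Rightarrow> (('e \<Rightarrow> real) \<times> ('m \<Rightarrow> 'e)) list" where
  "frm p = (SOME fr. \<exists>h. frame p h fr)"

lemma frm: "\<exists>h. frame p h (frm p)"
  unfolding frm_def using someI_ex[of "\<lambda>fr. \<exists>h. frame p h fr"] frame_exists by blast

text \<open>Extends a map that is linear over functions of the base. The frame is chosen at each
  point without any regularity; this is harmless because the value turns out to be independent of
  it.\<close>

definition ext_pb :: "(('m \<Rightarrow> 'e) \<Rightarrow> 'e \<Rightarrow> real) \<Rightarrow> ('e \<Rightarrow> 'e \<times> 'e) \<Rightarrow> 'e \<Rightarrow> real" where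
  "ext_pb T x u = (\<Sum>(\<theta>, e)\<leftarrow>frm (proj G u). \<theta> (snd (x u)) * T e u)"

definition pull_linear :: "(('m \<Rightarrow> 'e) \<Rightarrow> 'e \<Rightarrow> real) \<Rightarrow> bool" where
  "pull_linear T \<longleftrightarrow> (\<forall>X\<in>sec_E G. T X \<in> Cinf_E G) \<and> (\<forall>u. linear_at_E (proj G u) (\<lambda>X. T X u))"

text \<open>Independence of the frame: the value is that of \<open>T\<close> on any section which
  agrees with \<open>x\<close> at the point.\<close>

lemma ext_pb_eq:
  assumes T: "pull_linear T" and X: "X \<in> sec_E G" "X (proj G u) = snd (x u)"
  shows "ext_pb T x u = T X u"
proof -
  obtain h where h: "frame (proj G u) h (frm (proj G u))" using frm by blast
  have "linear_at_E (proj G u) (\<lambda>X. T X u)" using T unfolding pull_linear_def by blast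
  from linear_at_E_expand[OF h this X(1)] show ?thesis
    unfolding ext_pb_def using frame_one[OF h] X(2) by simp
qed

lemma ext_pb_hat: "pull_linear T \<Longrightarrow> X \<in> sec_E G \<Longrightarrow> ext_pb T (hat G X) u = T X u"
  by (rule ext_pb_eq) (simp_all add: hat_def)

text \<open>Multiplied by \<open>h\<close>, the values at all points can be computed in the single
  frame centred at the projection of \<open>u\<close>, and that expression is visibly
  smooth.\<close>

lemma ext_pb_smooth:
  assumes T: "pull_linear T" and x: "x \<in> sec_pb G"
  shows "ext_pb T x \<in> Cinf_E G"
proof (rule E.smooth_funs_locI)
  fix u
  obtain h fr where fr: "frame (proj G u) h fr" using frame_exists by blast
  have "h (proj G v) * ext_pb T x v = (\<Sum>(\<theta>, e)\<leftarrow>fr. \<theta> (snd (x v)) * T e v)" for v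
  proof -
    obtain X where X: "X \<in> sec_E G" "X (proj G v) = snd (x v)"
      using sec_through[of "snd (x v)"] x by auto
    have "linear_at_E (proj G v) (\<lambda>X. T X v)" using T unfolding pull_linear_def by blast
    moreover have "ext_pb T x v = T X v" by (rule ext_pb_eq[where X = X and u = v and x = x, OF T X])
    ultimately show ?thesis using linear_at_E_expand[OF fr _ X(1), of "proj G v" "\<lambda>X. T X v"] X(2) by simp
  qed
  moreover have "(\<lambda>v. \<Sum>(\<theta>, e)\<leftarrow>fr. \<theta> (snd (x v)) * T e v) \<in> Cinf_E G"
    unfolding case_prod_beta
  proof (rule E.smooth_funs_sum_list)
    fix te assume "te \<in> set fr"
    then have "fst te \<in> lin_funs G" "snd te \<in> sec_E G"
      using frame_lin[OF fr, of "fst te" "snd te"] frame_sec[OF fr, of "fst te" "snd te"] by auto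
    then show "(\<lambda>v. fst te (snd (x v)) * T (snd te) v) \<in> Cinf_E G"
      using T sec_pb_smooth[OF x lin_smooth] unfolding pull_linear_def
      by (intro E.smooth_funs_mult) auto
  qed
  ultimately have "(\<lambda>v. h (proj G v) * ext_pb T x v) \<in> Cinf_E G" by simp
  then show "\<exists>h\<in>Cinf_E G. h u \<noteq> 0 \<and> (\<lambda>v. h v * ext_pb T x v) \<in> Cinf_E G"
    using pull[OF frame_fun[OF fr]] frame_one[OF fr]
    by (intro bexI[of _ "\<lambda>v. h (proj G v)"]) auto
qed

lemma frm_lin: "(\<theta>, e) \<in> set (frm p) \<Longrightarrow> \<theta> \<in> lin_funs G"
  using frm frame_lin by blast

lemma frm_sec: "(\<theta>, e) \<in> set (frm p) \<Longrightarrow> e \<in> sec_E G"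
  using frm frame_sec by blast

lemma sum_list_prod_add:
  "(\<And>a b. (a, b) \<in> set L \<Longrightarrow> f a b = g a b + h a b) \<Longrightarrow>
    (\<Sum>(a, b)\<leftarrow>L. f a b) = (\<Sum>(a, b)\<leftarrow>L. g a b) + (\<Sum>(a, b)\<leftarrow>L. h a b :: real)"
  by (induction L) auto

lemma sum_list_prod_mult:
  "(\<And>a b. (a, b) \<in> set L \<Longrightarrow> f a b = c * g a b) \<Longrightarrow>
    (\<Sum>(a, b)\<leftarrow>L. f a b) = c * (\<Sum>(a, b)\<leftarrow>L. g a b :: real)"
  by (induction L) (auto simp: distrib_left)

lemma ext_pb_linear: "linear_at_pb u (\<lambda>x. ext_pb T x u)"
  unfolding linear_at_pb_def ext_pb_def
  by (intro conjI ballI sum_list_prod_add sum_list_prod_mult)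
    (simp_all add: lin_pb_add[OF frm_lin] lin_pb_smul[OF frm_lin] distrib_right)

text \<open>Linearity in the map that is extended. It preserves the linearity in further slots when
  several slots are extended one after another.\<close>

lemma ext_pb_add:
  "(\<And>X. X \<in> sec_E G \<Longrightarrow> T X u = T' X u + T'' X u) \<Longrightarrow> ext_pb T x u = ext_pb T' x u + ext_pb T'' x u"
  unfolding ext_pb_def by (rule sum_list_prod_add) (simp add: frm_sec distrib_left)

lemma ext_pb_mult:
  "(\<And>X. X \<in> sec_E G \<Longrightarrow> T X u = c * T' X u) \<Longrightarrow> ext_pb T x u = c * ext_pb T' x u"
  unfolding ext_pb_def by (rule sum_list_prod_mult) (simp add: frm_sec)

lemma fibre_sum:
  assumes "set L \<subseteq> UNIV \<times> sec_E G"
  shows "\<exists>v. proj G v = q \<and> (\<forall>g\<in>lin_funs G. g v = (\<Sum>(r, e)\<leftarrow>L. r * g (e q)))"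
  using assms
proof (induction L)
  case Nil
  then show ?case by (intro exI[of _ "zero_sec q"]) simp
next
  case (Cons re L)
  obtain r e where re: "re = (r, e)" "e \<in> sec_E G" using Cons.prems by auto
  obtain v where v: "proj G v = q" "\<forall>g\<in>lin_funs G. g v = (\<Sum>(r, e)\<leftarrow>L. r * g (e q))" using Cons by auto
  then show ?case
    using re by (intro exI[of _ "fadd G (fscale G r (e q)) v"]) (simp_all add: lin_fadd lin_fscale)
qed

text \<open>The bidual of a fibre is the fibre: in a frame the vector with components
  \<open>c g u\<close> is the sum of the \<open>c \<theta> u\<close> times \<open>e\<close>.
  Smoothness follows because it is tested on linear functions.\<close>

lemma pb_reconstruct:
  assumes sm: "\<And>g. g \<in> lin_funs G \<Longrightarrow> c g \<in> Cinf_E G"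
    and lin: "\<And>u. linear_at_lin u (\<lambda>g. c g u)"
  shows "\<exists>x\<in>sec_pb G. \<forall>g\<in>lin_funs G. \<forall>u. g (snd (x u)) = c g u"
proof -
  have "\<exists>v. proj G v = proj G u \<and> (\<forall>g\<in>lin_funs G. g v = c g u)" for u
  proof -
    obtain h fr where fr: "frame (proj G u) h fr" using frame_exists by blast
    let ?L = "map (\<lambda>(\<theta>, e). (c \<theta> u, e)) fr"
    have "set ?L \<subseteq> UNIV \<times> sec_E G" using frame_sec[OF fr] by fastforce
    from fibre_sum[OF this] obtain v where v: "proj G v = proj G u"
      "\<forall>g\<in>lin_funs G. g v = (\<Sum>(r, e)\<leftarrow>?L. r * g (e (proj G u)))" by blast
    have "g v = c g u" if g: "g \<in> lin_funs G" for g
      using v(2) g linear_at_lin_expand[OF fr lin g] by (simp add: o_def split_def mult.commute)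
    then show ?thesis using v(1) by blast
  qed
  then obtain w where w: "\<And>u. proj G (w u) = proj G u" "\<And>u g. g \<in> lin_funs G \<Longrightarrow> g (w u) = c g u"
    by metis
  have "(\<lambda>u. (u, w u)) \<in> sec_pb G"
    by (rule sec_pbI) (simp_all add: w sm)
  then show ?thesis using w(2) by (intro bexI[of _ "\<lambda>u. (u, w u)"]) simp_all
qed

end

section \<open>Lie algebroids and sections of the prolongation\<close>

locale lie_algd =
  fixes G :: "('m::{t2_space,second_countable_topology}, 'e::{t2_space,second_countable_topology},
      'a::real_inner, 'b::real_inner) algebroid"
  assumes la: "lie_algebroid G"
begin

lemmas la_parts =
  conjunct1[OF la[unfolded lie_algebroid_def]]
  conjunct1[OF conjunct2[OF la[unfolded lie_algebroid_def]]]
  conjunct1[OF conjunct2[OF conjunct2[OF la[unfolded lie_algebroid_def]]]]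
  conjunct1[OF conjunct2[OF conjunct2[OF conjunct2[OF la[unfolded lie_algebroid_def]]]]]
  conjunct1[OF conjunct2[OF conjunct2[OF conjunct2[OF conjunct2[OF la[unfolded lie_algebroid_def]]]]]]
  conjunct2[OF conjunct2[OF conjunct2[OF conjunct2[OF conjunct2[OF la[unfolded lie_algebroid_def]]]]]]

sublocale vbundle
  by (rule vbundle.intro) (rule la_parts(1))

lemma anchor_tangent: "anchor G u \<in> tangent_space (base_atlas G) (proj G u)"
  using la_parts(2) by blast

lemma anchor_fst [simp]: "fst (anchor G u) = proj G u"
  by (rule tangent_space_fst[OF anchor_tangent])

lemma anchor_fadd: "proj G u = proj G v \<Longrightarrow>
    snd (anchor G (fadd G u v)) f = snd (anchor G u) f + snd (anchor G v) f"
  using la_parts(3) by blast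

lemma anchor_fscale: "snd (anchor G (fscale G c u)) f = c * snd (anchor G u) f"
  using la_parts(4) by blast

lemma anchor_smooth: "f \<in> Cinf_M G \<Longrightarrow> (\<lambda>u. snd (anchor G u) f) \<in> Cinf_E G"
  using la_parts(5) by blast

lemmas anchor_rules = M.tangent_space_rules[OF anchor_tangent]

lemma anchor_sec_smooth: "X \<in> sec_E G \<Longrightarrow> f \<in> Cinf_M G \<Longrightarrow> (\<lambda>p. snd (anchor G (X p)) f) \<in> Cinf_M G"
  by (rule sec_E_smooth[OF _ anchor_smooth])

lemma lbr:
  assumes "X \<in> sec_E G" "Y \<in> sec_E G"
  shows lbr_in: "lbr G X Y \<in> sec_E G"
    and lbr_add: "Z \<in> sec_E G \<Longrightarrow>
      lbr G X (\<lambda>p. fadd G (Y p) (Z p)) = (\<lambda>p. fadd G (lbr G X Y p) (lbr G X Z p))"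
    and lbr_const: "lbr G X (\<lambda>p. fscale G c (Y p)) = (\<lambda>p. fscale G c (lbr G X Y p))"
    and lbr_anti: "lbr G Y X = (\<lambda>p. fscale G (- 1) (lbr G X Y p))"
    and lbr_jacobi: "Z \<in> sec_E G \<Longrightarrow> lbr G X (lbr G Y Z) =
      (\<lambda>p. fadd G (lbr G (lbr G X Y) Z p) (lbr G Y (lbr G X Z) p))"
    and lbr_leibniz: "f \<in> Cinf_M G \<Longrightarrow> lbr G X (\<lambda>p. fscale G (f p) (Y p)) =
      (\<lambda>p. fadd G (fscale G (f p) (lbr G X Y p)) (fscale G (snd (anchor G (X p)) f) (Y p)))"
  using la_parts(6)[unfolded lie_algebroid_bracket_def] assms by blast+

lemma lbr_zero: "X \<in> sec_E G \<Longrightarrow> lbr G X zero_sec = zero_sec"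
  using lbr_const[of X zero_sec 0] zero_sec_in lbr_in[of X zero_sec] by (simp add: fscale_zero)

lemma lbr_zero': "X \<in> sec_E G \<Longrightarrow> lbr G zero_sec X = zero_sec"
  using lbr_anti[of X zero_sec] zero_sec_in lbr_zero[of X] lbr_in[of zero_sec X]
  by (intro sec_E_eqI) (simp_all add: lin_fscale zero_sec_in)

lemma sec_L_parts:
  assumes "\<sigma> \<in> sec_L G"
  shows sec_L_base [simp]: "fst (snd (\<sigma> v)) = v"
    and sec_L_tangent: "snd (\<sigma> v) \<in> tangent_space (total_atlas G) v"
    and sec_L_pushforward: "anchor G (fst (\<sigma> v)) = pushforward (base_atlas G) (proj G) (snd (\<sigma> v))"
    and sec_L_smooth_map: "smooth_map (total_atlas G) (total_atlas G) (\<lambda>v. fst (\<sigma> v))"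
    and sec_L_vector_field: "(\<lambda>v. snd (\<sigma> v)) \<in> vector_fields (total_atlas G)"
proof -
  have *: "\<forall>v. \<sigma> v \<in> prolongation G \<and> fst (snd (\<sigma> v)) = v"
    "smooth_map (total_atlas G) (total_atlas G) (fst \<circ> \<sigma>)" "snd \<circ> \<sigma> \<in> vector_fields (total_atlas G)"
    using assms unfolding sec_L_def by blast+
  show "fst (snd (\<sigma> v)) = v" using * by blast
  have "\<sigma> v \<in> prolongation G" using * by blast
  then show "anchor G (fst (\<sigma> v)) = pushforward (base_atlas G) (proj G) (snd (\<sigma> v))"
    unfolding prolongation_def by (auto simp: case_prod_beta)
  show "smooth_map (total_atlas G) (total_atlas G) (\<lambda>v. fst (\<sigma> v))" using *(2) by (simp only: o_def)
  show "(\<lambda>v. snd (\<sigma> v)) \<in> vector_fields (total_atlas G)" using *(3) by (simp only: o_def)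
  then show "snd (\<sigma> v) \<in> tangent_space (total_atlas G) v" unfolding vector_fields_def by blast
qed

lemma sec_L_proj [simp]: "\<sigma> \<in> sec_L G \<Longrightarrow> proj G (fst (\<sigma> v)) = proj G v"
  using arg_cong[OF sec_L_pushforward[of \<sigma> v], of fst] by (simp add: pushforward_def)

lemma L_act_pull:
  "\<sigma> \<in> sec_L G \<Longrightarrow> f \<in> Cinf_M G \<Longrightarrow> L_act \<sigma> (\<lambda>u. f (proj G u)) v = snd (anchor G (fst (\<sigma> v))) f"
  using arg_cong[OF sec_L_pushforward[of \<sigma> v], of "\<lambda>z. snd z f"] by (simp add: pushforward_def L_act_def o_def)

lemma L_act_smooth: "\<sigma> \<in> sec_L G \<Longrightarrow> f \<in> Cinf_E G \<Longrightarrow> L_act \<sigma> f \<in> Cinf_E G"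
  using sec_L_vector_field unfolding vector_fields_def L_act_def by blast

lemma sec_L_fst_smooth: "\<sigma> \<in> sec_L G \<Longrightarrow> f \<in> Cinf_E G \<Longrightarrow> (\<lambda>v. f (fst (\<sigma> v))) \<in> Cinf_E G"
  by (rule smooth_map_pullback_funs[OF E.smooth_manifold_axioms E.smooth_manifold_axioms sec_L_smooth_map])

lemma L_act_rules:
  assumes "\<sigma> \<in> sec_L G" "f \<in> Cinf_E G" "g \<in> Cinf_E G"
  shows L_act_const: "L_act \<sigma> (\<lambda>_. r) v = 0"
    and L_act_sum: "L_act \<sigma> (\<lambda>q. f q + g q) v = L_act \<sigma> f v + L_act \<sigma> g v"
    and L_act_mult: "L_act \<sigma> (\<lambda>q. f q * g q) v = f v * L_act \<sigma> g v + L_act \<sigma> f v * g v"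
  unfolding L_act_def by (rule E.tangent_space_rules[OF sec_L_tangent[OF assms(1)] assms(2,3)])+

lemma L_act_zero [simp]: "\<sigma> \<in> sec_L G \<Longrightarrow> L_act \<sigma> (\<lambda>_. r) = (\<lambda>_. 0)"
  by (rule ext) (rule L_act_const[OF _ E.smooth_funs_const E.smooth_funs_const])

lemma L_act_cmult: "\<sigma> \<in> sec_L G \<Longrightarrow> f \<in> Cinf_E G \<Longrightarrow> L_act \<sigma> (\<lambda>q. c * f q) v = c * L_act \<sigma> f v"
  using L_act_mult[of \<sigma> "\<lambda>_. c" f v] E.smooth_funs_const[of c] by simp

lemma L_act_diff:
  "\<sigma> \<in> sec_L G \<Longrightarrow> f \<in> Cinf_E G \<Longrightarrow> g \<in> Cinf_E G \<Longrightarrow> L_act \<sigma> (\<lambda>q. f q - g q) v = L_act \<sigma> f v - L_act \<sigma> g v"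
  using L_act_sum[of \<sigma> f "\<lambda>q. - 1 * g q" v] L_act_cmult[of \<sigma> g "-1" v] E.smooth_funs_cmult[of g "-1"]
  by simp

text \<open>Equality with the pushforward concerns functionals on all functions. Both sides vanish
  on nonsmooth ones by convention, so only smooth functions of the base are left to test.\<close>

lemma sec_LI:
  assumes "\<And>v. fst (snd (\<sigma> v)) = v" "\<And>v. proj G (fst (\<sigma> v)) = proj G v"
    and "\<And>g. g \<in> lin_funs G \<Longrightarrow> (\<lambda>v. g (fst (\<sigma> v))) \<in> Cinf_E G"
    and vf: "(\<lambda>v. snd (\<sigma> v)) \<in> vector_fields (total_atlas G)"
    and an: "\<And>v f. f \<in> Cinf_M G \<Longrightarrow> snd (snd (\<sigma> v)) (\<lambda>u. f (proj G u)) = snd (anchor G (fst (\<sigma> v))) f"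
  shows "\<sigma> \<in> sec_L G"
proof -
  have "anchor G (fst (\<sigma> v)) = pushforward (base_atlas G) (proj G) (snd (\<sigma> v))" for v
    using tangent_space_nonsmooth[OF anchor_tangent] an assms(1,2)
    by (intro prod_eqI ext) (auto simp: pushforward_def o_def)
  moreover have "snd (\<sigma> v) \<in> tangent_space (total_atlas G) v" for v
    using vf unfolding vector_fields_def by blast
  ultimately have "\<sigma> v \<in> prolongation G" for v
    unfolding prolongation_def by (auto simp: case_prod_beta)
  moreover have "smooth_map (total_atlas G) (total_atlas G) (\<lambda>v. fst (\<sigma> v))"
    by (rule smooth_into_total_fibre) (rule assms)+
  ultimately show ?thesis using vf assms(1) unfolding sec_L_def by (auto simp: o_def)
qed

text \<open>Functions \<open>f \<circ> \<pi>\<close> are absent from the test because the action on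
  them is determined by the anchor of the first component.\<close>

lemma sec_L_eqI:
  assumes "\<sigma> \<in> sec_L G" "\<tau> \<in> sec_L G"
    and "\<And>g v. g \<in> lin_funs G \<Longrightarrow> g (fst (\<sigma> v)) = g (fst (\<tau> v))"
    and "\<And>g v. g \<in> lin_funs G \<Longrightarrow> L_act \<sigma> g v = L_act \<tau> g v"
  shows "\<sigma> = \<tau>"
proof (rule ext, rule prod_eqI)
  fix v
  show f: "fst (\<sigma> v) = fst (\<tau> v)" by (rule lin_sep) (simp_all add: assms)
  show "snd (\<sigma> v) = snd (\<tau> v)"
  proof (rule tangent_sep[OF sec_L_tangent[OF assms(1)] sec_L_tangent[OF assms(2)]])
    show "snd (snd (\<sigma> v)) g = snd (snd (\<tau> v)) g" if "g \<in> lin_funs G" for g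
      using assms(4)[OF that] by (simp add: L_act_def)
    show "snd (snd (\<sigma> v)) (\<lambda>w. g (proj G w)) = snd (snd (\<tau> v)) (\<lambda>w. g (proj G w))" if "g \<in> Cinf_M G" for g
      using L_act_pull[OF assms(1) that, of v] L_act_pull[OF assms(2) that, of v] f by (simp add: L_act_def)
  qed
qed

lemma L_add_act: "L_act (L_add G \<sigma> \<tau>) f v = L_act \<sigma> f v + L_act \<tau> f v"
  by (simp add: L_act_def L_add_def)

lemma L_smul_act: "L_act (L_smul G h \<sigma>) f v = h v * L_act \<sigma> f v"
  by (simp add: L_act_def L_smul_def)

lemma L_zero_act: "L_act (L_zero G) f v = 0"
  by (simp add: L_act_def L_zero_def)

lemma L_add_fst: "g \<in> lin_funs G \<Longrightarrow> \<sigma> \<in> sec_L G \<Longrightarrow> \<tau> \<in> sec_L G \<Longrightarrow>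
    g (fst (L_add G \<sigma> \<tau> v)) = g (fst (\<sigma> v)) + g (fst (\<tau> v))"
  by (simp add: L_add_def lin_fadd)

lemma L_smul_fst: "g \<in> lin_funs G \<Longrightarrow> g (fst (L_smul G h \<sigma> v)) = h v * g (fst (\<sigma> v))"
  by (simp add: L_smul_def lin_fscale)

lemma L_zero_fst: "g \<in> lin_funs G \<Longrightarrow> g (fst (L_zero G v)) = 0"
  by (simp add: L_zero_def lin_fscale)

lemmas L_eval = L_add_act L_smul_act L_zero_act L_add_fst L_smul_fst L_zero_fst

lemma L_add_in:
  assumes s: "\<sigma> \<in> sec_L G" and t: "\<tau> \<in> sec_L G" shows "L_add G \<sigma> \<tau> \<in> sec_L G"
proof (rule sec_LI)
  show "(\<lambda>v. g (fst (L_add G \<sigma> \<tau> v))) \<in> Cinf_E G" if "g \<in> lin_funs G" for g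
    using that s t by (simp add: L_add_fst E.smooth_funs_add sec_L_fst_smooth lin_smooth)
  have "(\<lambda>v. (v, \<lambda>f. 1 * snd (snd (\<sigma> v)) f + 1 * snd (snd (\<tau> v)) f)) \<in> vector_fields (total_atlas G)"
    by (intro E.vector_fields_lincomb sec_L_vector_field s t E.smooth_funs_const)
  then show "(\<lambda>v. snd (L_add G \<sigma> \<tau> v)) \<in> vector_fields (total_atlas G)" by (simp add: L_add_def)
  show "snd (snd (L_add G \<sigma> \<tau> v)) (\<lambda>u. f (proj G u)) = snd (anchor G (fst (L_add G \<sigma> \<tau> v))) f"
    if "f \<in> Cinf_M G" for f v
    using L_act_pull[OF s that, of v] L_act_pull[OF t that, of v] s t
    by (simp add: L_add_def L_act_def anchor_fadd)
qed (use s t in \<open>simp_all add: L_add_def\<close>)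

lemma L_smul_in:
  assumes h: "h \<in> Cinf_E G" and s: "\<sigma> \<in> sec_L G" shows "L_smul G h \<sigma> \<in> sec_L G"
proof (rule sec_LI)
  show "(\<lambda>v. g (fst (L_smul G h \<sigma> v))) \<in> Cinf_E G" if "g \<in> lin_funs G" for g
    using that s h by (simp add: L_smul_fst E.smooth_funs_mult sec_L_fst_smooth lin_smooth)
  have "(\<lambda>v. (v, \<lambda>f. h v * snd (snd (\<sigma> v)) f + 0 * snd (snd (\<sigma> v)) f)) \<in> vector_fields (total_atlas G)"
    by (intro E.vector_fields_lincomb sec_L_vector_field s h E.smooth_funs_const)
  then show "(\<lambda>v. snd (L_smul G h \<sigma> v)) \<in> vector_fields (total_atlas G)" by (simp add: L_smul_def)
  show "snd (snd (L_smul G h \<sigma> v)) (\<lambda>u. f (proj G u)) = snd (anchor G (fst (L_smul G h \<sigma> v))) f"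
    if "f \<in> Cinf_M G" for f v
    using L_act_pull[OF s that, of v] s by (simp add: L_smul_def L_act_def anchor_fscale)
qed (use s in \<open>simp_all add: L_smul_def\<close>)

section \<open>The maps \<open>i\<close> and \<open>j\<close> on sections\<close>

lemma i_eval:
  assumes x: "x \<in> sec_pb G"
  shows i_fst: "fst (i_map G (x v)) = zero_sec (proj G v)"
    and i_base: "fst (snd (i_map G (x v))) = v"
    and i_act: "g \<in> lin_funs G \<Longrightarrow> L_act (i_map G \<circ> x) g v = g (snd (x v))"
    and i_act_pull: "f \<in> Cinf_M G \<Longrightarrow> L_act (i_map G \<circ> x) (\<lambda>u. f (proj G u)) v = 0"
proof -
  have xv: "x v = (v, snd (x v))" using sec_pb_fst[OF x, of v] by (simp add: prod_eq_iff)
  show "fst (i_map G (x v)) = zero_sec (proj G v)" by (subst xv) (simp add: fscale_zero)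
  show "fst (snd (i_map G (x v))) = v" by (subst xv) simp
  show "L_act (i_map G \<circ> x) g v = g (snd (x v))" if "g \<in> lin_funs G"
    unfolding L_act_def o_apply by (subst xv) (rule i_map_lin[OF that sec_pb_proj[OF x]])
  show "L_act (i_map G \<circ> x) (\<lambda>u. f (proj G u)) v = 0" if "f \<in> Cinf_M G"
    unfolding L_act_def o_apply by (subst xv) (rule i_map_pull[OF that sec_pb_proj[OF x]])
qed

lemma anchor_zero: "snd (anchor G (zero_sec p)) f = 0"
  unfolding zero_sec_def by (simp add: anchor_fscale)

lemma i_in: assumes x: "x \<in> sec_pb G" shows "i_map G \<circ> x \<in> sec_L G"
proof (rule sec_LI)
  show "(\<lambda>v. snd ((i_map G \<circ> x) v)) \<in> vector_fields (total_atlas G)"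
    using i_map_vector_field[OF x] by simp
  show "snd (snd ((i_map G \<circ> x) v)) (\<lambda>u. f (proj G u)) = snd (anchor G (fst ((i_map G \<circ> x) v))) f"
    if "f \<in> Cinf_M G" for f v
    using i_act_pull[OF x that, of v] by (simp add: L_act_def i_fst[OF x] anchor_zero)
qed (simp_all add: i_fst[OF x] i_base[OF x] E.smooth_funs_const)

lemma i_lin_fst: "x \<in> sec_pb G \<Longrightarrow> g \<in> lin_funs G \<Longrightarrow> g (fst ((i_map G \<circ> x) v)) = 0"
  by (simp add: i_fst)

lemma i_add: "x \<in> sec_pb G \<Longrightarrow> y \<in> sec_pb G \<Longrightarrow>
    i_map G \<circ> pb_add G x y = L_add G (i_map G \<circ> x) (i_map G \<circ> y)"
  by (rule sec_L_eqI) (simp_all add: i_in pb_add_in L_add_in L_eval i_lin_fst i_act lin_pb_add del: o_apply)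

lemma i_smul: "x \<in> sec_pb G \<Longrightarrow> f \<in> Cinf_E G \<Longrightarrow>
    i_map G \<circ> pb_smul G f x = L_smul G f (i_map G \<circ> x)"
  by (rule sec_L_eqI) (simp_all add: i_in pb_smul_in L_smul_in L_eval i_lin_fst i_act lin_pb_smul del: o_apply)

lemma L_zero_smul: "\<sigma> \<in> sec_L G \<Longrightarrow> L_smul G (\<lambda>_. 0) \<sigma> = L_zero G"
  by (intro ext) (simp add: L_smul_def L_zero_def fscale_zero)

lemma L_zero_in: "L_zero G \<in> sec_L G"
  using L_smul_in[OF E.smooth_funs_const i_in[OF pb_zero_in], of 0]
  by (simp add: L_zero_smul[OF i_in[OF pb_zero_in]])

lemma i_zero: "i_map G \<circ> pb_zero G = L_zero G"
  by (rule sec_L_eqI) (simp_all add: i_in pb_zero_in L_zero_in L_eval i_lin_fst i_act lin_pb_zero del: o_apply)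

lemma i_inj: "x \<in> sec_pb G \<Longrightarrow> y \<in> sec_pb G \<Longrightarrow> i_map G \<circ> x = i_map G \<circ> y \<Longrightarrow> x = y"
  by (rule sec_pb_eqI) (metis i_act)+

lemma j_eval: "\<sigma> \<in> sec_L G \<Longrightarrow> (j_map \<circ> \<sigma>) v = (v, fst (\<sigma> v))"
  by (simp add: j_map_def case_prod_beta)

lemma j_in: "\<sigma> \<in> sec_L G \<Longrightarrow> j_map \<circ> \<sigma> \<in> sec_pb G"
  by (rule sec_pbI) (simp_all add: j_eval sec_L_fst_smooth lin_smooth del: o_apply)

lemma j_i: "x \<in> sec_pb G \<Longrightarrow> j_map \<circ> (i_map G \<circ> x) = pb_zero G"
  by (rule sec_pb_eqI) (simp_all only: j_in i_in pb_zero_in j_eval snd_conv i_lin_fst lin_pb_zero)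

text \<open>Exactness in the middle, for sections: pointwise preimages come from
  \<open>i_map_surj_vertical\<close>, and they form a smooth section since \<open>\<sigma>\<close>
  acts on linear functions by evaluating at them.\<close>

lemma ker_j:
  assumes s: "\<sigma> \<in> sec_L G" and z: "\<And>g v. g \<in> lin_funs G \<Longrightarrow> g (fst (\<sigma> v)) = 0"
  shows "\<exists>x\<in>sec_pb G. \<sigma> = i_map G \<circ> x"
proof -
  have f: "fst (\<sigma> v) = zero_sec (proj G v)" for v by (rule lin_sep) (simp_all add: s z)
  have "\<exists>w. proj G w = proj G v \<and> snd (\<sigma> v) = snd (i_map G (v, w))" for v
  proof (rule i_map_surj_vertical[OF sec_L_tangent[OF s]])
    show "snd (snd (\<sigma> v)) (\<lambda>w. h (proj G w)) = 0" if "h \<in> Cinf_M G" for h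
      using L_act_pull[OF s that, of v] by (simp add: f anchor_zero L_act_def)
  qed
  then obtain w where w: "\<And>v. proj G (w v) = proj G v" "\<And>v. snd (\<sigma> v) = snd (i_map G (v, w v))" by metis
  have eq: "\<sigma> = i_map G \<circ> (\<lambda>v. (v, w v))"
    by (intro ext prod_eqI) (simp_all add: w(2) f fscale_zero)
  have "(\<lambda>v. (v, w v)) \<in> sec_pb G"
  proof (rule sec_pbI)
    fix g assume g: "g \<in> lin_funs G"
    have "L_act \<sigma> g = (\<lambda>v. g (w v))"
      by (rule ext) (use i_map_lin[OF g w(1)] in \<open>simp add: L_act_def w(2)\<close>)
    then show "(\<lambda>v. g (snd (v, w v))) \<in> Cinf_E G"
      using L_act_smooth[OF s lin_smooth[OF g]] by simp
  qed (simp_all add: w(1))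
  then show ?thesis using eq by blast
qed

section \<open>Complete lifts\<close>

text \<open>Projectability with the base section named, because the bracket formula for projectable
  sections refers to it.\<close>

definition proj_over :: "('e \<Rightarrow> 'e \<times> 'e tvec) \<Rightarrow> ('m \<Rightarrow> 'e) \<Rightarrow> bool" where
  "proj_over P X \<longleftrightarrow> P \<in> sec_L G \<and> X \<in> sec_E G \<and> (\<forall>v. fst (P v) = X (proj G v))"

lemma proj_overD: "proj_over P X \<Longrightarrow> P \<in> sec_L G" "proj_over P X \<Longrightarrow> X \<in> sec_E G"
  "proj_over P X \<Longrightarrow> fst (P v) = X (proj G v)"
  unfolding proj_over_def by blast+

lemma proj_over_i: "x \<in> sec_pb G \<Longrightarrow> proj_over (i_map G \<circ> x) zero_sec"
  unfolding proj_over_def by (simp add: i_in zero_sec_in i_fst)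

lemma hat_add: "hat G (\<lambda>p. fadd G (X p) (Y p)) = pb_add G (hat G X) (hat G Y)"
  by (simp add: hat_def pb_add_def)

lemma hat_smul: "hat G (\<lambda>p. fscale G (f p) (X p)) = pb_smul G (\<lambda>u. f (proj G u)) (hat G X)"
  by (simp add: hat_def pb_smul_def)

lemma hat_snd [simp]: "snd (hat G X u) = X (proj G u)"
  by (simp add: hat_def)

lemma j_add: "\<sigma> \<in> sec_L G \<Longrightarrow> \<tau> \<in> sec_L G \<Longrightarrow> j_map \<circ> L_add G \<sigma> \<tau> = pb_add G (j_map \<circ> \<sigma>) (j_map \<circ> \<tau>)"
  by (rule sec_pb_eqI)
    (simp_all add: j_in L_add_in pb_add_in j_eval lin_pb_add L_add_fst del: o_apply)

lemma j_smul: "\<sigma> \<in> sec_L G \<Longrightarrow> f \<in> Cinf_E G \<Longrightarrow> j_map \<circ> L_smul G f \<sigma> = pb_smul G f (j_map \<circ> \<sigma>)"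
  by (rule sec_pb_eqI)
    (simp_all add: j_in L_smul_in pb_smul_in j_eval lin_pb_smul L_smul_fst del: o_apply)

lemma L_add_zero: "\<sigma> \<in> sec_L G \<Longrightarrow> L_add G \<sigma> (L_zero G) = \<sigma>"
  by (rule sec_L_eqI) (simp_all add: L_add_in L_zero_in L_eval)

text \<open>The Lie derivative of linear functions, obtained by extending \<open>\<xi> \<mapsto> \<rho>(\<eta>)(g(\<xi>)) - g([\<eta>, \<xi>])\<close>
  to the tautological section of the pullback bundle.\<close>
definition lie_fun :: "('m \<Rightarrow> 'e) \<Rightarrow> ('e \<Rightarrow> real) \<Rightarrow> ('m \<Rightarrow> 'e) \<Rightarrow> 'm \<Rightarrow> real" where
  "lie_fun \<eta> g \<xi> p = snd (anchor G (\<eta> p)) (\<lambda>q. g (\<xi> q)) - g (lbr G \<eta> \<xi> p)"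

definition lie_lin :: "('m \<Rightarrow> 'e) \<Rightarrow> ('e \<Rightarrow> real) \<Rightarrow> 'e \<Rightarrow> real" where
  "lie_lin \<eta> g = ext_pb (\<lambda>\<xi> u. lie_fun \<eta> g \<xi> (proj G u)) (\<lambda>u. (u, u))"

text \<open>Replacing \<open>\<xi>\<close> by \<open>f \<xi>\<close> creates the term
  \<open>\<rho>(\<eta>)(f) g(\<xi>)\<close> in both summands, from the derivation rule and from the
  Leibniz rule, with opposite signs.\<close>

lemma lie_fun_pull_linear:
  assumes \<eta>: "\<eta> \<in> sec_E G" and g: "g \<in> lin_funs G"
  shows "pull_linear (\<lambda>\<xi> u. lie_fun \<eta> g \<xi> (proj G u))"
proof -
  have gs: "(\<lambda>q. g (\<xi> q)) \<in> Cinf_M G" if "\<xi> \<in> sec_E G" for \<xi>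
    by (rule sec_E_smooth[OF that lin_smooth[OF g]])
  have "lie_fun \<eta> g \<xi> \<in> Cinf_M G" if "\<xi> \<in> sec_E G" for \<xi>
    unfolding lie_fun_def
    by (intro M.smooth_funs_diff anchor_sec_smooth \<eta> gs that lbr_in)
  moreover have "linear_at_E p (\<lambda>\<xi>. lie_fun \<eta> g \<xi> p)" for p
    unfolding linear_at_E_def
  proof (intro conjI ballI)
    fix X Y assume XY: "X \<in> sec_E G" "Y \<in> sec_E G"
    have "(\<lambda>q. g (fadd G (X q) (Y q))) = (\<lambda>q. g (X q) + g (Y q))"
      using XY by (simp add: lin_fadd[OF g])
    moreover have "g (lbr G \<eta> (\<lambda>q. fadd G (X q) (Y q)) p) = g (lbr G \<eta> X p) + g (lbr G \<eta> Y p)"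
      using XY \<eta> by (simp add: lbr_add lin_fadd[OF g] lbr_in)
    ultimately show "lie_fun \<eta> g (\<lambda>q. fadd G (X q) (Y q)) p = lie_fun \<eta> g X p + lie_fun \<eta> g Y p"
      using anchor_rules(2)[OF gs[OF XY(1)] gs[OF XY(2)]] by (simp add: lie_fun_def)
  next
    fix f X assume f: "f \<in> Cinf_M G" and X: "X \<in> sec_E G"
    have "(\<lambda>q. g (fscale G (f q) (X q))) = (\<lambda>q. f q * g (X q))" by (simp add: lin_fscale[OF g])
    moreover have "g (lbr G \<eta> (\<lambda>q. fscale G (f q) (X q)) p) =
        f p * g (lbr G \<eta> X p) + snd (anchor G (\<eta> p)) f * g (X p)"
      using X \<eta> f by (simp add: lbr_leibniz lin_fadd[OF g] lin_fscale[OF g] lbr_in)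
    ultimately show "lie_fun \<eta> g (\<lambda>q. fscale G (f q) (X q)) p = f p * lie_fun \<eta> g X p"
      using anchor_rules(3)[OF f gs[OF X], of "\<eta> p"] \<eta> by (simp add: lie_fun_def algebra_simps)
  qed
  ultimately show ?thesis unfolding pull_linear_def using pull by blast
qed

lemma tautological_in: "(\<lambda>u. (u, u)) \<in> sec_pb G"
  by (rule sec_pbI) (simp_all add: lin_smooth)

lemma lie_lin_sec:
  assumes "\<eta> \<in> sec_E G" "g \<in> lin_funs G" "\<xi> \<in> sec_E G"
  shows "lie_lin \<eta> g (\<xi> p) = lie_fun \<eta> g \<xi> p"
  unfolding lie_lin_def
  using ext_pb_eq[OF lie_fun_pull_linear[OF assms(1,2)] assms(3), of "\<xi> p" "\<lambda>u. (u, u)"] assms(3) by simp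

lemma lie_lin_in:
  assumes "\<eta> \<in> sec_E G" "g \<in> lin_funs G"
  shows "lie_lin \<eta> g \<in> lin_funs G"
proof -
  have "lie_lin \<eta> g \<in> Cinf_E G"
    unfolding lie_lin_def by (rule ext_pb_smooth[OF lie_fun_pull_linear[OF assms] tautological_in])
  moreover have "lie_lin \<eta> g (fadd G u v) = lie_lin \<eta> g u + lie_lin \<eta> g v" if "proj G u = proj G v" for u v
    unfolding lie_lin_def ext_pb_def using that
    by (simp, intro sum_list_prod_add) (simp add: lin_fadd[OF frm_lin] distrib_right)
  moreover have "lie_lin \<eta> g (fscale G c u) = c * lie_lin \<eta> g u" for c u
    unfolding lie_lin_def ext_pb_def
    by (simp, intro sum_list_prod_mult) (simp add: lin_fscale[OF frm_lin])
  ultimately show ?thesis unfolding lin_funs_def by blast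
qed

lemma lin_funs_eqI:
  assumes "\<And>\<xi> p. \<xi> \<in> sec_E G \<Longrightarrow> g (\<xi> p) = g' (\<xi> p)" shows "g = g'"
proof
  fix u
  obtain X where "X \<in> sec_E G" "X (proj G u) = u" using sec_through by blast
  then show "g u = g' u" using assms[of X "proj G u"] by simp
qed

text \<open>\<open>lie_lin\<close> is the witness that makes the \<open>SOME\<close> in
  \<open>dual_lie_deriv\<close> meaningful. Two candidates agree as functions on \<open>E\<close>,
  since every vector is a value of a section.\<close>

lemma dual_lie_deriv_eq:
  assumes \<eta>: "\<eta> \<in> sec_E G" and \<theta>: "\<theta> \<in> sec_dual G"
  shows "fun_hat G (dual_lie_deriv G \<eta> \<theta>) = lie_lin \<eta> (fun_hat G \<theta>)"
proof -
  let ?g = "fun_hat G \<theta>"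
  note g = sec_dual_lin_funs[OF \<theta>]
  let ?P = "\<lambda>\<omega>. \<omega> \<in> sec_dual G \<and> (\<forall>\<xi>\<in>sec_E G. \<forall>p.
    \<omega> p (\<xi> p) = snd (anchor G (\<eta> p)) (\<lambda>q. \<theta> q (\<xi> q)) - \<theta> p (lbr G \<eta> \<xi> p))"
  have lf: "lie_fun \<eta> ?g \<xi> p = snd (anchor G (\<eta> p)) (\<lambda>q. \<theta> q (\<xi> q)) - \<theta> p (lbr G \<eta> \<xi> p)"
    if "\<xi> \<in> sec_E G" for \<xi> p
    using that lbr_in[OF \<eta> that] by (simp add: lie_fun_def fun_hat_def)
  have "?P (\<lambda>_. lie_lin \<eta> ?g)"
    using lin_funs_sec_dual[OF lie_lin_in[OF \<eta> g]] lie_lin_sec[OF \<eta> g] lf by simp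
  then have P: "?P (dual_lie_deriv G \<eta> \<theta>)"
    unfolding dual_lie_deriv_def by (rule someI[of ?P])
  show ?thesis
  proof (rule lin_funs_eqI)
    fix \<xi> p assume \<xi>: "\<xi> \<in> sec_E G"
    have "fun_hat G (dual_lie_deriv G \<eta> \<theta>) (\<xi> p) = dual_lie_deriv G \<eta> \<theta> p (\<xi> p)"
      using \<xi> by (simp add: fun_hat_def)
    also have "\<dots> = lie_fun \<eta> ?g \<xi> p" using P \<xi> lf[OF \<xi>] by simp
    finally show "fun_hat G (dual_lie_deriv G \<eta> \<theta>) (\<xi> p) = lie_lin \<eta> ?g (\<xi> p)"
      by (simp add: lie_lin_sec[OF \<eta> g \<xi>])
  qed
qed

lemma lie_lin_add:
  assumes "\<eta> \<in> sec_E G" "g \<in> lin_funs G" "g' \<in> lin_funs G"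
  shows "lie_lin \<eta> (\<lambda>v. g v + g' v) u = lie_lin \<eta> g u + lie_lin \<eta> g' u"
proof -
  obtain \<xi> where \<xi>: "\<xi> \<in> sec_E G" "\<xi> (proj G u) = u" using sec_through by blast
  have s: "(\<lambda>q. g (\<xi> q)) \<in> Cinf_M G" if "g \<in> lin_funs G" for g
    by (rule sec_E_smooth[OF \<xi>(1) lin_smooth[OF that]])
  have "lie_lin \<eta> (\<lambda>v. g v + g' v) (\<xi> (proj G u)) =
      lie_lin \<eta> g (\<xi> (proj G u)) + lie_lin \<eta> g' (\<xi> (proj G u))"
    unfolding lie_lin_sec[OF assms(1,2) \<xi>(1)] lie_lin_sec[OF assms(1,3) \<xi>(1)]
      lie_lin_sec[OF assms(1) lin_funs_add[OF assms(2,3)] \<xi>(1)] lie_fun_def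
      anchor_rules(2)[OF s[OF assms(2)] s[OF assms(3)]] by simp
  then show ?thesis by (simp add: \<xi>(2))
qed

text \<open>The inhomogeneous term is the one that every section of the prolongation over
  \<open>\<eta>\<close> produces, so the difference from such a section is linear over base
  functions.\<close>

lemma lie_lin_mult:
  assumes "\<eta> \<in> sec_E G" "f \<in> Cinf_M G" "g \<in> lin_funs G"
  shows "lie_lin \<eta> (\<lambda>v. f (proj G v) * g v) u =
    f (proj G u) * lie_lin \<eta> g u + snd (anchor G (\<eta> (proj G u))) f * g u"
proof -
  obtain \<xi> where \<xi>: "\<xi> \<in> sec_E G" "\<xi> (proj G u) = u" using sec_through by blast
  have s: "(\<lambda>q. g (\<xi> q)) \<in> Cinf_M G"
    by (rule sec_E_smooth[OF \<xi>(1) lin_smooth[OF assms(3)]])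
  let ?p = "proj G u"
  have "lie_lin \<eta> (\<lambda>v. f (proj G v) * g v) (\<xi> ?p) =
    f ?p * lie_lin \<eta> g (\<xi> ?p) + snd (anchor G (\<eta> ?p)) f * g (\<xi> ?p)"
    unfolding lie_lin_sec[OF assms(1,3) \<xi>(1)]
      lie_lin_sec[OF assms(1) lin_funs_mult_base[OF assms(2,3)] \<xi>(1)] lie_fun_def
    using anchor_rules(3)[OF assms(2) s, of "\<eta> ?p"] \<xi>(1) assms(1) lbr_in[OF assms(1) \<xi>(1)]
    by (simp add: algebra_simps)
  then show ?thesis by (simp add: \<xi>(2))
qed

end

text \<open>The connection serves first as a splitting of the exact sequence and as a source of
  projectable sections over every \<open>X\<close>. The Berwald condition enters with
  \<open>br_complete_H\<close>.\<close>

locale prolongation_split = lie_algd G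
  for G :: "('m::{t2_space,second_countable_topology}, 'e::{t2_space,second_countable_topology},
      'a::real_inner, 'b::real_inner) algebroid" +
  fixes br :: "'e L_bracket" and H :: "('e \<Rightarrow> 'e \<times> 'e) \<Rightarrow> 'e \<Rightarrow> 'e \<times> 'e tvec"
  assumes pbr: "prolongation_bracket G br" and eh: "ehresmann G H"
begin

section \<open>The bracket of the prolongation\<close>

lemma br:
  assumes "x \<in> sec_L G" "y \<in> sec_L G"
  shows br_in: "br x y \<in> sec_L G"
    and br_add: "z \<in> sec_L G \<Longrightarrow> br x (L_add G y z) = L_add G (br x y) (br x z)"
    and br_const: "br x (L_smul G (\<lambda>_. c) y) = L_smul G (\<lambda>_. c) (br x y)"
    and br_anti: "br y x = L_smul G (\<lambda>_. - 1) (br x y)"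
    and br_jacobi: "z \<in> sec_L G \<Longrightarrow> br x (br y z) = L_add G (br (br x y) z) (br y (br x z))"
    and br_leibniz: "f \<in> Cinf_E G \<Longrightarrow> br x (L_smul G f y) = L_add G (L_smul G f (br x y)) (L_smul G (L_act x f) y)"
  using conjunct1[OF pbr[unfolded prolongation_bracket_def], unfolded lie_algebroid_bracket_def] assms
  by blast+

lemma br_zero: "x \<in> sec_L G \<Longrightarrow> br x (L_zero G) = L_zero G"
  using br_const[of x "L_zero G" 0] L_zero_in br_in[of x "L_zero G"] by (simp add: L_zero_smul)

lemma br_zero': "x \<in> sec_L G \<Longrightarrow> br (L_zero G) x = L_zero G"
  using br_anti[of x "L_zero G"] L_zero_in br_zero[of x]
  by (simp, intro sec_L_eqI) (simp_all add: L_smul_in E.smooth_funs_const L_eval)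

lemma br_add_left:
  assumes "x \<in> sec_L G" "y \<in> sec_L G" "z \<in> sec_L G"
  shows "br (L_add G y z) x = L_add G (br y x) (br z x)"
  unfolding br_anti[OF assms(1) L_add_in[OF assms(2,3)]] br_anti[OF assms(1,2)] br_anti[OF assms(1,3)]
    br_add[OF assms]
  by (rule sec_L_eqI) (simp_all add: assms br_in L_add_in L_smul_in E.smooth_funs_const L_eval)

lemma br_leibniz_left:
  assumes "x \<in> sec_L G" "y \<in> sec_L G" "f \<in> Cinf_E G"
  shows "br (L_smul G f y) x = L_add G (L_smul G f (br y x)) (L_smul G (\<lambda>v. - L_act x f v) y)"
  unfolding br_anti[OF assms(1) L_smul_in[OF assms(3,2)]] br_anti[OF assms(1,2)] br_leibniz[OF assms]
  by (rule sec_L_eqI)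
    (simp_all add: assms br_in L_add_in L_smul_in E.smooth_funs_const E.smooth_funs_minus L_act_smooth L_eval)

lemma br_proj_over:
  assumes P: "proj_over P X" and Q: "proj_over Q Y"
  shows "br P Q = (\<lambda>v. (lbr G X Y (proj G v),
    vf_bracket (total_atlas G) (\<lambda>v. snd (P v)) (\<lambda>v. snd (Q v)) v))"
proof -
  have eq: "P = (\<lambda>v. (X (proj G v), snd (P v)))" "Q = (\<lambda>v. (Y (proj G v), snd (Q v)))"
    using proj_overD(3)[OF P] proj_overD(3)[OF Q] by (auto simp: prod_eq_iff)
  have rel: "related_to_anchor G (\<lambda>v. snd (P v)) X" "related_to_anchor G (\<lambda>v. snd (Q v)) Y"
    unfolding related_to_anchor_def
    using sec_L_pushforward[OF proj_overD(1)[OF P]] sec_L_pushforward[OF proj_overD(1)[OF Q]]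
      proj_overD(3)[OF P] proj_overD(3)[OF Q] by simp_all
  have "br (\<lambda>v. (X (proj G v), snd (P v))) (\<lambda>v. (Y (proj G v), snd (Q v))) =
    (\<lambda>v. (lbr G X Y (proj G v), vf_bracket (total_atlas G) (\<lambda>v. snd (P v)) (\<lambda>v. snd (Q v)) v))"
    using conjunct2[OF pbr[unfolded prolongation_bracket_def], rule_format, OF proj_overD(2)[OF P]
        proj_overD(2)[OF Q] sec_L_vector_field[OF proj_overD(1)[OF P]]
        sec_L_vector_field[OF proj_overD(1)[OF Q]]] rel by blast
  then show ?thesis using eq by simp
qed

lemma proj_over_br: "proj_over P X \<Longrightarrow> proj_over Q Y \<Longrightarrow> proj_over (br P Q) (lbr G X Y)"
  using br_proj_over[of P X Q Y] br_in[of P Q] lbr_in[of X Y]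
  unfolding proj_over_def by simp

lemma L_act_br:
  assumes P: "proj_over P X" and Q: "proj_over Q Y" and f: "f \<in> Cinf_E G"
  shows "L_act (br P Q) f v = L_act P (L_act Q f) v - L_act Q (L_act P f) v"
  unfolding br_proj_over[OF P Q] by (simp add: L_act_def vf_bracket_def f)

text \<open>A vertical section lies over the zero section, so the bracket lies over
  \<open>[X, 0] = 0\<close> and is vertical by exactness.\<close>

lemma br_vertical:
  assumes P: "proj_over P X" and x: "x \<in> sec_pb G"
  shows "\<exists>y\<in>sec_pb G. br P (i_map G \<circ> x) = i_map G \<circ> y"
proof (rule ker_j)
  note po = proj_over_br[OF P proj_over_i[OF x]]
  show "br P (i_map G \<circ> x) \<in> sec_L G" by (rule proj_overD(1)[OF po])
  show "g (fst (br P (i_map G \<circ> x) v)) = 0" if "g \<in> lin_funs G" for g v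
    using that proj_overD(3)[OF po] lbr_zero[OF proj_overD(2)[OF P]] by simp
qed

section \<open>The connection, its vertical map and the horizontal differential\<close>

lemma H_rules:
  assumes "x \<in> sec_pb G"
  shows H_in: "H x \<in> sec_L G"
    and H_add: "y \<in> sec_pb G \<Longrightarrow> H (pb_add G x y) = L_add G (H x) (H y)"
    and H_smul: "f \<in> Cinf_E G \<Longrightarrow> H (pb_smul G f x) = L_smul G f (H x)"
    and j_H: "j_map \<circ> H x = x"
  using eh assms unfolding ehresmann_def module_hom_def by blast+

lemma H_fst: "x \<in> sec_pb G \<Longrightarrow> fst (H x v) = snd (x v)"
  using j_eval[OF H_in, of x v] j_H[of x] by simp

lemma H_zero: "H (pb_zero G) = L_zero G"
proof -
  have "pb_zero G = pb_smul G (\<lambda>_. 0) (pb_zero G)"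
    by (rule sec_pb_eqI) (simp_all add: pb_zero_in pb_smul_in E.smooth_funs_const lin_pb_zero lin_pb_smul)
  then have "H (pb_zero G) = L_smul G (\<lambda>_. 0) (H (pb_zero G))"
    using H_smul[OF pb_zero_in E.smooth_funs_const] by metis
  then show ?thesis using L_zero_smul[OF H_in[OF pb_zero_in]] by simp
qed

lemma H_hat: "X \<in> sec_E G \<Longrightarrow> proj_over (H (hat G X)) X"
  unfolding proj_over_def by (simp add: H_in hat_in H_fst)

lemma H_decomp:
  assumes s: "\<sigma> \<in> sec_L G"
  shows "\<exists>y\<in>sec_pb G. L_add G \<sigma> (L_smul G (\<lambda>_. - 1) (H (j_map \<circ> \<sigma>))) = i_map G \<circ> y"
proof (rule ker_j)
  note h = H_in[OF j_in[OF s]]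
  note h' = L_smul_in[OF E.smooth_funs_const[of "-1"] h]
  show "L_add G \<sigma> (L_smul G (\<lambda>_. - 1) (H (j_map \<circ> \<sigma>))) \<in> sec_L G" by (rule L_add_in[OF s h'])
  show "g (fst (L_add G \<sigma> (L_smul G (\<lambda>_. - 1) (H (j_map \<circ> \<sigma>))) v)) = 0" if "g \<in> lin_funs G" for g v
    using that s h' by (simp add: L_eval H_fst j_in j_eval del: o_apply)
qed

text \<open>The vertical part \<open>\<sigma> - \<H>(j \<sigma>)\<close> pulled back along
  \<open>i\<close>; it witnesses the existence behind the \<open>SOME\<close> in
  \<open>vertical_map\<close>.\<close>

definition vmap :: "('e \<Rightarrow> 'e \<times> 'e tvec) \<Rightarrow> 'e \<Rightarrow> 'e \<times> 'e" where
  "vmap \<sigma> = (SOME y. y \<in> sec_pb G \<and> L_add G \<sigma> (L_smul G (\<lambda>_. - 1) (H (j_map \<circ> \<sigma>))) = i_map G \<circ> y)"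

lemma vmap:
  assumes s: "\<sigma> \<in> sec_L G"
  shows "vmap \<sigma> \<in> sec_pb G" "i_map G \<circ> vmap \<sigma> = L_add G \<sigma> (L_smul G (\<lambda>_. - 1) (H (j_map \<circ> \<sigma>)))"
proof -
  let ?P = "\<lambda>y. y \<in> sec_pb G \<and> L_add G \<sigma> (L_smul G (\<lambda>_. - 1) (H (j_map \<circ> \<sigma>))) = i_map G \<circ> y"
  have "\<exists>y. ?P y" using H_decomp[OF s] by blast
  then have "?P (vmap \<sigma>)" unfolding vmap_def by (rule someI_ex)
  then show "vmap \<sigma> \<in> sec_pb G" "i_map G \<circ> vmap \<sigma> = L_add G \<sigma> (L_smul G (\<lambda>_. - 1) (H (j_map \<circ> \<sigma>)))"
    by simp_all
qed

lemma vmap_eqI: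
  assumes s: "\<sigma> \<in> sec_L G" and y: "y \<in> sec_pb G"
    and "\<And>g v. g \<in> lin_funs G \<Longrightarrow> L_act \<sigma> g v - L_act (H (j_map \<circ> \<sigma>)) g v = g (snd (y v))"
  shows "vmap \<sigma> = y"
proof (rule sec_pb_eqI[OF vmap(1)[OF s] y])
  fix g v assume g: "g \<in> lin_funs G"
  have "g (snd (vmap \<sigma> v)) = L_act (i_map G \<circ> vmap \<sigma>) g v" using i_act[OF vmap(1)[OF s] g] by simp
  also have "\<dots> = g (snd (y v))" unfolding vmap(2)[OF s] using assms(3)[OF g, of v] by (simp add: L_eval)
  finally show "g (snd (vmap \<sigma> v)) = g (snd (y v))" .
qed

lemma vmap_lin:
  assumes s: "\<sigma> \<in> sec_L G" and g: "g \<in> lin_funs G"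
  shows "g (snd (vmap \<sigma> v)) = L_act \<sigma> g v - L_act (H (j_map \<circ> \<sigma>)) g v"
proof -
  have "g (snd (vmap \<sigma> v)) = L_act (i_map G \<circ> vmap \<sigma>) g v" using i_act[OF vmap(1)[OF s] g] by simp
  then show ?thesis unfolding vmap(2)[OF s] by (simp add: L_eval)
qed

text \<open>Of the defining properties only this one is carried further, because below the vertical
  map is always applied to vertical sections.\<close>

lemma vertical_map_i:
  assumes x: "x \<in> sec_pb G" shows "vertical_map G H (i_map G \<circ> x) = x"
proof -
  let ?P = "\<lambda>V. module_hom (Cinf_E G) (sec_L G) (L_add G) (L_smul G) (sec_pb G) (pb_add G) (pb_smul G) V \<and>
     (\<forall>\<xi>\<in>sec_pb G. V (i_map G \<circ> \<xi>) = \<xi>) \<and>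
     (\<forall>\<sigma>\<in>sec_L G. V \<sigma> = pb_zero G \<longleftrightarrow> \<sigma> \<in> H ` sec_pb G)"
  have "?P vmap"
  proof (intro conjI ballI)
    show "module_hom (Cinf_E G) (sec_L G) (L_add G) (L_smul G) (sec_pb G) (pb_add G) (pb_smul G) vmap"
      unfolding module_hom_def
    proof (intro conjI ballI)
      fix \<sigma> \<tau> assume st: "\<sigma> \<in> sec_L G" "\<tau> \<in> sec_L G"
      show "vmap (L_add G \<sigma> \<tau>) = pb_add G (vmap \<sigma>) (vmap \<tau>)"
        by (rule vmap_eqI) (simp_all add: st L_add_in pb_add_in vmap(1) lin_pb_add vmap_lin j_add H_add j_in L_eval)
    next
      fix f \<sigma> assume st: "f \<in> Cinf_E G" "\<sigma> \<in> sec_L G"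
      show "vmap (L_smul G f \<sigma>) = pb_smul G f (vmap \<sigma>)"
        by (rule vmap_eqI)
          (simp_all add: st L_smul_in pb_smul_in vmap(1) lin_pb_smul vmap_lin j_smul H_smul j_in L_eval algebra_simps)
    qed (rule vmap(1))
    show "vmap (i_map G \<circ> y) = y" if "y \<in> sec_pb G" for y
      by (rule vmap_eqI) (simp_all add: that i_in j_i H_zero L_eval i_act del: o_apply)
    show "vmap \<sigma> = pb_zero G \<longleftrightarrow> \<sigma> \<in> H ` sec_pb G" if s: "\<sigma> \<in> sec_L G" for \<sigma>
    proof
      assume v: "vmap \<sigma> = pb_zero G"
      have "\<sigma> = H (j_map \<circ> \<sigma>)"
        by (rule sec_L_eqI)
          (use s vmap_lin[OF s] v in \<open>simp_all add: H_in j_in H_fst j_eval lin_pb_zero del: o_apply\<close>)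
      then show "\<sigma> \<in> H ` sec_pb G" using j_in[OF s] by blast
    next
      assume "\<sigma> \<in> H ` sec_pb G"
      then obtain y where y: "y \<in> sec_pb G" "\<sigma> = H y" by blast
      show "vmap \<sigma> = pb_zero G"
        by (rule vmap_eqI) (use s y in \<open>simp_all add: pb_zero_in j_H lin_pb_zero\<close>)
    qed
  qed
  then have "?P (vertical_map G H)" unfolding vertical_map_def by (rule someI[of ?P])
  then show ?thesis using x by blast
qed

text \<open>\<open>\<H>\<close> of a basic section is projectable, hence its bracket with a vertical
  section is vertical, and there the vertical map merely inverts \<open>i\<close>.\<close>

lemma nabla_h_hat:
  assumes X: "X \<in> sec_E G" and z: "z \<in> sec_pb G"
  shows nabla_h_in: "nabla_h G br H (hat G X) z \<in> sec_pb G"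
    and i_nabla_h: "i_map G \<circ> nabla_h G br H (hat G X) z = br (H (hat G X)) (i_map G \<circ> z)"
proof -
  obtain y where y: "y \<in> sec_pb G" "br (H (hat G X)) (i_map G \<circ> z) = i_map G \<circ> y"
    using br_vertical[OF H_hat[OF X] z] by blast
  have "nabla_h G br H (hat G X) z = y"
    unfolding nabla_h_def y(2) by (rule vertical_map_i[OF y(1)])
  then show "nabla_h G br H (hat G X) z \<in> sec_pb G"
    "i_map G \<circ> nabla_h G br H (hat G X) z = br (H (hat G X)) (i_map G \<circ> z)" using y by simp_all
qed

lemma nabla_h_zero: "z \<in> sec_pb G \<Longrightarrow> nabla_h G br H (pb_zero G) z = pb_zero G"
  unfolding nabla_h_def H_zero
  using br_zero'[OF i_in, of z] vertical_map_i[OF pb_zero_in] by (simp add: i_zero del: o_apply)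

section \<open>The vertical differential\<close>

lemma L_act_i_pull:
  "x \<in> sec_pb G \<Longrightarrow> X \<in> sec_E G \<Longrightarrow> g \<in> lin_funs G \<Longrightarrow> L_act (i_map G \<circ> x) (\<lambda>v. g (X (proj G v))) u = 0"
  using i_act_pull[OF _ sec_E_smooth[OF _ lin_smooth]] by simp

text \<open>Both sides are \<open>C\<^sup>\<infinity>\<close>-derivations in \<open>\<sigma>\<close> along the same field, so their difference is tensorial and it
  suffices to compare them on horizontal lifts of basic sections and on vertical sections.\<close>
lemma lin_fst_br_i:
  assumes x: "x \<in> sec_pb G" and s: "\<sigma> \<in> sec_L G" and g: "g \<in> lin_funs G"
  shows "g (fst (br (i_map G \<circ> x) \<sigma> u)) = L_act (i_map G \<circ> x) (\<lambda>v. g (fst (\<sigma> v))) u"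
proof -
  note ix = i_in[OF x]
  define \<Phi> where "\<Phi> \<sigma> = g (fst (br (i_map G \<circ> x) \<sigma> u)) - L_act (i_map G \<circ> x) (\<lambda>v. g (fst (\<sigma> v))) u" for \<sigma>
  have sm: "(\<lambda>v. g (fst (\<sigma> v))) \<in> Cinf_E G" if "\<sigma> \<in> sec_L G" for \<sigma>
    by (rule sec_L_fst_smooth[OF that lin_smooth[OF g]])
  have add: "\<Phi> (L_add G \<sigma> \<tau>) = \<Phi> \<sigma> + \<Phi> \<tau>" if "\<sigma> \<in> sec_L G" "\<tau> \<in> sec_L G" for \<sigma> \<tau>
    unfolding \<Phi>_def using that g L_act_sum[OF ix sm[OF that(1)] sm[OF that(2)]]
    by (simp add: br_add[OF ix] L_add_fst br_in[OF ix])
  \<comment> \<open>The Leibniz term, the derivative of \<open>f\<close> along \<open>i x\<close>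
    times \<open>g\<close> of the first component, occurs in both parts of \<open>\<Phi>\<close> and
    cancels.\<close>
  have smul: "\<Phi> (L_smul G f \<sigma>) = f u * \<Phi> \<sigma>" if "f \<in> Cinf_E G" "\<sigma> \<in> sec_L G" for f \<sigma>
    unfolding \<Phi>_def using that g L_act_mult[OF ix that(1) sm[OF that(2)], of u]
    by (simp add: br_leibniz[OF ix] L_add_fst L_smul_fst br_in[OF ix] L_smul_in L_act_smooth[OF ix] algebra_simps)
  have i: "\<Phi> (i_map G \<circ> y) = 0" if y: "y \<in> sec_pb G" for y
  proof -
    obtain z where "z \<in> sec_pb G" "br (i_map G \<circ> x) (i_map G \<circ> y) = i_map G \<circ> z"
      using br_vertical[OF proj_over_i[OF x] y] by blast
    then show ?thesis unfolding \<Phi>_def using L_act_zero[OF ix] by (simp add: i_lin_fst[OF _ g] y del: o_apply)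
  qed
  have "\<Phi> (H w) = 0" if w: "w \<in> sec_pb G" for w
  proof (rule linear_at_pb_zero[OF _ _ w])
    show "linear_at_pb u (\<lambda>w. \<Phi> (H w))"
      unfolding linear_at_pb_def by (simp add: H_add H_smul add smul H_in)
    \<comment> \<open>Both parts vanish: the bracket lies over \<open>[0, Y] = 0\<close>, and
      \<open>g(Y)\<close> is constant along the fibres.\<close>
    show "\<Phi> (H (hat G Y)) = 0" if Y: "Y \<in> sec_E G" for Y
      unfolding \<Phi>_def
      using proj_overD(3)[OF proj_over_br[OF proj_over_i[OF x] H_hat[OF Y]], of u]
        lbr_zero'[OF Y] g L_act_i_pull[OF x Y g] by (simp add: H_fst hat_in Y)
  qed
  note Hz = this
  have h: "H (j_map \<circ> \<sigma>) \<in> sec_L G" by (rule H_in[OF j_in[OF s]])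
  obtain y where y: "y \<in> sec_pb G" "L_add G \<sigma> (L_smul G (\<lambda>_. - 1) (H (j_map \<circ> \<sigma>))) = i_map G \<circ> y"
    using H_decomp[OF s] by blast
  have "\<Phi> \<sigma> + (- 1) * \<Phi> (H (j_map \<circ> \<sigma>)) = 0"
    using i[OF y(1)] add[OF s L_smul_in[OF E.smooth_funs_const h], of "-1"]
      smul[OF E.smooth_funs_const h, of "-1"] unfolding y(2) by simp
  then have "\<Phi> \<sigma> = 0" using Hz[OF j_in[OF s]] by simp
  then show ?thesis by (simp add: \<Phi>_def)
qed

text \<open>\<open>H w\<close> shows that a lift of \<open>w\<close> exists, and by
  \<open>lin_fst_br_i\<close> the result depends on the chosen lift only through its first
  component, which is \<open>w\<close>.\<close>

lemma nabla_v:
  assumes x: "x \<in> sec_pb G" and w: "w \<in> sec_pb G"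
  shows nabla_v_in: "nabla_v G br x w \<in> sec_pb G"
    and nabla_v_lin: "g \<in> lin_funs G \<Longrightarrow> g (snd (nabla_v G br x w u)) = L_act (i_map G \<circ> x) (\<lambda>v. g (snd (w v))) u"
proof -
  define s where "s = (SOME \<sigma>. \<sigma> \<in> sec_L G \<and> j_map \<circ> \<sigma> = w)"
  have s: "s \<in> sec_L G" "j_map \<circ> s = w"
    using someI[of "\<lambda>\<sigma>. \<sigma> \<in> sec_L G \<and> j_map \<circ> \<sigma> = w" "H w"] H_in[OF w] j_H[OF w] unfolding s_def by auto
  have n: "nabla_v G br x w = j_map \<circ> br (i_map G \<circ> x) s" by (simp add: nabla_v_def s_def)
  have b: "br (i_map G \<circ> x) s \<in> sec_L G" by (rule br_in[OF i_in[OF x] s(1)])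
  show "nabla_v G br x w \<in> sec_pb G" unfolding n by (rule j_in[OF b])
  have "snd (w v) = fst (s v)" for v using j_eval[OF s(1), of v] unfolding s(2) by simp
  then show "g (snd (nabla_v G br x w u)) = L_act (i_map G \<circ> x) (\<lambda>v. g (snd (w v))) u" if "g \<in> lin_funs G"
    unfolding n j_eval[OF b] snd_conv lin_fst_br_i[OF x s(1) that] by simp
qed

text \<open>The bracket of the horizontal lifts of \<open>X\<close> and \<open>Y\<close> is again a
  section of the prolongation, lying over \<open>[X, Y]\<close>. Its action on
  \<open>f \<circ> \<pi>\<close> is therefore the anchor of \<open>[X, Y]\<close>, and by the
  bracket formula it is the commutator.\<close>

lemma anchor_hom:
  assumes X: "X \<in> sec_E G" and Y: "Y \<in> sec_E G" and f: "f \<in> Cinf_M G"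
  shows "snd (anchor G (lbr G X Y p)) f =
    snd (anchor G (X p)) (\<lambda>q. snd (anchor G (Y q)) f) - snd (anchor G (Y p)) (\<lambda>q. snd (anchor G (X q)) f)"
proof -
  obtain v where v: "proj G v = p" using fibre_nonempty by blast
  let ?f = "\<lambda>u. f (proj G u)"
  have act: "L_act (H (hat G Z)) (\<lambda>u. h (proj G u)) = (\<lambda>u. snd (anchor G (Z (proj G u))) h)"
    if "Z \<in> sec_E G" "h \<in> Cinf_M G" for Z h
    using L_act_pull[OF proj_overD(1)[OF H_hat[OF that(1)]] that(2)] proj_overD(3)[OF H_hat[OF that(1)]] by auto
  note b = proj_over_br[OF H_hat[OF X] H_hat[OF Y]]
  have "snd (anchor G (lbr G X Y p)) f = L_act (br (H (hat G X)) (H (hat G Y))) ?f v"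
    using L_act_pull[OF proj_overD(1)[OF b] f, of v] proj_overD(3)[OF b, of v] v by simp
  also have "\<dots> = L_act (H (hat G X)) (L_act (H (hat G Y)) ?f) v - L_act (H (hat G Y)) (L_act (H (hat G X)) ?f) v"
    by (rule L_act_br[OF H_hat[OF X] H_hat[OF Y] pull[OF f]])
  also have "\<dots> = snd (anchor G (X p)) (\<lambda>q. snd (anchor G (Y q)) f) - snd (anchor G (Y p)) (\<lambda>q. snd (anchor G (X q)) f)"
    unfolding act[OF X f] act[OF Y f]
      act[OF X anchor_sec_smooth[OF Y f]] act[OF Y anchor_sec_smooth[OF X f]] v ..
  finally show ?thesis .
qed

text \<open>The complete lift differs from the horizontal lift \<open>\<H>(\<eta>)\<close> by the vertical section determined by
  \<open>g \<mapsto> \<L>\<^sub>\<eta> g - \<H>(\<eta>) g\<close>.\<close>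
lemma complete_lift_exists:
  assumes \<eta>: "\<eta> \<in> sec_E G"
  shows "\<exists>Z. proj_over Z \<eta> \<and> (\<forall>g\<in>lin_funs G. L_act Z g = lie_lin \<eta> g)"
proof -
  let ?H = "H (hat G \<eta>)"
  note po = H_hat[OF \<eta>] and h = proj_overD(1)[OF H_hat[OF \<eta>]]
  define c where "c g u = lie_lin \<eta> g u - L_act ?H g u" for g u
  have sm: "c g \<in> Cinf_E G" if "g \<in> lin_funs G" for g
    unfolding c_def
    by (intro E.smooth_funs_diff lin_smooth[OF lie_lin_in[OF \<eta> that]] L_act_smooth[OF h lin_smooth[OF that]])
  have lin: "linear_at_lin u (\<lambda>g. c g u)" for u
    unfolding linear_at_lin_def
  proof (intro conjI ballI)
    fix g g' assume gg: "g \<in> lin_funs G" "g' \<in> lin_funs G"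
    show "c (\<lambda>v. g v + g' v) u = c g u + c g' u"
      unfolding c_def lie_lin_add[OF \<eta> gg] L_act_sum[OF h lin_smooth[OF gg(1)] lin_smooth[OF gg(2)]] by simp
  next
    fix f g assume f: "f \<in> Cinf_M G" and g: "g \<in> lin_funs G"
    show "c (\<lambda>v. f (proj G v) * g v) u = f (proj G u) * c g u"
      unfolding c_def lie_lin_mult[OF \<eta> f g] L_act_mult[OF h pull[OF f] lin_smooth[OF g]]
        L_act_pull[OF h f] proj_overD(3)[OF po] by (simp add: algebra_simps)
  qed
  obtain w where w: "w \<in> sec_pb G" "\<forall>g\<in>lin_funs G. \<forall>u. g (snd (w u)) = c g u"
    using pb_reconstruct[of c, OF sm lin] by blast
  let ?Z = "L_add G ?H (i_map G \<circ> w)"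
  have Z: "?Z \<in> sec_L G" by (rule L_add_in[OF h i_in[OF w(1)]])
  have "fst (?Z v) = \<eta> (proj G v)" for v
  proof (rule lin_sep)
    show "proj G (fst (?Z v)) = proj G (\<eta> (proj G v))" using sec_L_proj[OF Z] \<eta> by simp
    show "g (fst (?Z v)) = g (\<eta> (proj G v))" if g: "g \<in> lin_funs G" for g
      unfolding L_add_fst[OF g h i_in[OF w(1)]] i_lin_fst[OF w(1) g] proj_overD(3)[OF po] by simp
  qed
  moreover have "L_act ?Z g = lie_lin \<eta> g" if g: "g \<in> lin_funs G" for g
    unfolding fun_eq_iff L_add_act i_act[OF w(1) g] using bspec[OF w(2) g] by (simp add: c_def)
  ultimately show ?thesis using Z \<eta> unfolding proj_over_def by blast
qed

text \<open>Uniqueness for the \<open>THE\<close> holds because the conditions fix the action on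
  linear functions and on \<open>f \<circ> \<pi>\<close>, which together separate tangent
  vectors.\<close>

lemma complete_lift:
  assumes \<eta>: "\<eta> \<in> sec_E G"
  shows complete_lift_proj_over: "proj_over (complete_lift G \<eta>) \<eta>"
    and complete_lift_lin: "g \<in> lin_funs G \<Longrightarrow> L_act (complete_lift G \<eta>) g = lie_lin \<eta> g"
proof -
  obtain Z where Z: "proj_over Z \<eta>" "\<forall>g\<in>lin_funs G. L_act Z g = lie_lin \<eta> g"
    using complete_lift_exists[OF \<eta>] by blast
  note ZL = proj_overD(1)[OF Z(1)]
  let ?P = "\<lambda>Z. Z \<in> vector_fields (total_atlas G) \<and> related_to_anchor G Z \<eta> \<and>
     (\<forall>\<theta>\<in>sec_dual G. \<forall>u. snd (Z u) (fun_hat G \<theta>) = fun_hat G (dual_lie_deriv G \<eta> \<theta>) u)"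
  have rel: "related_to_anchor G (\<lambda>v. snd (Z v)) \<eta>"
    unfolding related_to_anchor_def using sec_L_pushforward[OF ZL] proj_overD(3)[OF Z(1)] by simp
  have act: "snd (snd (Z u)) (fun_hat G \<theta>) = fun_hat G (dual_lie_deriv G \<eta> \<theta>) u"
    if \<theta>: "\<theta> \<in> sec_dual G" for \<theta> u
    unfolding dual_lie_deriv_eq[OF \<eta> \<theta>] using Z(2) sec_dual_lin_funs[OF \<theta>] unfolding L_act_def by metis
  have "complete_lift_field G \<eta> = (\<lambda>v. snd (Z v))"
    unfolding complete_lift_field_def
  proof (rule the_equality)
    show "?P (\<lambda>v. snd (Z v))" using sec_L_vector_field[OF ZL] rel act by blast
    fix Y assume Y: "?P Y"
    show "Y = (\<lambda>v. snd (Z v))"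
    proof
      fix u
      show "Y u = snd (Z u)"
      proof (rule tangent_sep[OF _ sec_L_tangent[OF ZL]])
        show "Y u \<in> tangent_space (total_atlas G) u" using Y unfolding vector_fields_def by blast
        have pf: "pushforward (base_atlas G) (proj G) (Y u) = pushforward (base_atlas G) (proj G) (snd (Z u))"
          using Y rel unfolding related_to_anchor_def by metis
        show "snd (Y u) (\<lambda>w. f (proj G w)) = snd (snd (Z u)) (\<lambda>w. f (proj G w))" if "f \<in> Cinf_M G" for f
          using arg_cong[OF pf, of "\<lambda>z. snd z f"] that by (simp add: pushforward_def o_def)
        show "snd (Y u) g = snd (snd (Z u)) g" if "g \<in> lin_funs G" for g
        proof -
          have "fun_hat G (\<lambda>_. g) = g" by (simp add: fun_hat_def)
          then show ?thesis using Y act[OF lin_funs_sec_dual[OF that]] lin_funs_sec_dual[OF that] by metis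
        qed
      qed
    qed
  qed
  then have "complete_lift G \<eta> = Z"
    unfolding complete_lift_def using proj_overD(3)[OF Z(1)] by (simp add: prod_eq_iff fun_eq_iff)
  then show "proj_over (complete_lift G \<eta>) \<eta>" "g \<in> lin_funs G \<Longrightarrow> L_act (complete_lift G \<eta>) g = lie_lin \<eta> g"
    using Z by simp_all
qed

lemma complete_lift_pull:
  "\<eta> \<in> sec_E G \<Longrightarrow> f \<in> Cinf_M G \<Longrightarrow>
    L_act (complete_lift G \<eta>) (\<lambda>u. f (proj G u)) v = snd (anchor G (\<eta> (proj G v))) f"
  using L_act_pull[OF proj_overD(1)[OF complete_lift_proj_over], of \<eta> f v]
    proj_overD(3)[OF complete_lift_proj_over, of \<eta> v] by simp

text \<open>The vertical lift of \<open>X\<close> turns a linear \<open>g\<close> into the base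
  function \<open>g(X)\<close>, so the bracket acts on \<open>g\<close> by
  \<open>\<rho>(\<eta>)(g(X)) - (\<L>\<^sub>\<eta> g)(X) = g([\<eta>, X])\<close>.\<close>

lemma br_complete_vertical:
  assumes \<eta>: "\<eta> \<in> sec_E G" and X: "X \<in> sec_E G"
  shows "br (complete_lift G \<eta>) (i_map G \<circ> hat G X) = i_map G \<circ> hat G (lbr G \<eta> X)"
proof (rule sec_L_eqI)
  note c = complete_lift_proj_over[OF \<eta>] and v = proj_over_i[OF hat_in[OF X]] and b = lbr_in[OF \<eta> X]
  note po = proj_over_br[OF c v]
  show "br (complete_lift G \<eta>) (i_map G \<circ> hat G X) \<in> sec_L G" by (rule proj_overD(1)[OF po])
  show "i_map G \<circ> hat G (lbr G \<eta> X) \<in> sec_L G" by (rule i_in[OF hat_in[OF b]])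
  fix g u assume g: "g \<in> lin_funs G"
  show "g (fst (br (complete_lift G \<eta>) (i_map G \<circ> hat G X) u)) = g (fst ((i_map G \<circ> hat G (lbr G \<eta> X)) u))"
    unfolding proj_overD(3)[OF po] lbr_zero[OF \<eta>] i_lin_fst[OF hat_in[OF b] g] using g by simp
  have XV: "L_act (i_map G \<circ> hat G X) h = (\<lambda>v. h (X (proj G v)))" if "h \<in> lin_funs G" for h
    using i_act[OF hat_in[OF X] that] by auto
  show "L_act (br (complete_lift G \<eta>) (i_map G \<circ> hat G X)) g u = L_act (i_map G \<circ> hat G (lbr G \<eta> X)) g u"
    unfolding L_act_br[OF c v lin_smooth[OF g]] XV[OF g] complete_lift_lin[OF \<eta> g]
      XV[OF lie_lin_in[OF \<eta> g]] complete_lift_pull[OF \<eta> sec_E_smooth[OF X lin_smooth[OF g]]]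
      i_act[OF hat_in[OF b] g] lie_lin_sec[OF \<eta> g X] lie_fun_def by simp
qed

text \<open>On linear functions this is the commutator rule for \<open>\<L>\<^sub>\<eta>\<close> and
  \<open>\<L>\<^sub>Y\<close>. The mixed terms cancel; what is left is \<open>anchor_hom\<close> for
  the derivative terms and the Jacobi identity on \<open>E\<close> for the bracket terms.\<close>

lemma br_complete_complete:
  assumes \<eta>: "\<eta> \<in> sec_E G" and Y: "Y \<in> sec_E G"
  shows "br (complete_lift G \<eta>) (complete_lift G Y) = complete_lift G (lbr G \<eta> Y)"
proof (rule sec_L_eqI)
  note c = complete_lift_proj_over[OF \<eta>] and d = complete_lift_proj_over[OF Y] and b = lbr_in[OF \<eta> Y]
  note po = proj_over_br[OF c d] and po' = complete_lift_proj_over[OF b]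
  show "br (complete_lift G \<eta>) (complete_lift G Y) \<in> sec_L G" by (rule proj_overD(1)[OF po])
  show "complete_lift G (lbr G \<eta> Y) \<in> sec_L G" by (rule proj_overD(1)[OF po'])
  fix g u assume g: "g \<in> lin_funs G"
  show "g (fst (br (complete_lift G \<eta>) (complete_lift G Y) u)) = g (fst (complete_lift G (lbr G \<eta> Y) u))"
    unfolding proj_overD(3)[OF po] proj_overD(3)[OF po'] ..
  \<comment> \<open>The formula for \<open>lie_lin\<close> is available at values of sections, so
    the point \<open>u\<close> is written as such a value.\<close>
  obtain \<xi> where \<xi>: "\<xi> \<in> sec_E G" "\<xi> (proj G u) = u" using sec_through by blast
  let ?p = "proj G u"
  have gs: "(\<lambda>q. g (X q)) \<in> Cinf_M G" if "X \<in> sec_E G" for X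
    by (rule sec_E_smooth[OF that lin_smooth[OF g]])
  have adiff: "snd (anchor G w) (\<lambda>q. f q - h q) = snd (anchor G w) f - snd (anchor G w) h"
    if "f \<in> Cinf_M G" "h \<in> Cinf_M G" for f h w
  proof -
    have "snd (anchor G w) (\<lambda>q. (f q - h q) + h q) = snd (anchor G w) (\<lambda>q. f q - h q) + snd (anchor G w) h"
      by (rule anchor_rules(2)[OF M.smooth_funs_diff[OF that] that(2)])
    then show ?thesis by simp
  qed
  have LL: "lie_lin A (lie_lin B g) (\<xi> ?p) =
      snd (anchor G (A ?p)) (\<lambda>q. snd (anchor G (B q)) (\<lambda>q. g (\<xi> q))) - snd (anchor G (A ?p)) (\<lambda>q. g (lbr G B \<xi> q))
      - (snd (anchor G (B ?p)) (\<lambda>q. g (lbr G A \<xi> q)) - g (lbr G B (lbr G A \<xi>) ?p))"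
    if A: "A \<in> sec_E G" and B: "B \<in> sec_E G" for A B
  proof -
    have "lie_lin A (lie_lin B g) (\<xi> ?p) =
        snd (anchor G (A ?p)) (\<lambda>q. lie_lin B g (\<xi> q)) - lie_lin B g (lbr G A \<xi> ?p)"
      unfolding lie_lin_sec[OF A lie_lin_in[OF B g] \<xi>(1)] lie_fun_def ..
    also have "(\<lambda>q. lie_lin B g (\<xi> q)) = (\<lambda>q. snd (anchor G (B q)) (\<lambda>q. g (\<xi> q)) - g (lbr G B \<xi> q))"
      unfolding lie_lin_sec[OF B g \<xi>(1)] lie_fun_def ..
    also have "lie_lin B g (lbr G A \<xi> ?p) = snd (anchor G (B ?p)) (\<lambda>q. g (lbr G A \<xi> q)) - g (lbr G B (lbr G A \<xi>) ?p)"
      unfolding lie_lin_sec[OF B g lbr_in[OF A \<xi>(1)]] lie_fun_def ..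
    also have "snd (anchor G (A ?p)) (\<lambda>q. snd (anchor G (B q)) (\<lambda>q. g (\<xi> q)) - g (lbr G B \<xi> q)) =
        snd (anchor G (A ?p)) (\<lambda>q. snd (anchor G (B q)) (\<lambda>q. g (\<xi> q))) - snd (anchor G (A ?p)) (\<lambda>q. g (lbr G B \<xi> q))"
      by (rule adiff[OF anchor_sec_smooth[OF B gs[OF \<xi>(1)]] gs[OF lbr_in[OF B \<xi>(1)]]])
    finally show ?thesis .
  qed
  have jac: "g (lbr G \<eta> (lbr G Y \<xi>) ?p) = g (lbr G (lbr G \<eta> Y) \<xi> ?p) + g (lbr G Y (lbr G \<eta> \<xi>) ?p)"
    unfolding lbr_jacobi[OF \<eta> Y \<xi>(1)] by (rule lin_fadd[OF g]) (simp add: \<eta> Y \<xi>(1) lbr_in)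
  have "L_act (br (complete_lift G \<eta>) (complete_lift G Y)) g (\<xi> ?p) = lie_lin (lbr G \<eta> Y) g (\<xi> ?p)"
    unfolding L_act_br[OF c d lin_smooth[OF g]] complete_lift_lin[OF \<eta> g] complete_lift_lin[OF Y g]
      complete_lift_lin[OF \<eta> lie_lin_in[OF Y g]] complete_lift_lin[OF Y lie_lin_in[OF \<eta> g]]
      LL[OF \<eta> Y] LL[OF Y \<eta>] lie_lin_sec[OF b g \<xi>(1)] lie_fun_def
    using jac anchor_hom[OF \<eta> Y gs[OF \<xi>(1)], of ?p] by simp
  then show "L_act (br (complete_lift G \<eta>) (complete_lift G Y)) g u = L_act (complete_lift G (lbr G \<eta> Y)) g u"
    unfolding complete_lift_lin[OF b g] \<xi>(2) .
qed

section \<open>The Berwald curvature\<close>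

lemma hat_pb_rules:
  shows i_hat_add: "X \<in> sec_E G \<Longrightarrow> Y \<in> sec_E G \<Longrightarrow>
      i_map G \<circ> hat G (\<lambda>p. fadd G (X p) (Y p)) = L_add G (i_map G \<circ> hat G X) (i_map G \<circ> hat G Y)"
    and i_hat_smul: "f \<in> Cinf_M G \<Longrightarrow> X \<in> sec_E G \<Longrightarrow>
      i_map G \<circ> hat G (\<lambda>p. fscale G (f p) (X p)) = L_smul G (\<lambda>u. f (proj G u)) (i_map G \<circ> hat G X)"
    and H_hat_add: "X \<in> sec_E G \<Longrightarrow> Y \<in> sec_E G \<Longrightarrow>
      H (hat G (\<lambda>p. fadd G (X p) (Y p))) = L_add G (H (hat G X)) (H (hat G Y))"
    and H_hat_smul: "f \<in> Cinf_M G \<Longrightarrow> X \<in> sec_E G \<Longrightarrow>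
      H (hat G (\<lambda>p. fscale G (f p) (X p))) = L_smul G (\<lambda>u. f (proj G u)) (H (hat G X))"
  unfolding hat_add hat_smul by (rule i_add i_smul H_add H_smul; (intro hat_in pull)?; assumption)+

text \<open>The \<open>g\<close>-component of the Berwald curvature on basic sections.\<close>
definition curv :: "('e \<Rightarrow> real) \<Rightarrow> ('m \<Rightarrow> 'e) \<Rightarrow> ('m \<Rightarrow> 'e) \<Rightarrow> ('m \<Rightarrow> 'e) \<Rightarrow> 'e \<Rightarrow> real" where
  "curv g X Y Z = L_act (i_map G \<circ> hat G X) (L_act (br (H (hat G Y)) (i_map G \<circ> hat G Z)) g)"

lemma curv_nabla:
  assumes X: "X \<in> sec_E G" and Y: "Y \<in> sec_E G" and Z: "Z \<in> sec_E G" and g: "g \<in> lin_funs G"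
  shows "g (snd (nabla_v G br (hat G X) (nabla_h G br H (hat G Y) (hat G Z)) u)) = curv g X Y Z u"
proof -
  note n = nabla_h_in[OF Y hat_in[OF Z]]
  have "(\<lambda>v. g (snd (nabla_h G br H (hat G Y) (hat G Z) v))) = L_act (br (H (hat G Y)) (i_map G \<circ> hat G Z)) g"
    unfolding i_nabla_h[OF Y hat_in[OF Z], symmetric] using i_act[OF n g] by auto
  then show ?thesis unfolding nabla_v_lin[OF hat_in[OF X] n g] curv_def by simp
qed

lemma br_H_i_in: "Y \<in> sec_E G \<Longrightarrow> z \<in> sec_pb G \<Longrightarrow> br (H (hat G Y)) (i_map G \<circ> z) \<in> sec_L G"
  by (intro br_in H_in i_in hat_in)

lemma curv_smooth:
  assumes X: "X \<in> sec_E G" and Y: "Y \<in> sec_E G" and Z: "Z \<in> sec_E G" and g: "g \<in> lin_funs G"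
  shows "curv g X Y Z \<in> Cinf_E G"
  unfolding curv_def
  by (intro L_act_smooth i_in hat_in X br_H_i_in Y Z lin_smooth[OF g])

lemma curv_linear_E1: "linear_at_E (proj G u) (\<lambda>X. curv g X Y Z u)"
  unfolding linear_at_E_def curv_def by (simp add: i_hat_add i_hat_smul L_eval)

text \<open>Passing from \<open>Y\<close> to \<open>f Y\<close> produces only derivatives of
  \<open>f \<circ> \<pi>\<close> along the vertical lifts of \<open>Z\<close> and \<open>X\<close>,
  and these are zero.\<close>

lemma curv_linear_E2:
  assumes X: "X \<in> sec_E G" and Z: "Z \<in> sec_E G" and g: "g \<in> lin_funs G"
  shows "linear_at_E (proj G u) (\<lambda>Y. curv g X Y Z u)"
proof -
  note iX = i_in[OF hat_in[OF X]] and iZ = i_in[OF hat_in[OF Z]]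
  have s: "L_act (br (H (hat G Y)) (i_map G \<circ> hat G Z)) g \<in> Cinf_E G" if "Y \<in> sec_E G" for Y
    by (rule L_act_smooth[OF br_H_i_in[OF that hat_in[OF Z]] lin_smooth[OF g]])
  show ?thesis
    unfolding linear_at_E_def
  proof (intro conjI ballI)
    fix Y Y' assume Y: "Y \<in> sec_E G" "Y' \<in> sec_E G"
    have "L_act (br (H (hat G (\<lambda>p. fadd G (Y p) (Y' p)))) (i_map G \<circ> hat G Z)) g =
      (\<lambda>v. L_act (br (H (hat G Y)) (i_map G \<circ> hat G Z)) g v + L_act (br (H (hat G Y')) (i_map G \<circ> hat G Z)) g v)"
      unfolding H_hat_add[OF Y] br_add_left[OF iZ H_in[OF hat_in[OF Y(1)]] H_in[OF hat_in[OF Y(2)]]]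
      by (rule ext) (simp add: L_eval)
    then show "curv g X (\<lambda>p. fadd G (Y p) (Y' p)) Z u = curv g X Y Z u + curv g X Y' Z u"
      unfolding curv_def using L_act_sum[OF iX s[OF Y(1)] s[OF Y(2)]] by simp
  next
    fix f Y assume f: "f \<in> Cinf_M G" and Y: "Y \<in> sec_E G"
    have z: "L_act (i_map G \<circ> hat G W) (\<lambda>v. f (proj G v)) v = 0" if "W \<in> sec_E G" for W v
      by (rule i_act_pull[OF hat_in[OF that] f])
    have "L_act (br (H (hat G (\<lambda>p. fscale G (f p) (Y p)))) (i_map G \<circ> hat G Z)) g =
      (\<lambda>v. f (proj G v) * L_act (br (H (hat G Y)) (i_map G \<circ> hat G Z)) g v)"
      unfolding H_hat_smul[OF f Y] br_leibniz_left[OF iZ H_in[OF hat_in[OF Y]] pull[OF f]]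
      by (rule ext) (simp add: L_eval z[OF Z] del: o_apply)
    then show "curv g X (\<lambda>p. fscale G (f p) (Y p)) Z u = f (proj G u) * curv g X Y Z u"
      unfolding curv_def using L_act_mult[OF iX pull[OF f] s[OF Y]] z[OF X] by simp
  qed
qed

text \<open>The horizontal derivative is not linear over functions in \<open>Z\<close>: it creates
  the term \<open>\<rho>(Y)(f) g(Z)\<close>. This term is a function of the base, and the outer
  vertical derivative kills it.\<close>

lemma curv_linear_E3:
  assumes X: "X \<in> sec_E G" and Y: "Y \<in> sec_E G" and g: "g \<in> lin_funs G"
  shows "linear_at_E (proj G u) (\<lambda>Z. curv g X Y Z u)"
proof -
  note iX = i_in[OF hat_in[OF X]] and hY = H_in[OF hat_in[OF Y]]
  have s: "L_act (br (H (hat G Y)) (i_map G \<circ> hat G Z)) g \<in> Cinf_E G" if "Z \<in> sec_E G" for Z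
    by (rule L_act_smooth[OF br_H_i_in[OF Y hat_in[OF that]] lin_smooth[OF g]])
  show ?thesis
    unfolding linear_at_E_def
  proof (intro conjI ballI)
    fix Z Z' assume Z: "Z \<in> sec_E G" "Z' \<in> sec_E G"
    have "L_act (br (H (hat G Y)) (i_map G \<circ> hat G (\<lambda>p. fadd G (Z p) (Z' p)))) g =
      (\<lambda>v. L_act (br (H (hat G Y)) (i_map G \<circ> hat G Z)) g v + L_act (br (H (hat G Y)) (i_map G \<circ> hat G Z')) g v)"
      unfolding i_hat_add[OF Z] br_add[OF hY i_in[OF hat_in[OF Z(1)]] i_in[OF hat_in[OF Z(2)]]]
      by (rule ext) (simp add: L_eval)
    then show "curv g X Y (\<lambda>p. fadd G (Z p) (Z' p)) u = curv g X Y Z u + curv g X Y Z' u"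
      unfolding curv_def using L_act_sum[OF iX s[OF Z(1)] s[OF Z(2)]] by simp
  next
    fix f Z assume f: "f \<in> Cinf_M G" and Z: "Z \<in> sec_E G"
    note iZ = i_in[OF hat_in[OF Z]]
    let ?f = "\<lambda>u. f (proj G u)" and ?a = "\<lambda>v. snd (anchor G (Y (proj G v))) f * g (Z (proj G v))"
    have a: "(\<lambda>p. snd (anchor G (Y p)) f * g (Z p)) \<in> Cinf_M G"
      by (intro M.smooth_funs_mult anchor_sec_smooth Y f sec_E_smooth[OF Z lin_smooth[OF g]])
    have z: "L_act (i_map G \<circ> hat G X) ?f u = 0" "L_act (i_map G \<circ> hat G X) ?a u = 0"
      using i_act_pull[OF hat_in[OF X] f] i_act_pull[OF hat_in[OF X] a] by simp_all
    have "L_act (br (H (hat G Y)) (i_map G \<circ> hat G (\<lambda>p. fscale G (f p) (Z p)))) g =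
      (\<lambda>v. ?f v * L_act (br (H (hat G Y)) (i_map G \<circ> hat G Z)) g v + ?a v)"
      unfolding i_hat_smul[OF f Z] br_leibniz[OF hY iZ pull[OF f]]
      by (rule ext) (simp add: L_eval L_act_pull[OF hY f] H_fst hat_in Y i_act[OF hat_in[OF Z] g] del: o_apply)
    then show "curv g X Y (\<lambda>p. fscale G (f p) (Z p)) u = f (proj G u) * curv g X Y Z u"
      unfolding curv_def
      using L_act_sum[OF iX E.smooth_funs_mult[OF pull[OF f] s[OF Z]] pull[OF a], of u]
        L_act_mult[OF iX pull[OF f] s[OF Z], of u] z by simp
  qed
qed

text \<open>The inner bracket is vertical, so it and the vertical lift of \<open>X\<close> both
  annihilate \<open>f \<circ> \<pi>\<close>. This allows the values to be assembled into a
  section.\<close>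

lemma curv_linear_lin:
  assumes X: "X \<in> sec_E G" and Y: "Y \<in> sec_E G" and Z: "Z \<in> sec_E G"
  shows "linear_at_lin u (\<lambda>g. curv g X Y Z u)"
proof -
  note iX = i_in[OF hat_in[OF X]] and b = br_H_i_in[OF Y hat_in[OF Z]]
  let ?b = "br (H (hat G Y)) (i_map G \<circ> hat G Z)"
  obtain w where w: "w \<in> sec_pb G" "?b = i_map G \<circ> w"
    using br_vertical[OF H_hat[OF Y] hat_in[OF Z]] by blast
  have s: "L_act ?b g \<in> Cinf_E G" if "g \<in> lin_funs G" for g by (rule L_act_smooth[OF b lin_smooth[OF that]])
  show ?thesis
    unfolding linear_at_lin_def
  proof (intro conjI ballI)
    fix g g' assume g: "g \<in> lin_funs G" "g' \<in> lin_funs G"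
    have "L_act ?b (\<lambda>v. g v + g' v) = (\<lambda>v. L_act ?b g v + L_act ?b g' v)"
      by (rule ext) (rule L_act_sum[OF b lin_smooth[OF g(1)] lin_smooth[OF g(2)]])
    then show "curv (\<lambda>v. g v + g' v) X Y Z u = curv g X Y Z u + curv g' X Y Z u"
      unfolding curv_def using L_act_sum[OF iX s[OF g(1)] s[OF g(2)]] by simp
  next
    fix f g assume f: "f \<in> Cinf_M G" and g: "g \<in> lin_funs G"
    have "L_act ?b (\<lambda>v. f (proj G v)) v = 0" for v unfolding w(2) by (rule i_act_pull[OF w(1) f])
    then have "L_act ?b (\<lambda>v. f (proj G v) * g v) = (\<lambda>v. f (proj G v) * L_act ?b g v)"
      using L_act_mult[OF b pull[OF f] lin_smooth[OF g]] by auto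
    then show "curv (\<lambda>v. f (proj G v) * g v) X Y Z u = f (proj G u) * curv g X Y Z u"
      unfolding curv_def using L_act_mult[OF iX pull[OF f] s[OF g]] i_act_pull[OF hat_in[OF X] f] by simp
  qed
qed

text \<open>The slots are extended one at a time, beginning with the last; the digit counts the
  slots that still hold sections of \<open>E\<close>.\<close>

definition curv2 where "curv2 g z X Y = ext_pb (\<lambda>Z. curv g X Y Z) z"
definition curv1 where "curv1 g y z X = ext_pb (\<lambda>Y. curv2 g z X Y) y"
definition curv0 where "curv0 g x y z = ext_pb (\<lambda>X. curv1 g y z X) x"

lemma curv_pull_linear:
  "X \<in> sec_E G \<Longrightarrow> Y \<in> sec_E G \<Longrightarrow> g \<in> lin_funs G \<Longrightarrow> pull_linear (\<lambda>Z. curv g X Y Z)"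
  unfolding pull_linear_def by (simp add: curv_smooth curv_linear_E3)

lemma curv2_pull_linear:
  assumes X: "X \<in> sec_E G" and z: "z \<in> sec_pb G" and g: "g \<in> lin_funs G"
  shows "pull_linear (\<lambda>Y. curv2 g z X Y)"
proof -
  have "linear_at_E (proj G u) (\<lambda>Y. curv2 g z X Y u)" for u
    unfolding linear_at_E_def curv2_def
  proof (intro conjI ballI)
    show "ext_pb (\<lambda>Z. curv g X (\<lambda>q. fadd G (Y q) (Y' q)) Z) z u = ext_pb (\<lambda>Z. curv g X Y Z) z u + ext_pb (\<lambda>Z. curv g X Y' Z) z u"
      if "Y \<in> sec_E G" "Y' \<in> sec_E G" for Y Y'
      by (rule ext_pb_add) (rule linear_at_E_add[OF curv_linear_E2[OF X _ g] that])
    show "ext_pb (\<lambda>Z. curv g X (\<lambda>q. fscale G (f q) (Y q)) Z) z u = f (proj G u) * ext_pb (\<lambda>Z. curv g X Y Z) z u"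
      if "f \<in> Cinf_M G" "Y \<in> sec_E G" for f Y
      by (rule ext_pb_mult) (rule linear_at_E_smul[OF curv_linear_E2[OF X _ g] that])
  qed
  moreover have "curv2 g z X Y \<in> Cinf_E G" if "Y \<in> sec_E G" for Y
    unfolding curv2_def by (rule ext_pb_smooth[OF curv_pull_linear[OF X that g] z])
  ultimately show ?thesis unfolding pull_linear_def by blast
qed

lemma curv1_pull_linear:
  assumes y: "y \<in> sec_pb G" and z: "z \<in> sec_pb G" and g: "g \<in> lin_funs G"
  shows "pull_linear (\<lambda>X. curv1 g y z X)"
proof -
  have "linear_at_E (proj G u) (\<lambda>X. curv1 g y z X u)" for u
    unfolding linear_at_E_def curv1_def
  proof (intro conjI ballI)
    show "ext_pb (\<lambda>Y. curv2 g z (\<lambda>q. fadd G (X q) (X' q)) Y) y u = ext_pb (\<lambda>Y. curv2 g z X Y) y u + ext_pb (\<lambda>Y. curv2 g z X' Y) y u"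
      if "X \<in> sec_E G" "X' \<in> sec_E G" for X X'
      unfolding curv2_def
      by (rule ext_pb_add, rule ext_pb_add) (rule linear_at_E_add[OF curv_linear_E1 that])
    show "ext_pb (\<lambda>Y. curv2 g z (\<lambda>q. fscale G (f q) (X q)) Y) y u = f (proj G u) * ext_pb (\<lambda>Y. curv2 g z X Y) y u"
      if "f \<in> Cinf_M G" "X \<in> sec_E G" for f X
      unfolding curv2_def
      by (rule ext_pb_mult, rule ext_pb_mult) (rule linear_at_E_smul[OF curv_linear_E1 that])
  qed
  moreover have "curv1 g y z X \<in> Cinf_E G" if "X \<in> sec_E G" for X
    unfolding curv1_def by (rule ext_pb_smooth[OF curv2_pull_linear[OF that z g] y])
  ultimately show ?thesis unfolding pull_linear_def by blast
qed

lemma curv0_hat: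
  assumes X: "X \<in> sec_E G" and Y: "Y \<in> sec_E G" and Z: "Z \<in> sec_E G" and g: "g \<in> lin_funs G"
  shows "curv0 g (hat G X) (hat G Y) (hat G Z) u = curv g X Y Z u"
  unfolding curv0_def ext_pb_hat[OF curv1_pull_linear[OF hat_in[OF Y] hat_in[OF Z] g] X]
    curv1_def ext_pb_hat[OF curv2_pull_linear[OF X hat_in[OF Z] g] Y]
    curv2_def ext_pb_hat[OF curv_pull_linear[OF X Y g] Z] ..

lemma curv0_linear:
  "linear_at_pb u (\<lambda>x. curv0 g x y z u)" "linear_at_pb u (\<lambda>y. curv0 g x y z u)" "linear_at_pb u (\<lambda>z. curv0 g x y z u)"
proof -
  show "linear_at_pb u (\<lambda>x. curv0 g x y z u)" unfolding curv0_def by (rule ext_pb_linear)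
  show "linear_at_pb u (\<lambda>y. curv0 g x y z u)"
    unfolding linear_at_pb_def curv0_def curv1_def
    by (intro conjI ballI ext_pb_add ext_pb_mult)
      (rule linear_at_pb_add[OF ext_pb_linear] linear_at_pb_smul[OF ext_pb_linear]; assumption)+
  show "linear_at_pb u (\<lambda>z. curv0 g x y z u)"
    unfolding linear_at_pb_def curv0_def curv1_def curv2_def
    by (intro conjI ballI ext_pb_add ext_pb_mult)
      (rule linear_at_pb_add[OF ext_pb_linear] linear_at_pb_smul[OF ext_pb_linear]; assumption)+
qed

lemma curv0_linear_lin: "linear_at_lin u (\<lambda>g. curv0 g x y z u)"
  unfolding linear_at_lin_def curv0_def curv1_def curv2_def
  by (intro conjI ballI ext_pb_add ext_pb_mult)
    (rule linear_at_lin_add[OF curv_linear_lin] linear_at_lin_mult[OF curv_linear_lin]; assumption)+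

lemma curv0_smooth:
  "x \<in> sec_pb G \<Longrightarrow> y \<in> sec_pb G \<Longrightarrow> z \<in> sec_pb G \<Longrightarrow> g \<in> lin_funs G \<Longrightarrow> curv0 g x y z \<in> Cinf_E G"
  unfolding curv0_def by (rule ext_pb_smooth[OF curv1_pull_linear])

section \<open>Tensors of type (1,3) and existence of the Berwald curvature\<close>

lemma length3E:
  assumes "length xs = 3" obtains x y z where "xs = [x, y, z]"
  using assms by (auto simp: numeral_3_eq_3 length_Suc_conv)

lemma is_tensor3I:
  assumes "\<And>x y z. x \<in> sec_pb G \<Longrightarrow> y \<in> sec_pb G \<Longrightarrow> z \<in> sec_pb G \<Longrightarrow> B [x, y, z] \<in> sec_pb G"
    and "\<And>u g y z. g \<in> lin_funs G \<Longrightarrow> y \<in> sec_pb G \<Longrightarrow> z \<in> sec_pb G \<Longrightarrow> linear_at_pb u (\<lambda>x. g (snd (B [x, y, z] u)))"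
    and "\<And>u g x z. g \<in> lin_funs G \<Longrightarrow> x \<in> sec_pb G \<Longrightarrow> z \<in> sec_pb G \<Longrightarrow> linear_at_pb u (\<lambda>y. g (snd (B [x, y, z] u)))"
    and "\<And>u g x y. g \<in> lin_funs G \<Longrightarrow> x \<in> sec_pb G \<Longrightarrow> y \<in> sec_pb G \<Longrightarrow> linear_at_pb u (\<lambda>z. g (snd (B [x, y, z] u)))"
  shows "is_tensor1 G 3 B"
proof -
  have hom: "module_hom (Cinf_E G) (sec_pb G) (pb_add G) (pb_smul G) (sec_pb G) (pb_add G) (pb_smul G) F"
    if in': "\<And>x. x \<in> sec_pb G \<Longrightarrow> F x \<in> sec_pb G"
      and l: "\<And>u g. g \<in> lin_funs G \<Longrightarrow> linear_at_pb u (\<lambda>x. g (snd (F x u)))" for F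
    unfolding module_hom_def
  proof (intro conjI ballI)
    fix x y assume xy: "x \<in> sec_pb G" "y \<in> sec_pb G"
    show "F (pb_add G x y) = pb_add G (F x) (F y)"
    proof (rule sec_pb_eqI)
      fix g u assume g: "g \<in> lin_funs G"
      show "g (snd (F (pb_add G x y) u)) = g (snd (pb_add G (F x) (F y) u))"
        unfolding lin_pb_add[OF g in'[OF xy(1)] in'[OF xy(2)]] by (rule linear_at_pb_add[OF l[OF g] xy])
    qed (intro in' pb_add_in xy)+
  next
    fix f x assume fx: "f \<in> Cinf_E G" "x \<in> sec_pb G"
    show "F (pb_smul G f x) = pb_smul G f (F x)"
    proof (rule sec_pb_eqI)
      fix g u assume g: "g \<in> lin_funs G"
      show "g (snd (F (pb_smul G f x) u)) = g (snd (pb_smul G f (F x) u))"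
        unfolding lin_pb_smul[OF g] by (rule linear_at_pb_smul[OF l[OF g] fx])
    qed (intro in' pb_smul_in fx)+
  qed (rule in')
  show ?thesis
    unfolding is_tensor1_def
  proof (intro allI impI)
    fix xs :: "('e \<Rightarrow> 'e \<times> 'e) list" assume xs: "length xs = 3 \<and> set xs \<subseteq> sec_pb G"
    then obtain x y z where [simp]: "xs = [x, y, z]" using length3E by blast
    have in': "x \<in> sec_pb G" "y \<in> sec_pb G" "z \<in> sec_pb G" using xs by auto
    have "module_hom (Cinf_E G) (sec_pb G) (pb_add G) (pb_smul G) (sec_pb G) (pb_add G) (pb_smul G) (\<lambda>w. B (xs[i := w]))"
      if "i < 3" for i
    proof -
      consider "i = 0" | "i = 1" | "i = 2" using \<open>i < 3\<close> by linarith
      then show ?thesis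
        by cases (simp_all add: numeral_2_eq_2 hom assms in')
    qed
    then show "B xs \<in> sec_pb G \<and> (\<forall>i<3. module_hom (Cinf_E G) (sec_pb G) (pb_add G) (pb_smul G)
        (sec_pb G) (pb_add G) (pb_smul G) (\<lambda>w. B (xs[i := w])))"
      using assms(1)[OF in'] by simp
  qed
qed

lemma is_tensor3D:
  assumes B: "is_tensor1 G 3 B" and in': "x \<in> sec_pb G" "y \<in> sec_pb G" "z \<in> sec_pb G"
  shows is_tensor3_in: "B [x, y, z] \<in> sec_pb G"
    and is_tensor3_add:
      "w \<in> sec_pb G \<Longrightarrow> B [pb_add G x w, y, z] = pb_add G (B [x, y, z]) (B [w, y, z])"
      "w \<in> sec_pb G \<Longrightarrow> B [x, pb_add G y w, z] = pb_add G (B [x, y, z]) (B [x, w, z])"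
      "w \<in> sec_pb G \<Longrightarrow> B [x, y, pb_add G z w] = pb_add G (B [x, y, z]) (B [x, y, w])"
    and is_tensor3_smul:
      "f \<in> Cinf_E G \<Longrightarrow> B [pb_smul G f x, y, z] = pb_smul G f (B [x, y, z])"
      "f \<in> Cinf_E G \<Longrightarrow> B [x, pb_smul G f y, z] = pb_smul G f (B [x, y, z])"
      "f \<in> Cinf_E G \<Longrightarrow> B [x, y, pb_smul G f z] = pb_smul G f (B [x, y, z])"
proof -
  have *: "B [x, y, z] \<in> sec_pb G \<and> (\<forall>i<3. module_hom (Cinf_E G) (sec_pb G) (pb_add G) (pb_smul G)
        (sec_pb G) (pb_add G) (pb_smul G) (\<lambda>w. B ([x, y, z][i := w])))"
    using B[unfolded is_tensor1_def, rule_format, of "[x, y, z]"] in' by simp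
  then show "B [x, y, z] \<in> sec_pb G" by blast
  have add: "B ([x, y, z][i := pb_add G v w]) = pb_add G (B ([x, y, z][i := v])) (B ([x, y, z][i := w]))"
    if "i < 3" "v \<in> sec_pb G" "w \<in> sec_pb G" for i v w
    using * that unfolding module_hom_def by blast
  have smul: "B ([x, y, z][i := pb_smul G f v]) = pb_smul G f (B ([x, y, z][i := v]))"
    if "i < 3" "f \<in> Cinf_E G" "v \<in> sec_pb G" for i f v
    using * that unfolding module_hom_def by blast
  show "B [pb_add G x w, y, z] = pb_add G (B [x, y, z]) (B [w, y, z])"
    "B [x, pb_add G y w, z] = pb_add G (B [x, y, z]) (B [x, w, z])"
    "B [x, y, pb_add G z w] = pb_add G (B [x, y, z]) (B [x, y, w])" if "w \<in> sec_pb G"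
    using add[of 0 x w] add[of 1 y w] add[of 2 z w] in' that by (simp_all add: numeral_2_eq_2)
  show "B [pb_smul G f x, y, z] = pb_smul G f (B [x, y, z])"
    "B [x, pb_smul G f y, z] = pb_smul G f (B [x, y, z])"
    "B [x, y, pb_smul G f z] = pb_smul G f (B [x, y, z])" if "f \<in> Cinf_E G"
    using smul[of 0 f x] smul[of 1 f y] smul[of 2 f z] in' that by (simp_all add: numeral_2_eq_2)
qed

text \<open>The correction term of the tensor derivation contains \<open>\<nabla>\<^sup>v\<close> of
  the basic section of \<open>Y\<close>, which is zero because \<open>g(Y)\<close> is constant along
  the fibres; \<open>nabla_h_zero\<close> then removes the term.\<close>

lemma berwald_hat:
  assumes X: "X \<in> sec_E G" and Y: "Y \<in> sec_E G" and Z: "Z \<in> sec_E G"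
  shows "nabla_v_tensor G br (nabla_h_sec G br H (hat G Z)) [hat G X, hat G Y] =
    nabla_v G br (hat G X) (nabla_h G br H (hat G Y) (hat G Z))"
proof -
  note x = hat_in[OF X] and y = hat_in[OF Y] and z = hat_in[OF Z]
  note n = nabla_v_in[OF x nabla_h_in[OF Y z]]
  have "nabla_v G br (hat G X) (hat G Y) = pb_zero G"
    by (rule sec_pb_eqI)
      (simp_all add: nabla_v_in x y pb_zero_in nabla_v_lin L_act_i_pull Y lin_pb_zero del: o_apply)
  then have "nabla_v_tensor G br (nabla_h_sec G br H (hat G Z)) [hat G X, hat G Y] =
    pb_add G (nabla_v G br (hat G X) (nabla_h G br H (hat G Y) (hat G Z)))
      (pb_smul G (\<lambda>_. - 1) (pb_add G (pb_zero G) (pb_zero G)))"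
    by (simp add: nabla_v_tensor_def tensor_deriv_def nabla_h_sec_def nabla_h_zero[OF z])
  also have "\<dots> = nabla_v G br (hat G X) (nabla_h G br H (hat G Y) (hat G Z))"
    by (rule sec_pb_eqI)
      (simp_all add: n pb_add_in pb_smul_in pb_zero_in E.smooth_funs_const lin_pb_add lin_pb_smul lin_pb_zero)
  finally show ?thesis .
qed

text \<open>Needed for the \<open>SOME\<close> in \<open>berwald_curvature\<close>, which then
  yields tensoriality and the values on basic sections; the main argument uses nothing else about
  \<open>\<B>\<close>.\<close>

lemma berwald_exists:
  "\<exists>B. is_tensor1 G 3 B \<and> (\<forall>X\<in>sec_E G. \<forall>Y\<in>sec_E G. \<forall>Z\<in>sec_E G.
    B [hat G X, hat G Y, hat G Z] = nabla_v_tensor G br (nabla_h_sec G br H (hat G Z)) [hat G X, hat G Y])"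
proof -
  have "\<exists>w\<in>sec_pb G. \<forall>g\<in>lin_funs G. \<forall>u. g (snd (w u)) = curv0 g x y z u"
    if "x \<in> sec_pb G" "y \<in> sec_pb G" "z \<in> sec_pb G" for x y z
    by (rule pb_reconstruct[of "\<lambda>g. curv0 g x y z", OF curv0_smooth[OF that] curv0_linear_lin])
  then obtain b where b: "\<And>x y z. x \<in> sec_pb G \<Longrightarrow> y \<in> sec_pb G \<Longrightarrow> z \<in> sec_pb G \<Longrightarrow> b x y z \<in> sec_pb G"
    "\<And>x y z g u. x \<in> sec_pb G \<Longrightarrow> y \<in> sec_pb G \<Longrightarrow> z \<in> sec_pb G \<Longrightarrow> g \<in> lin_funs G \<Longrightarrow>
      g (snd (b x y z u)) = curv0 g x y z u"
    by metis
  let ?B = "\<lambda>xs. b (xs ! 0) (xs ! 1) (xs ! 2)"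
  \<comment> \<open>The components of \<open>b\<close> are known only for arguments in
    \<open>sec_pb G\<close>, so linearity is transferred from \<open>curv0\<close> along agreement
    on that set.\<close>
  have cong: "linear_at_pb u \<Phi>" if "linear_at_pb u \<Psi>" "\<And>x. x \<in> sec_pb G \<Longrightarrow> \<Phi> x = \<Psi> x" for u \<Phi> \<Psi>
    using that unfolding linear_at_pb_def by (simp add: pb_add_in pb_smul_in)
  have "is_tensor1 G 3 ?B"
  proof (rule is_tensor3I)
    show "linear_at_pb u (\<lambda>x. g (snd (?B [x, y, z] u)))"
      if "g \<in> lin_funs G" "y \<in> sec_pb G" "z \<in> sec_pb G" for u g y z
      by (rule cong[OF curv0_linear(1)[of u g y z]]) (use that b(2) in simp)
    show "linear_at_pb u (\<lambda>y. g (snd (?B [x, y, z] u)))"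
      if "g \<in> lin_funs G" "x \<in> sec_pb G" "z \<in> sec_pb G" for u g x z
      by (rule cong[OF curv0_linear(2)[of u g x z]]) (use that b(2) in simp)
    show "linear_at_pb u (\<lambda>z. g (snd (?B [x, y, z] u)))"
      if "g \<in> lin_funs G" "x \<in> sec_pb G" "y \<in> sec_pb G" for u g x y
      by (rule cong[OF curv0_linear(3)[of u g x y]]) (use that b(2) in simp)
  qed (simp add: b(1))
  moreover have "?B [hat G X, hat G Y, hat G Z] =
      nabla_v_tensor G br (nabla_h_sec G br H (hat G Z)) [hat G X, hat G Y]"
    if X: "X \<in> sec_E G" and Y: "Y \<in> sec_E G" and Z: "Z \<in> sec_E G" for X Y Z
    unfolding berwald_hat[OF that]
  proof (rule sec_pb_eqI)
    note h = hat_in[OF X] hat_in[OF Y] hat_in[OF Z]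
    show "?B [hat G X, hat G Y, hat G Z] \<in> sec_pb G" using b(1)[OF h] by simp
    show "nabla_v G br (hat G X) (nabla_h G br H (hat G Y) (hat G Z)) \<in> sec_pb G"
      by (rule nabla_v_in[OF h(1) nabla_h_in[OF Y h(3)]])
    show "g (snd (?B [hat G X, hat G Y, hat G Z] u)) =
      g (snd (nabla_v G br (hat G X) (nabla_h G br H (hat G Y) (hat G Z)) u))" if "g \<in> lin_funs G" for g u
      using b(2)[OF h that] by (simp add: curv_nabla[OF X Y Z that] curv0_hat[OF X Y Z that])
  qed
  ultimately show ?thesis by (intro exI[of _ ?B] conjI ballI)
qed

lemma berwald_curvature:
  shows berwald_tensor: "is_tensor1 G 3 (berwald_curvature G br H)"
    and berwald_curvature_hat: "X \<in> sec_E G \<Longrightarrow> Y \<in> sec_E G \<Longrightarrow> Z \<in> sec_E G \<Longrightarrow>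
      berwald_curvature G br H [hat G X, hat G Y, hat G Z] =
      nabla_v G br (hat G X) (nabla_h G br H (hat G Y) (hat G Z))"
  using someI_ex[OF berwald_exists] berwald_hat unfolding berwald_curvature_def by auto

text \<open>The bracket with a vertical section is vertical and \<open>i\<close> is injective, so
  \<open>inv_into\<close> returns the actual preimage.\<close>

lemma lie_deriv:
  assumes P: "proj_over P X" and x: "x \<in> sec_pb G"
  shows lie_deriv_in: "lie_deriv G br P x \<in> sec_pb G"
    and i_lie_deriv: "i_map G \<circ> lie_deriv G br P x = br P (i_map G \<circ> x)"
proof -
  obtain y where y: "y \<in> sec_pb G" "br P (i_map G \<circ> x) = i_map G \<circ> y"
    using br_vertical[OF P x] by blast
  have "inj_on (\<lambda>\<xi>. i_map G \<circ> \<xi>) (sec_pb G)" using i_inj by (intro inj_onI)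
  then have "lie_deriv G br P x = y"
    unfolding lie_deriv_def y(2) using inv_into_f_f[of "\<lambda>\<xi>. i_map G \<circ> \<xi>" "sec_pb G" y] y(1) by simp
  then show "lie_deriv G br P x \<in> sec_pb G" "i_map G \<circ> lie_deriv G br P x = br P (i_map G \<circ> x)"
    using y by simp_all
qed

lemma lie_deriv_add:
  assumes P: "proj_over P X" and x: "x \<in> sec_pb G" and y: "y \<in> sec_pb G"
  shows "lie_deriv G br P (pb_add G x y) = pb_add G (lie_deriv G br P x) (lie_deriv G br P y)"
  by (rule i_inj)
    (simp_all only: lie_deriv_in[OF P] i_lie_deriv[OF P] pb_add_in x y i_add
      br_add[OF proj_overD(1)[OF P]] i_in)

lemma lie_deriv_smul:
  assumes P: "proj_over P X" and x: "x \<in> sec_pb G" and f: "f \<in> Cinf_E G"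
  shows "lie_deriv G br P (pb_smul G f x) = pb_add G (pb_smul G f (lie_deriv G br P x)) (pb_smul G (L_act P f) x)"
  by (rule i_inj)
    (simp_all only: lie_deriv_in[OF P] i_lie_deriv[OF P] pb_add_in pb_smul_in x f i_add i_smul
      br_leibniz[OF proj_overD(1)[OF P]] i_in L_act_smooth[OF proj_overD(1)[OF P]])

lemma lie_deriv_complete_hat:
  assumes \<eta>: "\<eta> \<in> sec_E G" and X: "X \<in> sec_E G"
  shows "lie_deriv G br (complete_lift G \<eta>) (hat G X) = hat G (lbr G \<eta> X)"
  by (rule i_inj)
    (simp_all only: lie_deriv_in[OF complete_lift_proj_over[OF \<eta>]] i_lie_deriv[OF complete_lift_proj_over[OF \<eta>]]
      hat_in \<eta> X lbr_in br_complete_vertical)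

lemma lie_deriv_complete_lin:
  assumes \<eta>: "\<eta> \<in> sec_E G" and x: "x \<in> sec_pb G" and g: "g \<in> lin_funs G"
  shows "g (snd (lie_deriv G br (complete_lift G \<eta>) x u)) =
    L_act (complete_lift G \<eta>) (\<lambda>v. g (snd (x v))) u - lie_lin \<eta> g (snd (x u))"
proof -
  note c = complete_lift_proj_over[OF \<eta>]
  have ig: "L_act (i_map G \<circ> x) h = (\<lambda>v. h (snd (x v)))" if "h \<in> lin_funs G" for h
    using i_act[OF x that] by auto
  have "g (snd (lie_deriv G br (complete_lift G \<eta>) x u)) = L_act (br (complete_lift G \<eta>) (i_map G \<circ> x)) g u"
    using i_act[OF lie_deriv_in[OF c x] g, of u] unfolding i_lie_deriv[OF c x] by simp
  also have "\<dots> = L_act (complete_lift G \<eta>) (\<lambda>v. g (snd (x v))) u - lie_lin \<eta> g (snd (x u))"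
    unfolding L_act_br[OF c proj_over_i[OF x] lin_smooth[OF g]] ig[OF g] complete_lift_lin[OF \<eta> g]
      ig[OF lie_lin_in[OF \<eta> g]] ..
  finally show ?thesis .
qed

text \<open>Written in \<open>g\<close>-components, both sides contain the vertical derivative of
  \<open>(\<L>\<^sub>\<eta> g)(w)\<close>. After cancelling it, the difference is the commutator of
  \<open>\<eta>\<^sup>C\<close> and the vertical lift of \<open>X\<close>, which is the vertical
  lift of \<open>[\<eta>, X]\<close>.\<close>

lemma lie_deriv_nabla_v:
  assumes \<eta>: "\<eta> \<in> sec_E G" and X: "X \<in> sec_E G" and w: "w \<in> sec_pb G"
  shows "lie_deriv G br (complete_lift G \<eta>) (nabla_v G br (hat G X) w) =
    pb_add G (nabla_v G br (hat G (lbr G \<eta> X)) w) (nabla_v G br (hat G X) (lie_deriv G br (complete_lift G \<eta>) w))"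
proof (rule sec_pb_eqI)
  note c = complete_lift_proj_over[OF \<eta>] and x = hat_in[OF X] and b = hat_in[OF lbr_in[OF \<eta> X]]
  note n = nabla_v_in[OF x w] and m = nabla_v_in[OF b w] and l = lie_deriv_in[OF c w]
  show "lie_deriv G br (complete_lift G \<eta>) (nabla_v G br (hat G X) w) \<in> sec_pb G"
    by (rule lie_deriv_in[OF c n])
  show "pb_add G (nabla_v G br (hat G (lbr G \<eta> X)) w)
      (nabla_v G br (hat G X) (lie_deriv G br (complete_lift G \<eta>) w)) \<in> sec_pb G"
    by (rule pb_add_in[OF m nabla_v_in[OF x l]])
  fix g u assume g: "g \<in> lin_funs G"
  let ?C = "L_act (complete_lift G \<eta>)" and ?X = "L_act (i_map G \<circ> hat G X)" and ?g = "\<lambda>v. g (snd (w v))"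
  have gw: "(\<lambda>v. h (snd (w v))) \<in> Cinf_E G" if "h \<in> lin_funs G" for h
    by (rule sec_pb_smooth[OF w lin_smooth[OF that]])
  have ng: "(\<lambda>v. g (snd (nabla_v G br (hat G X) w v))) = ?X ?g"
    by (rule ext) (rule nabla_v_lin[OF x w g])
  have lg: "(\<lambda>v. g (snd (lie_deriv G br (complete_lift G \<eta>) w v))) = (\<lambda>v. ?C ?g v - lie_lin \<eta> g (snd (w v)))"
    by (rule ext) (rule lie_deriv_complete_lin[OF \<eta> w g])
  have "g (snd (lie_deriv G br (complete_lift G \<eta>) (nabla_v G br (hat G X) w) u)) =
      ?C (?X ?g) u - ?X (\<lambda>v. lie_lin \<eta> g (snd (w v))) u"
    unfolding lie_deriv_complete_lin[OF \<eta> n g] ng nabla_v_lin[OF x w lie_lin_in[OF \<eta> g]] ..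
  moreover have "g (snd (nabla_v G br (hat G X) (lie_deriv G br (complete_lift G \<eta>) w) u)) =
      ?X (?C ?g) u - ?X (\<lambda>v. lie_lin \<eta> g (snd (w v))) u"
    unfolding nabla_v_lin[OF x l g] lg
    by (rule L_act_diff[OF i_in[OF x] L_act_smooth[OF proj_overD(1)[OF c] gw[OF g]] gw[OF lie_lin_in[OF \<eta> g]]])
  moreover have "g (snd (nabla_v G br (hat G (lbr G \<eta> X)) w u)) = ?C (?X ?g) u - ?X (?C ?g) u"
    unfolding nabla_v_lin[OF b w g] br_complete_vertical[OF \<eta> X, symmetric]
    by (rule L_act_br[OF c proj_over_i[OF x] gw[OF g]])
  ultimately show "g (snd (lie_deriv G br (complete_lift G \<eta>) (nabla_v G br (hat G X) w) u)) =
    g (snd (pb_add G (nabla_v G br (hat G (lbr G \<eta> X)) w)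
      (nabla_v G br (hat G X) (lie_deriv G br (complete_lift G \<eta>) w)) u))"
    unfolding lin_pb_add[OF g m nabla_v_in[OF x l]] by simp
qed

text \<open>\<open>\<eta>\<^sup>C\<close> preserves \<open>\<H>\<close>: the Berwald formula builds \<open>\<H>\<close> from complete lifts, vertical lifts
  and \<open>S\<close>, on all of which \<open>[\<eta>\<^sup>C, _]\<close> acts as \<open>[\<eta>, _]\<^sub>E\<close> or as zero.\<close>
lemma br_complete_H:
  assumes S: "S \<in> sec_L G" and B: "berwald_connection G br S H"
    and \<eta>: "\<eta> \<in> sec_E G" and sym: "br S (complete_lift G \<eta>) = L_zero G" and Y: "Y \<in> sec_E G"
  shows "br (complete_lift G \<eta>) (H (hat G Y)) = H (hat G (lbr G \<eta> Y))"
proof -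
  note C = proj_overD(1)[OF complete_lift_proj_over[OF \<eta>]]
  let ?C = "complete_lift G \<eta>"
  have Hh: "H (hat G Z) = L_smul G (\<lambda>_. 1 / 2) (L_add G (complete_lift G Z) (br (i_map G \<circ> hat G Z) S))"
    if "Z \<in> sec_E G" for Z
    using B that unfolding berwald_connection_def vertical_lift_def by blast
  have CS: "br ?C S = L_zero G"
    unfolding br_anti[OF S C] sym
    by (rule sec_L_eqI) (simp_all add: L_smul_in E.smooth_funs_const L_zero_in L_eval)
  note YC = proj_overD(1)[OF complete_lift_proj_over[OF Y]] and YV = i_in[OF hat_in[OF Y]]
  note YS = br_in[OF YV S] and BV = i_in[OF hat_in[OF lbr_in[OF \<eta> Y]]]
  have "br ?C (br (i_map G \<circ> hat G Y) S) = br (i_map G \<circ> hat G (lbr G \<eta> Y)) S"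
    unfolding br_jacobi[OF C YV S] CS br_zero[OF YV] br_complete_vertical[OF \<eta> Y]
    by (rule L_add_zero[OF br_in[OF BV S]])
  then show ?thesis
    unfolding Hh[OF Y] Hh[OF lbr_in[OF \<eta> Y]] br_const[OF C L_add_in[OF YC YS]] br_add[OF C YC YS]
      br_complete_complete[OF \<eta> Y] by simp
qed

text \<open>After applying \<open>i\<close> this is the Jacobi identity for
  \<open>\<eta>\<^sup>C\<close>, \<open>\<H>(Y)\<close> and the vertical section of
  \<open>z\<close>, with the first inner bracket evaluated by \<open>br_complete_H\<close>.\<close>

lemma lie_deriv_nabla_h:
  assumes S: "S \<in> sec_L G" and B: "berwald_connection G br S H"
    and \<eta>: "\<eta> \<in> sec_E G" and sym: "br S (complete_lift G \<eta>) = L_zero G"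
    and Y: "Y \<in> sec_E G" and z: "z \<in> sec_pb G"
  shows "lie_deriv G br (complete_lift G \<eta>) (nabla_h G br H (hat G Y) z) =
    pb_add G (nabla_h G br H (hat G (lbr G \<eta> Y)) z) (nabla_h G br H (hat G Y) (lie_deriv G br (complete_lift G \<eta>) z))"
proof (rule i_inj)
  note c = complete_lift_proj_over[OF \<eta>] and b = lbr_in[OF \<eta> Y]
  note l = lie_deriv_in[OF c z] and n = nabla_h_in[OF Y z]
  note r = nabla_h_in[OF b z] nabla_h_in[OF Y l]
  show "lie_deriv G br (complete_lift G \<eta>) (nabla_h G br H (hat G Y) z) \<in> sec_pb G"
    by (rule lie_deriv_in[OF c n])
  show "pb_add G (nabla_h G br H (hat G (lbr G \<eta> Y)) z)
    (nabla_h G br H (hat G Y) (lie_deriv G br (complete_lift G \<eta>) z)) \<in> sec_pb G" by (rule pb_add_in[OF r])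
  show "i_map G \<circ> lie_deriv G br (complete_lift G \<eta>) (nabla_h G br H (hat G Y) z) =
    i_map G \<circ> pb_add G (nabla_h G br H (hat G (lbr G \<eta> Y)) z)
      (nabla_h G br H (hat G Y) (lie_deriv G br (complete_lift G \<eta>) z))"
    unfolding i_add[OF r] i_nabla_h[OF b z] i_nabla_h[OF Y l] i_lie_deriv[OF c n] i_lie_deriv[OF c z]
      i_nabla_h[OF Y z] br_jacobi[OF proj_overD(1)[OF c] H_in[OF hat_in[OF Y]] i_in[OF z]]
      br_complete_H[OF S B \<eta> sym Y] ..
qed

section \<open>The Lie derivative of the Berwald curvature\<close>

lemma tensor_deriv3:
  "tensor_deriv G D A [x, y, z] = pb_add G (D (A [x, y, z])) (pb_smul G (\<lambda>_. - 1)
    (pb_add G (A [D x, y, z]) (pb_add G (A [x, D y, z]) (pb_add G (A [x, y, D z]) (pb_zero G)))))"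
  by (simp add: tensor_deriv_def numeral_2_eq_2 upt_conv_Cons)

lemma berwald_collineation:
  assumes S: "S \<in> sec_L G" and Bc: "berwald_connection G br S H"
    and \<eta>: "\<eta> \<in> sec_E G" and sym: "br S (complete_lift G \<eta>) = L_zero G"
  shows "curvature_collineation G br 3 (berwald_curvature G br H) (complete_lift G \<eta>)"
proof -
  note c = complete_lift_proj_over[OF \<eta>]
  let ?C = "complete_lift G \<eta>" and ?B = "berwald_curvature G br H"
  let ?L = "lie_deriv G br ?C"
  note Lin = lie_deriv_in[OF c] and Bin = is_tensor3_in[OF berwald_tensor]
  \<comment> \<open>One component of the Lie derivative at one point, so that each slot can be
    treated as a pointwise linear functional.\<close>
  define T where "T g u x y z = g (snd (?L (?B [x, y, z]) u)) - g (snd (?B [?L x, y, z] u))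
    - g (snd (?B [x, ?L y, z] u)) - g (snd (?B [x, y, ?L z] u))"
    for g :: "'e \<Rightarrow> real" and u x y z
  have deriv: "tensor_deriv G ?L ?B [x, y, z] \<in> sec_pb G"
    "g \<in> lin_funs G \<Longrightarrow> g (snd (tensor_deriv G ?L ?B [x, y, z] u)) = T g u x y z"
    if "x \<in> sec_pb G" "y \<in> sec_pb G" "z \<in> sec_pb G" for g u x y z
    unfolding tensor_deriv3 T_def
    by (simp_all add: that pb_add_in pb_smul_in pb_zero_in Lin Bin E.smooth_funs_const
        lin_pb_add lin_pb_smul lin_pb_zero)
  note simps = pb_add_in pb_smul_in Lin Bin is_tensor3_add[OF berwald_tensor]
    is_tensor3_smul[OF berwald_tensor] lie_deriv_smul[OF c] lie_deriv_add[OF c]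
    lin_pb_add lin_pb_smul L_act_smooth[OF proj_overD(1)[OF c]]
  \<comment> \<open>Multiplying the slot by \<open>f\<close> adds the derivative of \<open>f\<close>
    along \<open>\<eta>\<^sup>C\<close> times \<open>\<B>\<close> twice, once from the first term
    and once from the term that differentiates this slot; the two cancel.\<close>
  have T1: "linear_at_pb u (\<lambda>x. T g u x y z)" if "g \<in> lin_funs G" "y \<in> sec_pb G" "z \<in> sec_pb G" for g u y z
    unfolding linear_at_pb_def T_def using that by (simp add: simps algebra_simps)
  have T2: "linear_at_pb u (\<lambda>y. T g u x y z)" if "g \<in> lin_funs G" "x \<in> sec_pb G" "z \<in> sec_pb G" for g u x z
    unfolding linear_at_pb_def T_def using that by (simp add: simps algebra_simps)
  have T3: "linear_at_pb u (\<lambda>z. T g u x y z)" if "g \<in> lin_funs G" "x \<in> sec_pb G" "y \<in> sec_pb G" for g u x y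
    unfolding linear_at_pb_def T_def using that by (simp add: simps algebra_simps)
  have T_hat: "T g u (hat G X) (hat G Y) (hat G Z) = 0"
    if g: "g \<in> lin_funs G" and XYZ: "X \<in> sec_E G" "Y \<in> sec_E G" "Z \<in> sec_E G" for g u X Y Z
  proof -
    note x = hat_in[OF XYZ(1)] and z = hat_in[OF XYZ(3)]
    note b = lbr_in[OF \<eta> XYZ(1)] lbr_in[OF \<eta> XYZ(2)] lbr_in[OF \<eta> XYZ(3)]
    let ?w = "nabla_h G br H (hat G Y) (hat G Z)"
    note w = nabla_h_in[OF XYZ(2) z] nabla_h_in[OF b(2) z] nabla_h_in[OF XYZ(2) hat_in[OF b(3)]]
    \<comment> \<open>Commuting the Lie derivation past both differentials leaves three terms, with
      \<open>[\<eta>, _]\<close> applied to \<open>X\<close>, \<open>Y\<close> and \<open>Z\<close>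
      in turn; they are exactly the three terms subtracted in \<open>T\<close>.\<close>
    have "?L ?w = pb_add G (nabla_h G br H (hat G (lbr G \<eta> Y)) (hat G Z)) (nabla_h G br H (hat G Y) (hat G (lbr G \<eta> Z)))"
      unfolding lie_deriv_nabla_h[OF S Bc \<eta> sym XYZ(2) z] lie_deriv_complete_hat[OF \<eta> XYZ(3)] ..
    then have "g (snd (nabla_v G br (hat G X) (?L ?w) u)) =
        g (snd (nabla_v G br (hat G X) (nabla_h G br H (hat G (lbr G \<eta> Y)) (hat G Z)) u)) +
        g (snd (nabla_v G br (hat G X) (nabla_h G br H (hat G Y) (hat G (lbr G \<eta> Z))) u))"
      using L_act_sum[OF i_in[OF x] sec_pb_smooth[OF w(2) lin_smooth[OF g]] sec_pb_smooth[OF w(3) lin_smooth[OF g]]]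
      by (simp add: nabla_v_lin[OF x _ g] w pb_add_in lin_pb_add[OF g])
    moreover have "g (snd (?L (nabla_v G br (hat G X) ?w) u)) =
        g (snd (nabla_v G br (hat G (lbr G \<eta> X)) ?w u)) + g (snd (nabla_v G br (hat G X) (?L ?w) u))"
      unfolding lie_deriv_nabla_v[OF \<eta> XYZ(1) w(1)]
      by (rule lin_pb_add[OF g nabla_v_in[OF hat_in[OF b(1)] w(1)] nabla_v_in[OF x Lin[OF w(1)]]])
    ultimately show ?thesis
      unfolding T_def
      by (simp add: lie_deriv_complete_hat \<eta> XYZ b berwald_curvature_hat)
  qed
  have T0: "T g u x y z = 0"
    if g: "g \<in> lin_funs G" and xyz: "x \<in> sec_pb G" "y \<in> sec_pb G" "z \<in> sec_pb G" for g u x y z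
  proof -
    \<comment> \<open>Basic arguments are released one slot at a time: \<open>z\<close> first, with
      the other two still basic, then \<open>y\<close>, then \<open>x\<close>.\<close>
    have "T g u (hat G X) y z = 0" if X: "X \<in> sec_E G" for X
    proof -
      have "T g u (hat G X) (hat G Y) z = 0" if Y: "Y \<in> sec_E G" for Y
        by (rule linear_at_pb_zero[OF T3[OF g hat_in[OF X] hat_in[OF Y]] T_hat[OF g X Y] xyz(3)])
      then show ?thesis by (rule linear_at_pb_zero[OF T2[OF g hat_in[OF X] xyz(3)] _ xyz(2)])
    qed
    then show ?thesis by (rule linear_at_pb_zero[OF T1[OF g xyz(2,3)] _ xyz(1)])
  qed
  have "tensor_deriv G ?L ?B xs = pb_zero G" if xs: "length xs = 3 \<and> set xs \<subseteq> sec_pb G" for xs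
  proof -
    obtain x y z where e: "xs = [x, y, z]" using xs length3E by blast
    have xyz: "x \<in> sec_pb G" "y \<in> sec_pb G" "z \<in> sec_pb G" using xs e by auto
    show ?thesis
      unfolding e
      by (rule sec_pb_eqI) (simp_all add: deriv[OF xyz] T0 xyz pb_zero_in lin_pb_zero)
  qed
  moreover have "projectable G ?C"
    unfolding projectable_def using c unfolding proj_over_def by (auto simp: fun_eq_iff)
  ultimately show ?thesis
    unfolding curvature_collineation_def using berwald_tensor by simp
qed

end

theorem theorem4p7:
  fixes G :: "('m::{t2_space,second_countable_topology},
               'e::{t2_space,second_countable_topology},
               'a::real_inner, 'b::real_inner) algebroid"
    and br :: "'e L_bracket"
    and S :: "'e \<Rightarrow> 'e \<times> 'e tvec"
    and H :: "('e \<Rightarrow> 'e \<times> 'e) \<Rightarrow> 'e \<Rightarrow> 'e \<times> 'e tvec"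
    and \<eta> :: "'m \<Rightarrow> 'e"
  assumes "lie_algebroid G"
    and "prolongation_bracket G br"
    and "spray G br S"
    and "berwald_connection G br S H"
    and "lie_symmetry G br S \<eta>"
  shows "curvature_collineation G br 3 (berwald_curvature G br H) (complete_lift G \<eta>)"
proof -
  interpret prolongation_split G br H
    using assms(1,2,4) unfolding berwald_connection_def by unfold_locales blast+
  show ?thesis
    using assms(3,4,5) unfolding spray_def semispray_def lie_symmetry_def
    by (intro berwald_collineation) blast+
qed

end
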